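(* Let $R$ be a hyperbolic Bessel process of index $\alpha\ge-\frac12$ starting from $x\ge0$, and let $t>0$. Then for every $\lambda>0$, $$\mathbb{E}\exp(-\lambda\cosh R_t)=\frac{\sqrt{2\pi}}{\sqrt t}\,e^{-\frac{a^2t}{2}}\,\mathbb{E}\Bigl(\mathbf 1_{\{V_t\ge|B_t|\}}\,V_t\,h_t(B_t,x)\,J_0\bigl(\lambda\phi(B_t,V_t)\bigr)\Bigr),$$ where $a=\alpha+\frac12$, $J_0$ is the Bessel function of the first kind of order $0$, $$h_t(z,x)=\exp\Bigl(\frac{z^2}{2t}+az-\lambda\cosh(x)e^{z}\Bigr),\qquad \phi(v,z)=\sqrt2\,e^{v/2}(\cosh z-\cosh v)^{1/2}\ \text{ for } z\ge|v|,$$ and $V,B$ are two independent standard Brownian motions.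
   Context: Hyperbolic Bessel process. On a filtered probability space satisfying the usual conditions and carrying a standard Brownian motion $B$, a hyperbolic Bessel process of index $\alpha$ starting from $x\ge 0$ is defined as follows. For $\alpha\in(-\frac12,\infty)$ it is the nonnegative diffusion $R$ with $R_t=x+B_t+(\alpha+\frac12)\int_0^t\coth R_u\,du$; for $\alpha\in(-\frac12,0)$ the point $0$ is instantaneously reflecting and the equation is understood as $dR_t=dB_t+(\alpha+\frac12)\mathbf{1}_{\{R_t\ne0\}}\coth R_t\,dt$, $R_0=x$. For $\alpha=-\frac12$ it is $R_t=|x+B_t|$. (The Brownian motions $V,B$ on the right-hand side of the claim need not be related to the one driving $R$.) *)

theory Defs
  imports "HOL-Probability.Probability"
begin

section \<open>Filtrations and Brownian motion\<close>

text \<open>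
  Time is the half-line \<open>[0, \<infinity>)\<close>, represented by the nonnegative reals. The values of filtrations
  and processes at negative times are irrelevant; clamping the index at \<open>0\<close> lets
  \<^locale>\<open>filtration\<close> speak about nonnegative times only.
\<close>

definition filtered_prob_space :: "'a measure \<Rightarrow> (real \<Rightarrow> 'a measure) \<Rightarrow> bool" where
  "filtered_prob_space M F \<longleftrightarrow>
     prob_space M \<and> filtration (space M) (\<lambda>t. F (max 0 t)) \<and> (\<forall>t\<ge>0. sets (F t) \<subseteq> sets M)"

definition usual_conditions :: "'a measure \<Rightarrow> (real \<Rightarrow> 'a measure) \<Rightarrow> bool" where
  "usual_conditions M F \<longleftrightarrow>
     complete_measure M \<and> null_sets M \<subseteq> sets (F 0) \<and>
     (\<forall>t\<ge>0. sets (F t) = (\<Inter>s\<in>{t<..}. sets (F s)))"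

definition adapted_process :: "(real \<Rightarrow> 'a measure) \<Rightarrow> (real \<Rightarrow> 'a \<Rightarrow> real) \<Rightarrow> bool" where
  "adapted_process F X \<longleftrightarrow> (\<forall>t\<ge>0. X t \<in> borel_measurable (F t))"

definition brownian_motion_wrt ::
    "'a measure \<Rightarrow> (real \<Rightarrow> 'a measure) \<Rightarrow> (real \<Rightarrow> 'a \<Rightarrow> real) \<Rightarrow> bool" where
  "brownian_motion_wrt M F B \<longleftrightarrow>
     filtered_prob_space M F \<and> adapted_process F B \<and>
     (AE \<omega> in M. B 0 \<omega> = 0) \<and>
     (AE \<omega> in M. continuous_on {0..} (\<lambda>t. B t \<omega>)) \<and>
     (\<forall>s t. 0 \<le> s \<longrightarrow> s < t \<longrightarrow>
        distributed M lborel (\<lambda>\<omega>. B t \<omega> - B s \<omega>) (normal_density 0 (sqrt (t - s))) \<and>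
        prob_space.indep_set M (sets (F s))
          (sets (vimage_algebra (space M) (\<lambda>\<omega>. B t \<omega> - B s \<omega>) borel)))"

definition natural_filtration ::
    "'a measure \<Rightarrow> (real \<Rightarrow> 'a \<Rightarrow> real) \<Rightarrow> real \<Rightarrow> 'a measure" where
  "natural_filtration M X t =
     sigma (space M) (\<Union>u\<in>{0..t}. sets (vimage_algebra (space M) (X u) borel))"

definition standard_brownian_motion :: "'a measure \<Rightarrow> (real \<Rightarrow> 'a \<Rightarrow> real) \<Rightarrow> bool" where
  "standard_brownian_motion M B \<longleftrightarrow> brownian_motion_wrt M (natural_filtration M B) B"

definition indep_processes ::
    "'a measure \<Rightarrow> (real \<Rightarrow> 'a \<Rightarrow> real) \<Rightarrow> (real \<Rightarrow> 'a \<Rightarrow> real) \<Rightarrow> bool" where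
  "indep_processes M X Y \<longleftrightarrow>
     prob_space.indep_var M
       (\<Pi>\<^sub>M t\<in>{0..}. borel) (\<lambda>\<omega>. \<lambda>t\<in>{0..}. X t \<omega>)
       (\<Pi>\<^sub>M t\<in>{0..}. borel) (\<lambda>\<omega>. \<lambda>t\<in>{0..}. Y t \<omega>)"

section \<open>Hyperbolic Bessel processes\<close>

definition coth :: "real \<Rightarrow> real" where
  "coth r = cosh r / sinh r"

definition solves_drift_equation ::
    "'a measure \<Rightarrow> (real \<Rightarrow> 'a \<Rightarrow> real) \<Rightarrow> (real \<Rightarrow> real) \<Rightarrow> real \<Rightarrow> (real \<Rightarrow> 'a \<Rightarrow> real) \<Rightarrow> bool" where
  "solves_drift_equation M B b x R \<longleftrightarrow>
     (AE \<omega> in M. \<forall>t\<ge>0.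
        set_integrable lborel {0..t} (\<lambda>u. b (R u \<omega>)) \<and>
        R t \<omega> = x + B t \<omega> + (LBINT u:{0..t}. b (R u \<omega>)))"

definition null_time_at_zero :: "'a measure \<Rightarrow> (real \<Rightarrow> 'a \<Rightarrow> real) \<Rightarrow> bool" where
  "null_time_at_zero M R \<longleftrightarrow> (AE \<omega> in M. AE u in lborel. 0 \<le> u \<longrightarrow> R u \<omega> \<noteq> 0)"

text \<open>
  For \<open>-1/2 < \<alpha> < 0\<close>, \<^const>\<open>null_time_at_zero\<close> says that \<open>0\<close> is instantaneously reflecting. For
  \<open>\<alpha> \<ge> 0\<close> it expresses that the integrand \<open>coth R\<^sub>u\<close>, which is infinite at \<open>R\<^sub>u = 0\<close>, is defined for
  almost all \<open>u\<close>; it has to be stated because \<open>coth 0 = 0\<close> in HOL.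
\<close>

definition hyperbolic_bessel_process ::
    "'a measure \<Rightarrow> (real \<Rightarrow> 'a measure) \<Rightarrow> (real \<Rightarrow> 'a \<Rightarrow> real) \<Rightarrow> real \<Rightarrow> real \<Rightarrow>
     (real \<Rightarrow> 'a \<Rightarrow> real) \<Rightarrow> bool" where
  "hyperbolic_bessel_process M F B \<alpha> x R \<longleftrightarrow>
     adapted_process F R \<and>
     (AE \<omega> in M. continuous_on {0..} (\<lambda>t. R t \<omega>) \<and> (\<forall>t\<ge>0. 0 \<le> R t \<omega>)) \<and>
     (if \<alpha> = - 1 / 2 then
        AE \<omega> in M. \<forall>t\<ge>0. R t \<omega> = \<bar>x + B t \<omega>\<bar>
      else if \<alpha> < 0 then
        null_time_at_zero M R \<and>
        solves_drift_equation M B (\<lambda>r. (\<alpha> + 1 / 2) * (of_bool (r \<noteq> 0) * coth r)) x R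
      else
        null_time_at_zero M R \<and>
        solves_drift_equation M B (\<lambda>r. (\<alpha> + 1 / 2) * coth r) x R)"

section \<open>The functions in the formula\<close>

definition bessel_J :: "nat \<Rightarrow> real \<Rightarrow> real" where
  "bessel_J n z = (\<Sum>k. (- 1) ^ k / (fact k * fact (k + n)) * (z / 2) ^ (2 * k + n))"

definition bessel_h :: "real \<Rightarrow> real \<Rightarrow> real \<Rightarrow> real \<Rightarrow> real \<Rightarrow> real" where
  "bessel_h a l t z x = exp (z\<^sup>2 / (2 * t) + a * z - l * cosh x * exp z)"

definition bessel_phi :: "real \<Rightarrow> real \<Rightarrow> real" where
  "bessel_phi v z = sqrt 2 * exp (v / 2) * sqrt (cosh z - cosh v)"

end

theory Submission
  imports Defs "HOL-Real_Asymp.Real_Asymp"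
begin

text \<open>
  \<^bold>\<open>Why the formula holds.\<close>
  Write \<open>f\<^sub>\<theta>(y) = exp (- \<theta> y)\<close> and \<open>Y\<^sub>t = cosh R\<^sub>t\<close>. The generator of \<open>R\<close> maps \<open>f\<^sub>\<theta>(cosh r)\<close> to
  \<open>(\<theta>\<^sup>2/2 (y\<^sup>2 - 1) - (a + 1/2) \<theta> y) f\<^sub>\<theta>(y)\<close> at \<open>y = cosh r\<close> (the function \<open>exp_generator\<close>). The same
  function arises when the operator \<open>\<theta>\<^sup>2/2 \<partial>\<^sup>2 + (a + 1/2) \<theta> \<partial> - \<theta>\<^sup>2/2\<close> acts on \<open>f\<^sub>\<theta>(y)\<close> in the variable \<open>\<theta>\<close>.
  This duality turns the evolution of the law of \<open>R\<close> into an equation in the Laplace variable alone.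
  With \<open>\<theta> = l exp z\<close> and after multiplication by \<open>exp (a z)\<close> the dual operator is, up to the constant
  \<open>- a\<^sup>2/2\<close>, one half of the Schroedinger operator \<open>H = \<partial>\<^sub>z\<^sup>2 - l\<^sup>2 exp (2 z)\<close>.

  The heat flow of \<open>H/2\<close> is recovered from the wave equation \<open>D\<^sub>v\<^sub>v = H D\<close> by averaging over the first
  hitting time density of the level \<open>v\<close> by a Brownian motion. The Riemann function of this wave equation is
  \<open>J\<^sub>0 (l \<phi>(z, v))\<close>, which is where the Bessel function in the statement comes from. The factor \<open>V\<^sub>t\<close>, the
  prefactor \<open>sqrt (2 \<pi> / t)\<close>, the Gaussian densities of \<open>V\<^sub>t\<close> and \<open>B\<^sub>t\<close> and the term \<open>exp (z\<^sup>2/2t)\<close> in \<open>h\<close> multiply to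
  the hitting density (\<open>hitting_density_normal\<close>).

  \<^bold>\<open>How it is proved.\<close>
  Both sides of the formula are compared after a Laplace transform in time.

  \<^item> For a smooth \<open>F\<close> the integrals of \<open>F\<close> against the Riemann function over \<open>[- v, v]\<close> satisfy
    \<open>D[F]'' = D[H F]\<close>; hence the Laplace transform in \<open>v\<close> of \<open>s\<^sup>2 D[F] - D[H F]\<close> is \<open>2 F 0\<close>
    (\<open>wave_average_laplace\<close>). For \<open>F z = exp (a z - l y exp z)\<close> the duality makes \<open>H F\<close> explicit, which gives an
    identity in the single parameter \<open>y \<ge> 1\<close> (\<open>wave_duality\<close>).
  \<^item> Ito's formula in expectation (\<open>weak_ito\<close>) says that the mean of \<open>f\<^sub>\<theta>(Y\<^sub>t)\<close> changes at the rate given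
    by the mean of \<open>exp_generator\<close> (\<open>cosh_laplace_evolution\<close>). It is obtained by discretising the path: the Gaussian
    part of each step is expanded to second order, and the effect of the drift converges along almost every path.
    The drift \<open>coth R\<close> is singular, so its integrability in mean has to be proved; this is done by first using the
    test function \<open>arctan\<close>, whose derivative is positive.
  \<^item> Putting \<open>y = Y\<^sub>t\<close> in \<open>wave_duality\<close> and averaging over the path and over an independent exponential time gives
    the Laplace transform in time of the left-hand side (\<open>cosh_laplace_time_transform\<close>). That of the
    right-hand side is the same integral, because \<open>exp (- s v)\<close> is the Laplace transform of the hitting density
    (\<open>hitting_density_laplace\<close>, \<open>hitting_average_laplace\<close>).
  \<^item> Both sides are continuous in \<open>t\<close>, and Laplace transforms determine continuous functions
    (\<open>laplace_transform_unique\<close>).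
\<close>

section \<open>Integrals\<close>

lemma abs_integral_le:
  fixes f g :: "'a \<Rightarrow> real"
  assumes "integrable M f" "integrable M g" "\<And>x. x \<in> space M \<Longrightarrow> \<bar>f x\<bar> \<le> g x"
  shows "\<bar>integral\<^sup>L M f\<bar> \<le> integral\<^sup>L M g"
proof -
  have "norm (integral\<^sup>L M f) \<le> (\<integral>x. norm (f x) \<partial>M)" by (rule integral_norm_bound)
  also have "\<dots> \<le> integral\<^sup>L M g"
    by (intro integral_mono integrable_norm assms(1,2)) (simp add: assms(3))
  finally show ?thesis by simp
qed

lemma integrable_dominated:
  fixes f g :: "'a \<Rightarrow> real"
  assumes "integrable M g" "f \<in> borel_measurable M" "\<And>x. x \<in> space M \<Longrightarrow> \<bar>f x\<bar> \<le> g x"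
  shows "integrable M f"
  using assms(1,2)
proof (rule Bochner_Integration.integrable_bound)
  show "AE x in M. norm (f x) \<le> norm (g x)"
    unfolding real_norm_def by (intro AE_I2 order_trans[OF assms(3) abs_ge_self])
qed

lemma integrable_on_interval: "integrable lborel (\<lambda>z. indicator {u..v :: real} z * (c :: real))"
  by (intro integrable_mult_left integrable_real_indicator) (auto simp: emeasure_lborel_Icc_eq)

section \<open>The Bessel function of order zero in the squared argument\<close>

text \<open>
  \<open>J\<^sub>0 z\<close> is an entire function of \<open>z\<^sup>2\<close>. Working with that function keeps everything smooth on the
  characteristics \<open>\<bar>z\<bar> = v\<close>, where \<open>\<phi>\<close> vanishes like a square root.
\<close>

definition bessel_sq :: "real \<Rightarrow> real" where
  "bessel_sq y = (\<Sum>k. ((- 1 / 4) ^ k / (fact k)\<^sup>2) * y ^ k)"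

definition bessel_sq' :: "real \<Rightarrow> real" where
  "bessel_sq' y = (\<Sum>k. diffs (\<lambda>k. (- 1 / 4) ^ k / (fact k)\<^sup>2) k * y ^ k)"

definition bessel_sq'' :: "real \<Rightarrow> real" where
  "bessel_sq'' y = (\<Sum>k. diffs (diffs (\<lambda>k. (- 1 / 4) ^ k / (fact k)\<^sup>2)) k * y ^ k)"

lemma bessel_J_0_eq: "bessel_J 0 z = bessel_sq (z\<^sup>2)"
  unfolding bessel_J_def bessel_sq_def
proof (intro suminf_cong)
  fix k
  have "(z / 2) ^ (2 * k) = (z\<^sup>2 / 4) ^ k"
    unfolding power_mult by (simp add: power_divide)
  also have "(- 1) ^ k * \<dots> = (- 1 / 4) ^ k * (z\<^sup>2) ^ k"
    by (simp flip: power_mult_distrib)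
  finally show "(- 1) ^ k / (fact k * fact (k + 0)) * (z / 2) ^ (2 * k + 0) =
      (- 1 / 4) ^ k / (fact k)\<^sup>2 * (z\<^sup>2) ^ k"
    by (simp add: power2_eq_square divide_simps)
qed
lemma bessel_sq_0 [simp]: "bessel_sq 0 = 1"
  using powser_zero[of "\<lambda>k. (- 1 / 4 :: real) ^ k / (fact k)\<^sup>2"] by (simp add: bessel_sq_def)

lemma bessel_sq_summable: "summable (\<lambda>k. ((- 1 / 4 :: real) ^ k / (fact k)\<^sup>2) * y ^ k)"
proof (rule summable_comparison_test_ev)
  show "summable (\<lambda>k. inverse (fact k) * \<bar>y\<bar> ^ k)"
    by (rule summable_exp)
  have "norm ((- 1 / 4 :: real) ^ k / (fact k)\<^sup>2 * y ^ k) \<le> inverse (fact k) * \<bar>y\<bar> ^ k" for k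
  proof -
    have f: "(fact k :: real) \<ge> 1" by (rule fact_ge_1)
    have "\<bar>(- 1 / 4 :: real) ^ k\<bar> \<le> 1"
      unfolding power_abs by (rule power_le_one) auto
    moreover have "(fact k :: real) \<le> (fact k)\<^sup>2"
      using f by (simp add: power2_eq_square)
    ultimately have "\<bar>(- 1 / 4 :: real) ^ k\<bar> / (fact k)\<^sup>2 \<le> 1 / fact k"
      using f by (intro frac_le) auto
    then have "\<bar>(- 1 / 4 :: real) ^ k\<bar> / (fact k)\<^sup>2 * \<bar>y\<bar> ^ k \<le> 1 / fact k * \<bar>y\<bar> ^ k"
      by (intro mult_right_mono) auto
    then show ?thesis by (simp add: abs_mult power_abs inverse_eq_divide)
  qed
  then show "\<forall>\<^sub>F k in sequentially. norm ((- 1 / 4 :: real) ^ k / (fact k)\<^sup>2 * y ^ k) \<le> inverse (fact k) * \<bar>y\<bar> ^ k"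
    by simp
qed

lemma bessel_sq_deriv: "(bessel_sq has_real_derivative bessel_sq' y) (at y)"
  unfolding bessel_sq'_def bessel_sq_def[abs_def]
  by (rule termdiffs_strong_converges_everywhere) (rule bessel_sq_summable)

lemma bessel_sq'_deriv: "(bessel_sq' has_real_derivative bessel_sq'' y) (at y)"
  unfolding bessel_sq'_def[abs_def] bessel_sq''_def
  by (rule termdiffs_strong_converges_everywhere)
    (rule termdiff_converges_all, rule bessel_sq_summable)

lemma isCont_bessel_sq'': "isCont bessel_sq'' y"
proof -
  have "summable (\<lambda>k. diffs (diffs (\<lambda>k. (- 1 / 4 :: real) ^ k / (fact k)\<^sup>2)) k * x ^ k)" for x
    by (intro termdiff_converges_all bessel_sq_summable)
  then show ?thesis
    unfolding bessel_sq''_def[abs_def]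
    by (intro DERIV_isCont[OF termdiffs_strong_converges_everywhere])
qed

text \<open>Bessel's equation of order zero, written in the squared argument.\<close>

lemma bessel_sq_ode: "y * bessel_sq'' y + bessel_sq' y + bessel_sq y / 4 = 0"
proof -
  let ?c = "\<lambda>k. (- 1 / 4 :: real) ^ k / (fact k)\<^sup>2"
  have s1: "summable (\<lambda>k. diffs ?c k * y ^ k)" for y
    by (intro termdiff_converges_all bessel_sq_summable)
  have s2: "summable (\<lambda>k. diffs (diffs ?c) k * y ^ k)"
    by (intro termdiff_converges_all s1)
  have "(\<lambda>k. y * (diffs (diffs ?c) k * y ^ k)) sums (y * bessel_sq'' y)"
    unfolding bessel_sq''_def by (intro sums_mult summable_sums s2)
  then have "(\<lambda>k. real (Suc k) * diffs ?c (Suc k) * y ^ Suc k) sums (y * bessel_sq'' y)"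
    unfolding diffs_def[of "diffs ?c"] by (simp add: mult_ac)
  then have "(\<lambda>k. real k * diffs ?c k * y ^ k) sums (y * bessel_sq'' y)"
    using sums_Suc_iff[of "\<lambda>k. real k * diffs ?c k * y ^ k" "y * bessel_sq'' y"] by simp
  moreover have "(\<lambda>k. diffs ?c k * y ^ k) sums bessel_sq' y"
    unfolding bessel_sq'_def by (intro summable_sums s1)
  moreover have "(\<lambda>k. ?c k * y ^ k / 4) sums (bessel_sq y / 4)"
    unfolding bessel_sq_def by (intro sums_divide summable_sums bessel_sq_summable)
  ultimately have "(\<lambda>k. real k * diffs ?c k * y ^ k + diffs ?c k * y ^ k + ?c k * y ^ k / 4) sums
      (y * bessel_sq'' y + bessel_sq' y + bessel_sq y / 4)"
    by (intro sums_add)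
  moreover have "real k * diffs ?c k * y ^ k + diffs ?c k * y ^ k + ?c k * y ^ k / 4 = 0" for k
  proof -
    have "diffs ?c k * (real k + 1) = - ?c k / 4"
    proof -
      have "(fact (Suc k) :: real) = (real k + 1) * fact k" by simp
      moreover have "real k + 1 > 0" "(fact k :: real) > 0" by simp_all
      ultimately show ?thesis
        unfolding diffs_def by (simp add: power_mult_distrib) (simp add: divide_simps power2_eq_square)
    qed
    then have "(diffs ?c k * (real k + 1) + ?c k / 4) * y ^ k = 0" by simp
    then show ?thesis by (simp add: algebra_simps)
  qed
  ultimately have "(\<lambda>k. 0 :: real) sums (y * bessel_sq'' y + bessel_sq' y + bessel_sq y / 4)"
    by simp
  then show ?thesis
    by (rule sums_unique2) (rule sums_zero)
qed

text \<open>
  An energy argument: by Bessel's equation \<open>J\<^sub>0'\<^sup>2 + J\<^sub>0\<^sup>2\<close> decreases from its value \<open>1\<close> at the origin. In the squared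
  argument \<open>y\<close> this energy reads \<open>4 y j'(y)\<^sup>2 + j(y)\<^sup>2\<close>.
\<close>

lemma abs_bessel_sq_le_1:
  assumes "0 \<le> y"
  shows "\<bar>bessel_sq y\<bar> \<le> 1"
proof -
  let ?E = "\<lambda>y. 4 * y * (bessel_sq' y)\<^sup>2 + (bessel_sq y)\<^sup>2"
  have "?E y \<le> ?E 0"
  proof (rule DERIV_nonpos_imp_nonincreasing[OF assms])
    fix u :: real
    assume "0 \<le> u"
    have "(?E has_real_derivative (4 * (bessel_sq' u)\<^sup>2 + 8 * u * bessel_sq' u * bessel_sq'' u + 2 * bessel_sq u * bessel_sq' u)) (at u)"
      by (auto intro!: derivative_eq_intros bessel_sq_deriv bessel_sq'_deriv simp: power2_eq_square)
    moreover have "4 * (bessel_sq' u)\<^sup>2 + 8 * u * bessel_sq' u * bessel_sq'' u + 2 * bessel_sq u * bessel_sq' u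
       = - 4 * (bessel_sq' u)\<^sup>2"
      using bessel_sq_ode[of u] by algebra
    ultimately show "\<exists>d. DERIV ?E u :> d \<and> d \<le> 0"
      by (metis mult_nonpos_nonneg neg_le_0_iff_le zero_le_numeral zero_le_power2)
  qed
  moreover have "?E 0 = 1" by simp
  moreover have "0 \<le> 4 * y * (bessel_sq' y)\<^sup>2" using assms by simp
  ultimately have "(bessel_sq y)\<^sup>2 \<le> 1" by linarith
  then show ?thesis by (simp add: abs_square_le_1)
qed


section \<open>The Riemann function of the wave equation with exponential potential\<close>

lemma cosh_sinh_measurable [measurable]:
  "(cosh :: real \<Rightarrow> real) \<in> borel_measurable borel" "(sinh :: real \<Rightarrow> real) \<in> borel_measurable borel"
  by (intro borel_measurable_continuous_onI continuous_intros)+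

text \<open>\<open>(l \<phi>(z, v))\<^sup>2\<close>, extended by the same formula beyond the characteristics, where it becomes negative.\<close>

definition wave_arg :: "real \<Rightarrow> real \<Rightarrow> real \<Rightarrow> real" where
  "wave_arg l v z = l\<^sup>2 * (2 * exp z * cosh v - exp z ^ 2 - 1)"

definition wave_kernel :: "real \<Rightarrow> real \<Rightarrow> real \<Rightarrow> real" where
  "wave_kernel l v z = bessel_sq (wave_arg l v z)"

lemma cosh_exp: "2 * exp z * cosh z = exp z ^ 2 + (1 :: real)"
  by (simp add: cosh_field_def power2_eq_square exp_minus field_simps)

lemma wave_arg_factor: "wave_arg l v z = 2 * l\<^sup>2 * exp z * (cosh v - cosh z)"
  using cosh_exp[of z] unfolding wave_arg_def by algebra

lemma wave_arg_nonneg: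
  assumes "\<bar>z\<bar> \<le> v" shows "0 \<le> wave_arg l v z"
proof -
  have "cosh \<bar>z\<bar> \<le> cosh v"
    using assms by (subst cosh_real_nonneg_le_iff) auto
  then show ?thesis unfolding wave_arg_factor by auto
qed

lemma abs_wave_kernel_le_1: "\<bar>z\<bar> \<le> v \<Longrightarrow> \<bar>wave_kernel l v z\<bar> \<le> 1"
  unfolding wave_kernel_def by (intro abs_bessel_sq_le_1 wave_arg_nonneg)

lemma wave_kernel_eq_bessel_J:
  assumes "\<bar>z\<bar> \<le> v"
  shows "bessel_J 0 (l * bessel_phi z v) = wave_kernel l v z"
proof -
  have "cosh \<bar>z\<bar> \<le> cosh v"
    using assms by (subst cosh_real_nonneg_le_iff) auto
  then have "(l * bessel_phi z v)\<^sup>2 = wave_arg l v z"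
    unfolding wave_arg_factor bessel_phi_def
    by (simp add: power_mult_distrib flip: exp_double)
  then show ?thesis
    by (simp add: bessel_J_0_eq wave_kernel_def)
qed

lemma wave_arg_diagonal [simp]: "wave_arg l v v = 0" "wave_arg l v (- v) = 0"
  by (simp_all add: wave_arg_factor)

text \<open>
  The following five functions are the partial derivatives of the kernel in the variables that their names show.
\<close>

definition wave_kernel_v :: "real \<Rightarrow> real \<Rightarrow> real \<Rightarrow> real" where
  "wave_kernel_v l v z = bessel_sq' (wave_arg l v z) * (2 * l\<^sup>2 * (exp z * sinh v))"

definition wave_kernel_z :: "real \<Rightarrow> real \<Rightarrow> real \<Rightarrow> real" where
  "wave_kernel_z l v z = bessel_sq' (wave_arg l v z) * (2 * l\<^sup>2 * (exp z * cosh v - exp z ^ 2))"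

definition wave_kernel_vv :: "real \<Rightarrow> real \<Rightarrow> real \<Rightarrow> real" where
  "wave_kernel_vv l v z = bessel_sq'' (wave_arg l v z) * (2 * l\<^sup>2 * (exp z * sinh v))\<^sup>2
     + bessel_sq' (wave_arg l v z) * (2 * l\<^sup>2 * (exp z * cosh v))"

definition wave_kernel_vz :: "real \<Rightarrow> real \<Rightarrow> real \<Rightarrow> real" where
  "wave_kernel_vz l v z = bessel_sq'' (wave_arg l v z) * (2 * l\<^sup>2 * (exp z * cosh v - exp z ^ 2)) *
       (2 * l\<^sup>2 * (exp z * sinh v))
     + bessel_sq' (wave_arg l v z) * (2 * l\<^sup>2 * (exp z * sinh v))"

definition wave_kernel_zz :: "real \<Rightarrow> real \<Rightarrow> real \<Rightarrow> real" where
  "wave_kernel_zz l v z = bessel_sq'' (wave_arg l v z) * (2 * l\<^sup>2 * (exp z * cosh v - exp z ^ 2))\<^sup>2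
     + bessel_sq' (wave_arg l v z) * (2 * l\<^sup>2 * (exp z * cosh v - 2 * exp z ^ 2))"

text \<open>
  The equation holds because \<open>y = (l \<phi>)\<^sup>2\<close> satisfies \<open>y\<^sub>v\<^sup>2 - y\<^sub>z\<^sup>2 = 4 l\<^sup>2 exp (2 z) y\<close> and
  \<open>y\<^sub>v\<^sub>v - y\<^sub>z\<^sub>z = 4 l\<^sup>2 exp (2 z)\<close>: the derivatives combine to the left-hand side of Bessel's equation.
\<close>

lemma wave_equation:
  "wave_kernel_vv l v z = wave_kernel_zz l v z - l\<^sup>2 * exp z ^ 2 * wave_kernel l v z"
proof -
  define y where "y = wave_arg l v z"
  have hyp: "cosh v ^ 2 = sinh v ^ 2 + (1::real)"
    by (simp add: cosh_square_eq)
  have y: "y = l\<^sup>2 * (2 * exp z * cosh v - exp z ^ 2 - 1)"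
    by (simp add: y_def wave_arg_def)
  have "(2 * l\<^sup>2 * (exp z * sinh v))\<^sup>2 - (2 * l\<^sup>2 * (exp z * cosh v - exp z ^ 2))\<^sup>2 = 4 * l\<^sup>2 * exp z ^ 2 * y"
    unfolding y using hyp by algebra
  then have "wave_kernel_vv l v z - wave_kernel_zz l v z
      = 4 * l\<^sup>2 * exp z ^ 2 * (y * bessel_sq'' y + bessel_sq' y)"
    unfolding wave_kernel_vv_def wave_kernel_zz_def y_def[symmetric] by algebra
  also have "y * bessel_sq'' y + bessel_sq' y = - bessel_sq y / 4"
    using bessel_sq_ode[of y] by simp
  finally show ?thesis
    by (simp add: wave_kernel_def y_def)
qed

text \<open>
  The kernel equals \<open>1\<close> on the characteristics \<open>z = \<plusminus> v\<close>, so its derivatives along them vanish. These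
  identities cancel the boundary terms when the wave operator is moved from the kernel to the initial data.
\<close>

lemma wave_characteristics:
  "wave_kernel_v l v v = - wave_kernel_z l v v"
  "wave_kernel_v l v (- v) = wave_kernel_z l v (- v)"
proof -
  have e: "exp v * sinh v = - (exp v * cosh v - exp v ^ 2)"
       "exp (- v) * sinh v = exp (- v) * cosh v - exp (- v) ^ 2"
    by (simp_all add: cosh_field_def sinh_field_def field_simps power2_eq_square)
  then show "wave_kernel_v l v v = - wave_kernel_z l v v"
    "wave_kernel_v l v (- v) = wave_kernel_z l v (- v)"
    unfolding wave_kernel_v_def wave_kernel_z_def wave_arg_diagonal e
    by (simp_all only: mult_minus_right)
qed

lemma continuous_on_bessel_sq [continuous_intros]:
  assumes "continuous_on S f"
  shows "continuous_on S (\<lambda>x. bessel_sq (f x))" "continuous_on S (\<lambda>x. bessel_sq' (f x))"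
    "continuous_on S (\<lambda>x. bessel_sq'' (f x))"
proof -
  have "continuous_on UNIV bessel_sq" "continuous_on UNIV bessel_sq'" "continuous_on UNIV bessel_sq''"
    using DERIV_isCont[OF bessel_sq_deriv] DERIV_isCont[OF bessel_sq'_deriv] isCont_bessel_sq''
    by (auto intro!: continuous_at_imp_continuous_on)
  then show "continuous_on S (\<lambda>x. bessel_sq (f x))" "continuous_on S (\<lambda>x. bessel_sq' (f x))"
    "continuous_on S (\<lambda>x. bessel_sq'' (f x))"
    using assms by (auto intro: continuous_on_compose2)
qed

lemma continuous_on_wave [continuous_intros]:
  assumes [continuous_intros]: "continuous_on S f" "continuous_on S g"
  shows "continuous_on S (\<lambda>x. wave_kernel l (f x) (g x))"
    "continuous_on S (\<lambda>x. wave_kernel_v l (f x) (g x))"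
    "continuous_on S (\<lambda>x. wave_kernel_z l (f x) (g x))"
    "continuous_on S (\<lambda>x. wave_kernel_vv l (f x) (g x))"
    "continuous_on S (\<lambda>x. wave_kernel_vz l (f x) (g x))"
    "continuous_on S (\<lambda>x. wave_kernel_zz l (f x) (g x))"
  unfolding wave_kernel_def wave_kernel_v_def wave_kernel_z_def wave_kernel_vv_def
    wave_kernel_vz_def wave_kernel_zz_def wave_arg_def
  by (intro continuous_intros)+

lemma wave_kernel_deriv_path:
  assumes "(p has_real_derivative p') (at s)" "(q has_real_derivative q') (at s)"
  shows "((\<lambda>s. wave_kernel l (p s) (q s)) has_real_derivative
      p' * wave_kernel_v l (p s) (q s) + q' * wave_kernel_z l (p s) (q s)) (at s)"
    "((\<lambda>s. wave_kernel_v l (p s) (q s)) has_real_derivative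
      p' * wave_kernel_vv l (p s) (q s) + q' * wave_kernel_vz l (p s) (q s)) (at s)"
    "((\<lambda>s. wave_kernel_z l (p s) (q s)) has_real_derivative
      p' * wave_kernel_vz l (p s) (q s) + q' * wave_kernel_zz l (p s) (q s)) (at s)"
proof -
  have c: "((\<lambda>s. cosh (p s)) has_real_derivative sinh (p s) * p') (at s)"
    "((\<lambda>s. sinh (p s)) has_real_derivative cosh (p s) * p') (at s)"
    "((\<lambda>s. exp (q s)) has_real_derivative exp (q s) * q') (at s)"
    using assms by (auto intro!: derivative_eq_intros)
  have arg: "((\<lambda>s. wave_arg l (p s) (q s)) has_real_derivative
      p' * (2 * l\<^sup>2 * (exp (q s) * sinh (p s))) + q' * (2 * l\<^sup>2 * (exp (q s) * cosh (p s) - exp (q s) ^ 2))) (at s)"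
    unfolding wave_arg_def
    by (rule derivative_eq_intros c refl | simp add: algebra_simps power2_eq_square)+
  note d = DERIV_chain2[OF bessel_sq_deriv arg] DERIV_chain2[OF bessel_sq'_deriv arg]
  show "((\<lambda>s. wave_kernel l (p s) (q s)) has_real_derivative
      p' * wave_kernel_v l (p s) (q s) + q' * wave_kernel_z l (p s) (q s)) (at s)"
    unfolding wave_kernel_def wave_kernel_v_def wave_kernel_z_def
    by (rule DERIV_cong[OF d(1)]) (simp add: algebra_simps)
  show "((\<lambda>s. wave_kernel_v l (p s) (q s)) has_real_derivative
      p' * wave_kernel_vv l (p s) (q s) + q' * wave_kernel_vz l (p s) (q s)) (at s)"
    unfolding wave_kernel_v_def wave_kernel_vv_def wave_kernel_vz_def
    by (rule derivative_eq_intros c d(2) refl)+ (simp add: algebra_simps power2_eq_square)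
  show "((\<lambda>s. wave_kernel_z l (p s) (q s)) has_real_derivative
      p' * wave_kernel_vz l (p s) (q s) + q' * wave_kernel_zz l (p s) (q s)) (at s)"
    unfolding wave_kernel_z_def wave_kernel_zz_def wave_kernel_vz_def
    by (rule derivative_eq_intros c d(2) refl)+ (simp add: algebra_simps power2_eq_square)
qed

section \<open>Wave propagation and its Laplace transform\<close>

text \<open>
  Differentiation of \<open>\<integral> g v z dz\<close> over \<open>[- v, v]\<close>. The substitution \<open>z = v s\<close> makes the limits
  constant and extends the integral to an odd function of \<open>v\<close>, so that no one-sided derivatives occur at \<open>v = 0\<close>.
\<close>

lemma leibniz_scaled:
  fixes g gv gz :: "real \<Rightarrow> real \<Rightarrow> real"
  assumes path: "\<And>v s. ((\<lambda>v. g v (v * s)) has_real_derivative gv v (v * s) + s * gz v (v * s)) (at v)"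
    and gz: "\<And>v z. (g v has_real_derivative gz v z) (at z)"
    and cont: "continuous_on UNIV (\<lambda>p. g (fst p) (fst p * snd p))" "continuous_on UNIV (\<lambda>p. gv (fst p) (fst p * snd p))"
      "continuous_on UNIV (\<lambda>p. gz (fst p) (fst p * snd p))"
  shows "((\<lambda>v. v * integral {-1..1} (\<lambda>s. g v (v * s))) has_real_derivative
      g v v + g v (- v) + v * integral {-1..1} (\<lambda>s. gv v (v * s))) (at v)"
proof -
  let ?d = "\<lambda>v s. gv v (v * s) + s * gz v (v * s)"
  have sec: "continuous_on UNIV (\<lambda>s. h v (v * s))"
    if "continuous_on UNIV (\<lambda>p. h (fst p) (fst p * snd p))" for h :: "real \<Rightarrow> real \<Rightarrow> real" and v
  proof -
    have "continuous_on UNIV (\<lambda>s. (v, s))" by (intro continuous_intros)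
    from continuous_on_compose2[OF that this] show ?thesis by simp
  qed
  note sc = cont[THEN sec, THEN continuous_on_subset, OF subset_UNIV]
  have "((\<lambda>v. integral (cbox (-1) 1) (\<lambda>s. g v (v * s))) has_real_derivative
      integral (cbox (-1) 1) (?d v)) (at v within UNIV)"
  proof (rule leibniz_rule_field_derivative)
    show "continuous_on (UNIV \<times> cbox (- 1) 1) (\<lambda>(v, s). ?d v s)"
      using cont by (auto intro!: continuous_intros simp: case_prod_beta elim: continuous_on_subset)
    show "(\<lambda>s. g v (v * s)) integrable_on cbox (- 1) 1" for v
      unfolding cbox_interval by (intro integrable_continuous_real sc)
  qed (use path in auto)
  then have "((\<lambda>v. v * integral {-1..1} (\<lambda>s. g v (v * s))) has_real_derivative
      integral {-1..1} (\<lambda>s. g v (v * s)) + v * integral {-1..1} (?d v)) (at v)"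
    by (auto intro!: derivative_eq_intros)
  moreover have "integral {-1..1} (?d v) = integral {-1..1} (\<lambda>s. gv v (v * s)) + integral {-1..1} (\<lambda>s. s * gz v (v * s))"
    by (intro Henstock_Kurzweil_Integration.integral_add integrable_continuous_real continuous_intros sc)
  \<comment> \<open>The \<open>z\<close>-derivative contributes the boundary terms, through the primitive \<open>s * g v (v * s)\<close>.\<close>
  moreover have "((\<lambda>s. g v (v * s) + v * (s * gz v (v * s))) has_integral (1 * g v (v * 1) - (-1) * g v (v * (-1)))) {-1..1}"
  proof (rule fundamental_theorem_of_calculus)
    fix s :: real
    have "((\<lambda>s. s * g v (v * s)) has_real_derivative g v (v * s) + v * (s * gz v (v * s))) (at s)"
      by (auto intro!: derivative_eq_intros DERIV_chain2[OF gz])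
    then show "((\<lambda>s. s * g v (v * s)) has_vector_derivative g v (v * s) + v * (s * gz v (v * s))) (at s within {-1..1})"
      by (auto simp: has_real_derivative_iff_has_vector_derivative intro: has_vector_derivative_at_within)
  qed simp
  then have "integral {-1..1} (\<lambda>s. g v (v * s) + v * (s * gz v (v * s))) = g v v + g v (- v)"
    by (simp add: integral_unique)
  moreover have "integral {-1..1} (\<lambda>s. g v (v * s) + v * (s * gz v (v * s))) =
      integral {-1..1} (\<lambda>s. g v (v * s)) + integral {-1..1} (\<lambda>s. v * (s * gz v (v * s)))"
    by (intro Henstock_Kurzweil_Integration.integral_add integrable_continuous_real continuous_intros sc)
  moreover have "integral {-1..1} (\<lambda>s. v * (s * gz v (v * s))) = v * integral {-1..1} (\<lambda>s. s * gz v (v * s))"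
    by (rule integral_mult_right)
  ultimately show ?thesis
    by (elim DERIV_cong) (simp only: distrib_left)
qed

text \<open>
  The solution of the wave equation with initial position \<open>0\<close> and initial velocity \<open>2 F\<close>, seen at a fixed point,
  as a function of time \<open>v\<close>; it is the integral of \<open>F z * wave_kernel l v z\<close> over \<open>[- v, v]\<close> in the scaled variable.
\<close>

definition wave_average :: "real \<Rightarrow> (real \<Rightarrow> real) \<Rightarrow> real \<Rightarrow> real" where
  "wave_average l F v = v * integral {-1..1} (\<lambda>s. F (v * s) * wave_kernel l v (v * s))"

definition wave_average_v :: "real \<Rightarrow> (real \<Rightarrow> real) \<Rightarrow> real \<Rightarrow> real" where
  "wave_average_v l F v = F v + F (- v) + v * integral {-1..1} (\<lambda>s. F (v * s) * wave_kernel_v l v (v * s))"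

lemma wave_kernel_diagonal [simp]: "wave_kernel l v v = 1" "wave_kernel l v (- v) = 1"
  by (simp_all add: wave_kernel_def)

context
  fixes l :: real and F F' F'' :: "real \<Rightarrow> real"
  assumes F: "\<And>z. (F has_real_derivative F' z) (at z)"
    and F': "\<And>z. (F' has_real_derivative F'' z) (at z)"
    and F'': "continuous_on UNIV F''"
begin

lemma continuous_on_F:
  assumes "continuous_on S f"
  shows "continuous_on S (\<lambda>x. F (f x))" "continuous_on S (\<lambda>x. F' (f x))" "continuous_on S (\<lambda>x. F'' (f x))"
proof -
  have "continuous_on UNIV F" "continuous_on UNIV F'"
    using DERIV_isCont[OF F] DERIV_isCont[OF F'] by (auto intro!: continuous_at_imp_continuous_on)
  then show "continuous_on S (\<lambda>x. F (f x))" "continuous_on S (\<lambda>x. F' (f x))" "continuous_on S (\<lambda>x. F'' (f x))"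
    using assms F'' by (auto intro: continuous_on_compose2)
qed

lemma wave_average_deriv:
  "(wave_average l F has_real_derivative wave_average_v l F v) (at v)"
proof -
  have "((\<lambda>v. v * integral {-1..1} (\<lambda>s. F (v * s) * wave_kernel l v (v * s))) has_real_derivative
      F v * wave_kernel l v v + F (- v) * wave_kernel l v (- v) +
      v * integral {-1..1} (\<lambda>s. F (v * s) * wave_kernel_v l v (v * s))) (at v)"
  proof (rule leibniz_scaled[where g = "\<lambda>v z. F z * wave_kernel l v z" and gv = "\<lambda>v z. F z * wave_kernel_v l v z"
        and gz = "\<lambda>v z. F' z * wave_kernel l v z + F z * wave_kernel_z l v z"])
    show "((\<lambda>v. F (v * s) * wave_kernel l v (v * s)) has_real_derivative
        F (v * s) * wave_kernel_v l v (v * s) + s * (F' (v * s) * wave_kernel l v (v * s) + F (v * s) * wave_kernel_z l v (v * s))) (at v)" for v s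
      by (rule derivative_eq_intros DERIV_chain2[OF F] wave_kernel_deriv_path refl | simp add: algebra_simps)+
    show "((\<lambda>z. F z * wave_kernel l v z) has_real_derivative F' z * wave_kernel l v z + F z * wave_kernel_z l v z) (at z)" for v z
      by (rule derivative_eq_intros F wave_kernel_deriv_path refl | simp add: algebra_simps)+
  qed (intro continuous_intros continuous_on_F)+
  then show ?thesis unfolding wave_average_def[abs_def] wave_average_v_def by simp
qed

text \<open>
  The second derivative falls on the initial data: the wave equation for the kernel turns \<open>v\<close>-derivatives into
  \<open>z\<close>-derivatives, and two integrations by parts move these to \<open>F\<close>.
\<close>

lemma wave_average_v_deriv:
  "(wave_average_v l F has_real_derivative wave_average l (\<lambda>z. F'' z - l\<^sup>2 * exp z ^ 2 * F z) v) (at v)"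
proof -
  let ?B = "v * integral {-1..1} (\<lambda>s. F (v * s) * wave_kernel_vv l v (v * s))"
  have "((\<lambda>v. v * integral {-1..1} (\<lambda>s. F (v * s) * wave_kernel_v l v (v * s))) has_real_derivative
      F v * wave_kernel_v l v v + F (- v) * wave_kernel_v l v (- v) + ?B) (at v)"
  proof (rule leibniz_scaled[where g = "\<lambda>v z. F z * wave_kernel_v l v z" and gv = "\<lambda>v z. F z * wave_kernel_vv l v z"
        and gz = "\<lambda>v z. F' z * wave_kernel_v l v z + F z * wave_kernel_vz l v z"])
    show "((\<lambda>v. F (v * s) * wave_kernel_v l v (v * s)) has_real_derivative
        F (v * s) * wave_kernel_vv l v (v * s) + s * (F' (v * s) * wave_kernel_v l v (v * s) + F (v * s) * wave_kernel_vz l v (v * s))) (at v)" for v s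
      by (rule derivative_eq_intros DERIV_chain2[OF F] wave_kernel_deriv_path refl | simp add: algebra_simps)+
    show "((\<lambda>z. F z * wave_kernel_v l v z) has_real_derivative F' z * wave_kernel_v l v z + F z * wave_kernel_vz l v z) (at z)" for v z
      by (rule derivative_eq_intros F wave_kernel_deriv_path refl | simp add: algebra_simps)+
  qed (intro continuous_intros continuous_on_F)+
  moreover have "((\<lambda>v. F v + F (- v)) has_real_derivative F' v - F' (- v)) (at v)"
    by (auto intro!: derivative_eq_intros F DERIV_chain2[OF F])
  ultimately have D: "(wave_average_v l F has_real_derivative F' v - F' (- v) +
      (F v * wave_kernel_v l v v + F (- v) * wave_kernel_v l v (- v) + ?B)) (at v)"
    unfolding wave_average_v_def[abs_def] by (rule DERIV_add[rotated])
  let ?G = "\<lambda>s. F' (v * s) * wave_kernel l v (v * s) - F (v * s) * wave_kernel_z l v (v * s)"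
  have "((\<lambda>s. v * (F'' (v * s) * wave_kernel l v (v * s) - F (v * s) * wave_kernel_zz l v (v * s)))
      has_integral (?G 1 - ?G (-1))) {-1..1}"
  proof (rule fundamental_theorem_of_calculus)
    fix s :: real
    have "(?G has_real_derivative v * (F'' (v * s) * wave_kernel l v (v * s) - F (v * s) * wave_kernel_zz l v (v * s))) (at s)"
      by (rule derivative_eq_intros DERIV_chain2[OF F] DERIV_chain2[OF F'] wave_kernel_deriv_path refl | simp add: algebra_simps)+
    then show "(?G has_vector_derivative v * (F'' (v * s) * wave_kernel l v (v * s) - F (v * s) * wave_kernel_zz l v (v * s))) (at s within {-1..1})"
      by (auto simp: has_real_derivative_iff_has_vector_derivative intro: has_vector_derivative_at_within)
  qed simp
  moreover have "((\<lambda>s. v * (F (v * s) * wave_kernel_vv l v (v * s))) has_integral ?B) {-1..1}"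
    by (intro has_integral_mult_right integrable_integral integrable_continuous_real continuous_intros continuous_on_F)
  ultimately have "((\<lambda>s. v * (F'' (v * s) * wave_kernel l v (v * s) - F (v * s) * wave_kernel_zz l v (v * s)) +
      v * (F (v * s) * wave_kernel_vv l v (v * s))) has_integral (?G 1 - ?G (-1) + ?B)) {-1..1}"
    by (rule has_integral_add)
  also have "(\<lambda>s. v * (F'' (v * s) * wave_kernel l v (v * s) - F (v * s) * wave_kernel_zz l v (v * s)) +
      v * (F (v * s) * wave_kernel_vv l v (v * s))) =
      (\<lambda>s. v * ((F'' (v * s) - l\<^sup>2 * exp (v * s) ^ 2 * F (v * s)) * wave_kernel l v (v * s)))"
    unfolding wave_equation by (simp add: algebra_simps)
  finally have E: "wave_average l (\<lambda>z. F'' z - l\<^sup>2 * exp z ^ 2 * F z) v = ?G 1 - ?G (-1) + ?B"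
    unfolding wave_average_def by (subst integral_mult_right[symmetric]) (rule integral_unique)
  show ?thesis
    unfolding E by (rule DERIV_cong[OF D]) (simp add: wave_characteristics)
qed

end


lemma integrable_linear_exp:
  assumes "d > 0"
  shows "integrable lborel (\<lambda>v. indicator {0..} v * (v * exp (- d * v)) :: real)"
proof (rule integrableI_nonneg)
  have "(\<integral>\<^sup>+v. ennreal (v * exp (- d * v)) * indicator {0..} v \<partial>lborel)
      = 0 - (- (0 / d + 1 / d\<^sup>2) * exp (- d * 0))"
  proof (rule nn_integral_FTC_atLeast)
    show "((\<lambda>v. - (v / d + 1 / d\<^sup>2) * exp (- d * v)) has_real_derivative v * exp (- d * v)) (at v)" for v
      using assms by (auto intro!: derivative_eq_intros simp: field_simps power2_eq_square)
    show "((\<lambda>v. - (v / d + 1 / d\<^sup>2) * exp (- d * v)) \<longlongrightarrow> 0) at_top"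
      using assms by real_asymp
  qed auto
  moreover have "ennreal (indicator {0..} v * (v * exp (- d * v))) = ennreal (v * exp (- d * v)) * indicator {0..} v" for v
    by (simp add: indicator_def)
  ultimately show "(\<integral>\<^sup>+v. ennreal (indicator {0..} v * (v * exp (- d * v))) \<partial>lborel) < \<infinity>"
    by simp
qed (auto simp: indicator_def)

lemma abs_wave_average_le:
  assumes "continuous_on UNIV H" "0 \<le> v" "\<And>z. \<bar>z\<bar> \<le> v \<Longrightarrow> \<bar>H z\<bar> \<le> C"
  shows "\<bar>wave_average l H v\<bar> \<le> 2 * v * C"
proof -
  have "norm (integral {-1..1} (\<lambda>s. H (v * s) * wave_kernel l v (v * s))) \<le> C * (1 - (-1))"
  proof (rule integral_bound)
    show "continuous_on {- 1..1} (\<lambda>s. H (v * s) * wave_kernel l v (v * s))"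
      by (intro continuous_intros continuous_on_compose2[OF assms(1)]) auto
    show "norm (H (v * s) * wave_kernel l v (v * s)) \<le> C" if "s \<in> {-1..1}" for s
    proof -
      have "\<bar>s\<bar> \<le> 1" using that by auto
      then have "\<bar>v * s\<bar> \<le> v"
        using assms(2) by (simp add: abs_mult mult_left_le)
      then have "\<bar>H (v * s)\<bar> * \<bar>wave_kernel l v (v * s)\<bar> \<le> C * 1"
        using assms(3)[of "v * s"] abs_wave_kernel_le_1[of "v * s" v l] by (intro mult_mono) auto
      then show "norm (H (v * s) * wave_kernel l v (v * s)) \<le> C" by (simp add: abs_mult)
    qed
  qed simp
  then have "v * norm (integral {-1..1} (\<lambda>s. H (v * s) * wave_kernel l v (v * s))) \<le> v * (C * (1 - (-1)))"
    using assms(2) by (intro mult_left_mono) auto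
  then show ?thesis
    using assms(2) by (simp add: wave_average_def abs_mult mult_ac)
qed

lemma wave_average_0 [simp]: "wave_average l F 0 = 0" "wave_average_v l F 0 = 2 * F 0"
  by (simp_all add: wave_average_def wave_average_v_def)

lemma wave_average_eq_integral:
  assumes "continuous_on UNIV H"
  shows "(\<integral>z. of_bool (\<bar>z\<bar> \<le> v) * (H z * wave_kernel l v z) \<partial>lborel) = indicator {0..} v * wave_average l H v"
proof (cases "v > 0")
  case True
  have "(\<integral>z. of_bool (\<bar>z\<bar> \<le> v) * (H z * wave_kernel l v z) \<partial>lborel)
      = v * (\<integral>s. of_bool (\<bar>v * s\<bar> \<le> v) * (H (v * s) * wave_kernel l v (v * s)) \<partial>lborel)"
    using True lborel_integral_real_affine[of v "\<lambda>z. of_bool (\<bar>z\<bar> \<le> v) * (H z * wave_kernel l v z)" 0]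
    by simp
  also have "(\<integral>s. of_bool (\<bar>v * s\<bar> \<le> v) * (H (v * s) * wave_kernel l v (v * s)) \<partial>lborel) =
      (LINT s:{-1..1}|lborel. H (v * s) * wave_kernel l v (v * s))"
    unfolding set_lebesgue_integral_def
  proof (intro Bochner_Integration.integral_cong refl)
    fix s :: real
    have "\<bar>v * s\<bar> \<le> v \<longleftrightarrow> \<bar>s\<bar> \<le> 1"
      using True by (simp add: abs_mult)
    then show "of_bool (\<bar>v * s\<bar> \<le> v) * (H (v * s) * wave_kernel l v (v * s)) =
        indicat_real {- 1..1} s *\<^sub>R (H (v * s) * wave_kernel l v (v * s))"
      by (auto simp: indicator_def of_bool_def)
  qed
  also have "\<dots> = integral {-1..1} (\<lambda>s. H (v * s) * wave_kernel l v (v * s))"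
    by (intro set_borel_integral_eq_integral borel_integrable_atLeastAtMost' continuous_intros
        continuous_on_compose2[OF assms]) auto
  finally show ?thesis using True by (simp add: wave_average_def)
next
  case False
  have [measurable]: "H \<in> borel_measurable borel" "wave_kernel l v \<in> borel_measurable borel"
    by (auto intro!: borel_measurable_continuous_onI assms continuous_intros)
  have "AE z in lborel. z \<noteq> (0::real)"
    by (rule AE_lborel_singleton)
  then have "(\<integral>z. of_bool (\<bar>z\<bar> \<le> v) * (H z * wave_kernel l v z) \<partial>lborel) = (\<integral>z. 0 \<partial>(lborel :: real measure))"
    using False by (intro integral_cong_AE) (auto elim!: AE_mp simp: indicator_def)
  then show ?thesis using False by (auto simp: indicator_def)
qed

text \<open>
  \<open>- exp (- s v) (D' v + s D v)\<close> is a primitive of \<open>exp (- s v) (s\<^sup>2 D v - D'' v)\<close>, and \<open>D' 0 = 2 F 0\<close>.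
\<close>

lemma wave_average_laplace:
  assumes F: "\<And>z. (F has_real_derivative F' z) (at z)"
    and F': "\<And>z. (F' has_real_derivative F'' z) (at z)"
    and F'': "continuous_on UNIV F''"
    and bounds: "\<And>z. \<bar>F z\<bar> \<le> C * exp (k * \<bar>z\<bar>)" "\<And>z. \<bar>F'' z - l\<^sup>2 * exp z ^ 2 * F z\<bar> \<le> C * exp (k * \<bar>z\<bar>)"
    and k: "0 \<le> k" "k < s"
  shows "(\<integral>v. indicator {0..} v * (exp (- s * v) *
      (s\<^sup>2 * wave_average l F v - wave_average l (\<lambda>z. F'' z - l\<^sup>2 * exp z ^ 2 * F z) v)) \<partial>lborel) = 2 * F 0"
proof -
  let ?H = "\<lambda>z. F'' z - l\<^sup>2 * exp z ^ 2 * F z"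
  let ?f = "\<lambda>v. exp (- s * v) * (s\<^sup>2 * wave_average l F v - wave_average l ?H v)"
  let ?P = "\<lambda>v. - (exp (- s * v) * (wave_average_v l F v + s * wave_average l F v))"
  note dF = wave_average_deriv[OF F F' F''] wave_average_v_deriv[OF F F' F'']
  have C: "0 \<le> C"
    using bounds(1)[of 0] by simp
  have contF: "continuous_on UNIV F"
    by (intro continuous_at_imp_continuous_on ballI DERIV_isCont[OF F])
  have contH: "continuous_on UNIV ?H"
    by (intro continuous_intros F'' contF)
  have grow: "C * exp (k * \<bar>z\<bar>) \<le> C * exp (k * v)" if "\<bar>z\<bar> \<le> v" for z v
    using that k C by (intro mult_left_mono) (auto intro: mult_left_mono)
  have bF: "\<bar>wave_average l F v\<bar> \<le> 2 * v * (C * exp (k * v))" if "0 \<le> v" for v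
    using order_trans[OF bounds(1) grow] by (intro abs_wave_average_le contF that) auto
  have bH: "\<bar>wave_average l ?H v\<bar> \<le> 2 * v * (C * exp (k * v))" if "0 \<le> v" for v
    using order_trans[OF bounds(2) grow] by (intro abs_wave_average_le contH that) auto
  \<comment> \<open>The first derivative is controlled through the second by the mean value theorem.\<close>
  have bV: "\<bar>wave_average_v l F v\<bar> \<le> 2 * \<bar>F 0\<bar> + v * (2 * v * (C * exp (k * v)))" if v: "0 < v" for v
  proof -
    obtain \<xi> where \<xi>: "0 < \<xi>" "\<xi> < v" "wave_average_v l F v - wave_average_v l F 0 = (v - 0) * wave_average l ?H \<xi>"
      using MVT2[OF v, of "wave_average_v l F" "wave_average l ?H"] dF(2) by blast
    have "\<bar>wave_average l ?H \<xi>\<bar> \<le> 2 * \<xi> * (C * exp (k * \<xi>))"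
      using \<xi> by (intro bH) simp
    also have "\<dots> \<le> 2 * v * (C * exp (k * v))"
      using \<xi> C k by (intro mult_mono mult_left_mono) (auto intro: mult_left_mono)
    finally have "v * \<bar>wave_average l ?H \<xi>\<bar> \<le> v * (2 * v * (C * exp (k * v)))"
      using v by (intro mult_left_mono) auto
    moreover have "\<bar>v * wave_average l ?H \<xi>\<bar> = v * \<bar>wave_average l ?H \<xi>\<bar>"
      using v by (simp add: abs_mult)
    ultimately show ?thesis using \<xi>(3) by simp
  qed
  have deriv: "(?P has_real_derivative ?f v) (at v)" for v
    by (rule derivative_eq_intros dF refl | simp add: algebra_simps power2_eq_square)+
  have cont_avg: "continuous_on UNIV (wave_average l F)" 
    by (intro continuous_at_imp_continuous_on ballI DERIV_isCont[OF dF(1)])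
  have cont_avgH: "continuous_on UNIV (wave_average l ?H)"
    unfolding wave_average_def cbox_interval[symmetric] 
    by (intro continuous_intros integral_continuous_on_param)
      (auto simp: case_prod_beta intro!: continuous_intros continuous_on_compose2[OF contH] continuous_on_compose2[OF contF] continuous_on_compose2[OF F''])
  have contf: "continuous_on S ?f" for S
    by (intro continuous_intros continuous_on_subset[OF cont_avg] continuous_on_subset[OF cont_avgH]) auto
  define d where "d = s - k"
  have d: "d > 0" using k by (simp add: d_def)
  have expd: "exp (- s * v) * exp (k * v) = exp (- d * v)" for v
    by (simp add: d_def algebra_simps flip: exp_add)
  have int: "set_integrable lborel {0..} ?f"
    unfolding set_integrable_def
  proof (rule Bochner_Integration.integrable_bound)
    show "integrable lborel (\<lambda>v. (2 * C * s\<^sup>2 + 2 * C) * (indicator {0..} v * (v * exp (- d * v)) :: real))"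
      by (intro integrable_mult_right integrable_linear_exp d)
    have [measurable]: "?f \<in> borel_measurable borel"
      by (intro borel_measurable_continuous_onI contf)
    show "(\<lambda>v. indicat_real {0..} v *\<^sub>R ?f v) \<in> borel_measurable lborel"
      by measurable
    show "AE v in lborel. norm (indicat_real {0..} v *\<^sub>R ?f v) \<le> norm ((2 * C * s\<^sup>2 + 2 * C) * (indicator {0..} v * (v * exp (- d * v))))"
    proof (intro AE_I2)
      fix v :: real
      show "norm (indicat_real {0..} v *\<^sub>R ?f v) \<le> norm ((2 * C * s\<^sup>2 + 2 * C) * (indicator {0..} v * (v * exp (- d * v))))"
      proof (cases "0 \<le> v")
        case True
        have "\<bar>s\<^sup>2 * wave_average l F v - wave_average l ?H v\<bar> \<le> s\<^sup>2 * \<bar>wave_average l F v\<bar> + \<bar>wave_average l ?H v\<bar>"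
          using abs_triangle_ineq4[of "s\<^sup>2 * wave_average l F v" "wave_average l ?H v"] by (simp add: abs_mult)
        also have "\<dots> \<le> s\<^sup>2 * (2 * v * (C * exp (k * v))) + 2 * v * (C * exp (k * v))"
          using bF[OF True] bH[OF True] by (intro add_mono mult_left_mono) auto
        finally have "exp (- s * v) * \<bar>s\<^sup>2 * wave_average l F v - wave_average l ?H v\<bar>
            \<le> exp (- s * v) * (s\<^sup>2 * (2 * v * (C * exp (k * v))) + 2 * v * (C * exp (k * v)))"
          by (intro mult_left_mono) auto
        also have "\<dots> = (2 * C * s\<^sup>2 + 2 * C) * (v * exp (- d * v))"
          unfolding expd[symmetric] by (simp add: algebra_simps)
        finally show ?thesis using True C by (simp add: abs_mult)
      qed simp
    qed
  qed
  have lim: "((\<lambda>v. LINT x:{0..v}|lborel. ?f x) \<longlongrightarrow> (LINT x:{0..}|lborel. ?f x)) at_top"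
    by (rule tendsto_set_lebesgue_integral_at_top[OF _ int]) auto
  have eq: "(LINT x:{0..v}|lborel. ?f x) = ?P v - ?P 0" if "0 \<le> v" for v
    unfolding set_lebesgue_integral_def
  proof (rule integral_FTC_atLeastAtMost[OF that])
    show "(?P has_vector_derivative ?f x) (at x within {0..v})" for x
      using deriv[of x] by (auto simp: has_real_derivative_iff_has_vector_derivative intro: has_vector_derivative_at_within)
  qed (rule contf)
  have "(?P \<longlongrightarrow> 0) at_top"
  proof (rule Lim_null_comparison)
    show "\<forall>\<^sub>F v in at_top. norm (?P v) \<le> 2 * \<bar>F 0\<bar> * exp (- s * v) + 2 * C * (v\<^sup>2 * exp (- d * v)) + 2 * s * C * (v * exp (- d * v))"
      using eventually_gt_at_top[of 0]
    proof eventually_elim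
      case (elim v)
      have "\<bar>wave_average_v l F v + s * wave_average l F v\<bar> \<le> \<bar>wave_average_v l F v\<bar> + s * \<bar>wave_average l F v\<bar>"
        using abs_triangle_ineq[of "wave_average_v l F v" "s * wave_average l F v"] k by (simp add: abs_mult)
      also have "\<dots> \<le> 2 * \<bar>F 0\<bar> + v * (2 * v * (C * exp (k * v))) + s * (2 * v * (C * exp (k * v)))"
        using bV[OF elim] bF[of v] elim k by (intro add_mono mult_left_mono) auto
      finally have "exp (- s * v) * \<bar>wave_average_v l F v + s * wave_average l F v\<bar>
         \<le> exp (- s * v) * (2 * \<bar>F 0\<bar> + v * (2 * v * (C * exp (k * v))) + s * (2 * v * (C * exp (k * v))))"
        by (intro mult_left_mono) auto
      also have "\<dots> = 2 * \<bar>F 0\<bar> * exp (- s * v) + 2 * C * (v\<^sup>2 * exp (- d * v)) + 2 * s * C * (v * exp (- d * v))"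
        unfolding expd[symmetric] by (simp add: algebra_simps power2_eq_square)
      finally show ?case by (simp add: abs_mult)
    qed
    have "s > 0" using k by simp
    then have "((\<lambda>v. exp (- s * v)) \<longlongrightarrow> 0) at_top" by real_asymp
    moreover have "((\<lambda>v. v\<^sup>2 * exp (- d * v)) \<longlongrightarrow> 0) at_top" "((\<lambda>v. v * exp (- d * v)) \<longlongrightarrow> 0) at_top"
      using d by real_asymp+
    ultimately show "((\<lambda>v. 2 * \<bar>F 0\<bar> * exp (- s * v) + 2 * C * (v\<^sup>2 * exp (- d * v)) + 2 * s * C * (v * exp (- d * v))) \<longlongrightarrow> 0) at_top"
      by (intro tendsto_add_zero tendsto_mult_right_zero)
  qed
  then have limP: "((\<lambda>v. ?P v - ?P 0) \<longlongrightarrow> 0 - ?P 0) at_top"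
    by (intro tendsto_intros)
  have "((\<lambda>v. LINT x:{0..v}|lborel. ?f x) \<longlongrightarrow> 0 - ?P 0) at_top"
    using eventually_ge_at_top[of 0]
    by (rule Lim_transform_eventually[OF limP eventually_mono]) (simp only: eq)
  from tendsto_unique[OF trivial_limit_at_top_linorder lim this]
  have "(LINT x:{0..}|lborel. ?f x) = 0 - ?P 0" .
  then show ?thesis
    by (simp add: set_lebesgue_integral_def)
qed


section \<open>Duality\<close>

text \<open>
  The generator \<open>(y\<^sup>2 - 1)/2 \<partial>\<^sup>2 + (a + 1/2) y \<partial>\<close> of \<open>cosh R\<close>, applied to \<open>exp (- \<theta> y)\<close>.
\<close>

definition exp_generator :: "real \<Rightarrow> real \<Rightarrow> real \<Rightarrow> real" where
  "exp_generator a \<theta> y = (\<theta>\<^sup>2 / 2 * (y\<^sup>2 - 1) - (a + 1 / 2) * \<theta> * y) * exp (- \<theta> * y)"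

text \<open>One term of the exponential series is at most the whole sum.\<close>

lemma power_exp_le:
  assumes "0 \<le> (x :: real)"
  shows "x ^ n * exp (- x) \<le> fact n"
proof -
  have "x ^ n / fact n = (\<Sum>k\<in>{n}. x ^ k / fact k)" by simp
  also have "\<dots> \<le> exp x"
    using assms exp_converges[of x]
    by (intro sum_le_suminf[THEN order_trans[OF _ eq_refl]] ) (auto simp: sums_iff scaleR_conv_of_real field_simps)
  finally have "x ^ n \<le> fact n * exp x" by (simp add: field_simps)
  then show ?thesis by (simp add: exp_minus field_simps)
qed

lemma abs_exp_generator_le:
  assumes "0 \<le> a" "0 < \<theta>" "1 \<le> y"
  shows "\<bar>exp_generator a \<theta> y\<bar> \<le> a + 3 / 2"
proof -
  have y2: "0 \<le> y\<^sup>2 - 1" "0 \<le> y" using assms by (auto simp: one_le_power)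
  have "\<theta>\<^sup>2 / 2 * (y\<^sup>2 - 1) \<le> (\<theta> * y)\<^sup>2 / 2"
    by (simp add: power_mult_distrib algebra_simps)
  then have "\<theta>\<^sup>2 / 2 * (y\<^sup>2 - 1) * exp (- \<theta> * y) \<le> (\<theta> * y)\<^sup>2 / 2 * exp (- (\<theta> * y))"
    by (simp add: mult_right_mono)
  also have "\<dots> \<le> 1"
    using power_exp_le[of "\<theta> * y" 2] assms by (simp add: fact_numeral)
  finally have 1: "\<theta>\<^sup>2 / 2 * (y\<^sup>2 - 1) * exp (- \<theta> * y) \<le> 1" .
  have 2: "0 \<le> \<theta>\<^sup>2 / 2 * (y\<^sup>2 - 1) * exp (- \<theta> * y)" using y2 by simp
  have "(a + 1 / 2) * ((\<theta> * y) ^ 1 * exp (- (\<theta> * y))) \<le> (a + 1 / 2) * fact 1"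
    using assms by (intro mult_left_mono power_exp_le) auto
  then have 3: "(a + 1 / 2) * \<theta> * y * exp (- \<theta> * y) \<le> a + 1 / 2" by (simp add: mult_ac)
  have 4: "0 \<le> (a + 1 / 2) * \<theta> * y * exp (- \<theta> * y)" using assms by simp
  show ?thesis
    unfolding exp_generator_def left_diff_distrib using 1 2 3 4 by linarith
qed

text \<open>
  The Laplace identity for \<open>F z = exp (a z - l y exp z)\<close>. Here \<open>H F\<close> is \<open>a\<^sup>2 F\<close> plus twice
  \<open>exp (a z)\<close> times the generator at \<open>\<theta> = l exp z\<close>. The bound on the generator is uniform in \<open>y \<ge> 1\<close>,
  so that the identity may later be integrated over \<open>y\<close>.
\<close>

lemma wave_duality:
  assumes a: "0 \<le> a" "a < s" and l: "0 < l" and y: "1 \<le> y"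
  shows "(\<integral>v. \<integral>z. of_bool (\<bar>z\<bar> \<le> v) * (exp (- s * v) * exp (a * z) * wave_kernel l v z *
      ((s\<^sup>2 - a\<^sup>2) * exp (- l * exp z * y) - 2 * exp_generator a (l * exp z) y)) \<partial>lborel \<partial>lborel) = 2 * exp (- l * y)"
proof -
  define F where "F = (\<lambda>z. exp (a * z) * exp (- l * exp z * y))"
  define F' where "F' = (\<lambda>z. (a - l * exp z * y) * F z)"
  define F'' where "F'' = (\<lambda>z. ((a - l * exp z * y)\<^sup>2 - l * exp z * y) * F z)"
  let ?H = "\<lambda>z. F'' z - l\<^sup>2 * exp z ^ 2 * F z"
  have F: "(F has_real_derivative F' z) (at z)" for z
    unfolding F_def F'_def by (rule derivative_eq_intros refl | simp add: algebra_simps)+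
  have F': "(F' has_real_derivative F'' z) (at z)" for z
    unfolding F'_def F''_def by (rule derivative_eq_intros refl F | simp add: F'_def algebra_simps power2_eq_square)+
  have F'': "continuous_on UNIV F''"
    unfolding F''_def F_def by (intro continuous_intros)
  have H: "?H z = a\<^sup>2 * F z + 2 * exp (a * z) * exp_generator a (l * exp z) y" for z
    unfolding F''_def F_def exp_generator_def by (simp add: field_simps power2_eq_square)
  have contH: "continuous_on UNIV ?H" and contF: "continuous_on UNIV F"
    unfolding F''_def F_def by (intro continuous_intros)+
  let ?C = "1 + a\<^sup>2 + 2 * (a + 3 / 2)"
  have ea: "exp (a * z) \<le> exp (a * \<bar>z\<bar>)" for z using a by (simp add: mult_left_mono)
  have F1: "0 \<le> F z" "F z \<le> exp (a * z)" for z
    using l y by (auto simp: F_def mult_le_cancel_left1)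
  have "s\<^sup>2 * wave_average l F v - wave_average l ?H v = wave_average l (\<lambda>z. s\<^sup>2 * F z - ?H z) v" for v
  proof -
    have 1: "(\<lambda>x. F (v * x) * wave_kernel l v (v * x)) integrable_on {-1..1}"
      by (intro integrable_continuous_real continuous_intros continuous_on_compose2[OF contF]) auto
    have 2: "(\<lambda>x. ?H (v * x) * wave_kernel l v (v * x)) integrable_on {-1..1}"
      by (intro integrable_continuous_real continuous_intros continuous_on_compose2[OF contF] continuous_on_compose2[OF F'']) auto
    have "integral {-1..1} (\<lambda>x. (s\<^sup>2 * F (v * x) - ?H (v * x)) * wave_kernel l v (v * x))
      = integral {-1..1} (\<lambda>x. s\<^sup>2 * (F (v * x) * wave_kernel l v (v * x)) - ?H (v * x) * wave_kernel l v (v * x))"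
      by (simp add: algebra_simps)
    also have "\<dots> = s\<^sup>2 * integral {-1..1} (\<lambda>x. F (v * x) * wave_kernel l v (v * x)) - integral {-1..1} (\<lambda>x. ?H (v * x) * wave_kernel l v (v * x))"
      using 1 2 by (subst Henstock_Kurzweil_Integration.integral_diff) (auto intro: integrable_on_mult_right simp: integral_mult_right)
    finally have e: "integral {-1..1} (\<lambda>x. (s\<^sup>2 * F (v * x) - ?H (v * x)) * wave_kernel l v (v * x)) =
        s\<^sup>2 * integral {-1..1} (\<lambda>x. F (v * x) * wave_kernel l v (v * x)) - integral {-1..1} (\<lambda>x. ?H (v * x) * wave_kernel l v (v * x))" .
    have gen: "r * (v * i) - v * j = v * (r * i - j)" for r i j :: real
      by (simp add: algebra_simps)
    show ?thesis
      unfolding wave_average_def e by (rule gen)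
  qed
  then have "indicator {0..} v * (exp (- s * v) * (s\<^sup>2 * wave_average l F v - wave_average l ?H v)) =
     (\<integral>z. of_bool (\<bar>z\<bar> \<le> v) * (exp (- s * v) * exp (a * z) * wave_kernel l v z *
      ((s\<^sup>2 - a\<^sup>2) * exp (- l * exp z * y) - 2 * exp_generator a (l * exp z) y)) \<partial>lborel)" for v
  proof -
    assume *: "\<And>v. s\<^sup>2 * wave_average l F v - wave_average l ?H v = wave_average l (\<lambda>z. s\<^sup>2 * F z - ?H z) v"
    have "indicator {0..} v * (exp (- s * v) * (s\<^sup>2 * wave_average l F v - wave_average l ?H v)) =
      exp (- s * v) * (indicator {0..} v * wave_average l (\<lambda>z. s\<^sup>2 * F z - ?H z) v)"
      unfolding * by simp
    also have "indicator {0..} v * wave_average l (\<lambda>z. s\<^sup>2 * F z - ?H z) v =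
       (\<integral>z. of_bool (\<bar>z\<bar> \<le> v) * ((s\<^sup>2 * F z - ?H z) * wave_kernel l v z) \<partial>lborel)"
      by (rule wave_average_eq_integral[symmetric]) (intro continuous_intros contF F'')
    also have "exp (- s * v) * \<dots> = (\<integral>z. exp (- s * v) * (of_bool (\<bar>z\<bar> \<le> v) * ((s\<^sup>2 * F z - ?H z) * wave_kernel l v z)) \<partial>lborel)"
      by simp
    also have "(\<lambda>z. exp (- s * v) * (of_bool (\<bar>z\<bar> \<le> v) * ((s\<^sup>2 * F z - ?H z) * wave_kernel l v z))) = 
       (\<lambda>z. of_bool (\<bar>z\<bar> \<le> v) * (exp (- s * v) * exp (a * z) * wave_kernel l v z *
      ((s\<^sup>2 - a\<^sup>2) * exp (- l * exp z * y) - 2 * exp_generator a (l * exp z) y)))"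
      unfolding H by (simp add: F_def algebra_simps)
    finally show ?thesis .
  qed
  then have "(\<integral>v. \<integral>z. of_bool (\<bar>z\<bar> \<le> v) * (exp (- s * v) * exp (a * z) * wave_kernel l v z *
      ((s\<^sup>2 - a\<^sup>2) * exp (- l * exp z * y) - 2 * exp_generator a (l * exp z) y)) \<partial>lborel \<partial>lborel) =
      (\<integral>v. indicator {0..} v * (exp (- s * v) * (s\<^sup>2 * wave_average l F v - wave_average l ?H v)) \<partial>lborel)"
    by simp
  also have "\<dots> = 2 * F 0"
  proof (rule wave_average_laplace[OF F F' F'' _ _ a])
    fix z
    have "F z \<le> ?C * exp (a * \<bar>z\<bar>)"
    proof -
      have "1 * exp (a * \<bar>z\<bar>) \<le> ?C * exp (a * \<bar>z\<bar>)"
        using a by (intro mult_right_mono) auto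
      then show ?thesis using F1(2)[of z] ea[of z] by linarith
    qed
    then show "\<bar>F z\<bar> \<le> ?C * exp (a * \<bar>z\<bar>)" using F1[of z] by simp
    have g: "\<bar>exp_generator a (l * exp z) y\<bar> \<le> a + 3 / 2"
      using a l y by (intro abs_exp_generator_le) auto
    have "\<bar>?H z\<bar> \<le> a\<^sup>2 * F z + 2 * exp (a * z) * \<bar>exp_generator a (l * exp z) y\<bar>"
      unfolding H by (rule order_trans[OF abs_triangle_ineq]) (use F1[of z] in \<open>simp add: abs_mult\<close>)
    also have "\<dots> \<le> a\<^sup>2 * exp (a * z) + 2 * exp (a * z) * (a + 3 / 2)"
      using F1 g by (intro add_mono mult_left_mono) auto
    also have "\<dots> \<le> ?C * exp (a * z)" by (simp add: algebra_simps)
    also have "\<dots> \<le> ?C * exp (a * \<bar>z\<bar>)" using a ea by (intro mult_left_mono) auto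
    finally show "\<bar>?H z\<bar> \<le> ?C * exp (a * \<bar>z\<bar>)" .
  qed
  finally show ?thesis by (simp add: F_def)
qed

text \<open>A majorant for applications of Fubini's theorem on the cone \<open>\<bar>z\<bar> \<le> v\<close>.\<close>

lemma integrable_exp_cone:
  assumes "d > 0"
  shows "integrable (lborel \<Otimes>\<^sub>M lborel) (\<lambda>(v, z). of_bool (\<bar>z\<bar> \<le> v) * exp (- d * v) :: real)"
proof -
  have sec: "of_bool (\<bar>z\<bar> \<le> v) * exp (- d * v) = indicator {-v..v} z * exp (- d * v)" for v z :: real
    by (auto simp: indicator_def)
  show ?thesis
  proof (rule lborel_pair.Fubini_integrable)
    show "(\<lambda>(v, z). of_bool (\<bar>z\<bar> \<le> v) * exp (- d * v) :: real) \<in> borel_measurable (lborel \<Otimes>\<^sub>M lborel)"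
      by measurable
    have "(\<integral>z. norm (case (v, z) of (v, z) \<Rightarrow> (of_bool (\<bar>z\<bar> \<le> v) * exp (- d * v) :: real)) \<partial>lborel)
       = 2 * (indicator {0..} v * (v * exp (- d * v)))" for v
    proof -
      have e: "norm (case (v, z) of (v, z) \<Rightarrow> (of_bool (\<bar>z\<bar> \<le> v) * exp (- d * v) :: real)) = indicator {-v..v} z * exp (- d * v)" for z
        unfolding prod.case sec real_norm_def by (rule abs_of_nonneg) simp
      have "v < 0 \<or> 0 \<le> v" by linarith
      then show ?thesis unfolding e by auto
    qed
    then show "integrable lborel (\<lambda>v. \<integral>z. norm (case (v, z) of (v, z) \<Rightarrow> (of_bool (\<bar>z\<bar> \<le> v) * exp (- d * v) :: real)) \<partial>lborel)"
      by (simp only:) (intro integrable_mult_right integrable_linear_exp assms)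
    show "AE v in lborel. integrable lborel (\<lambda>z. case (v, z) of (v, z) \<Rightarrow> (of_bool (\<bar>z\<bar> \<le> v) * exp (- d * v) :: real))"
      unfolding prod.case sec by (intro AE_I2 integrable_on_interval)
  qed
qed

section \<open>Hitting times and uniqueness of Laplace transforms\<close>

definition std_normal_cdf :: "real \<Rightarrow> real" where
  "std_normal_cdf = cdf (density lborel std_normal_density)"

lemma std_normal_cdf_limits:
  "(std_normal_cdf \<longlongrightarrow> 1) at_top" "(std_normal_cdf \<longlongrightarrow> 0) at_bot"
proof -
  interpret real_distribution "density lborel std_normal_density"
    by (rule real_dist_normal_dist)
  show "(std_normal_cdf \<longlongrightarrow> 1) at_top" "(std_normal_cdf \<longlongrightarrow> 0) at_bot"
    unfolding std_normal_cdf_def by (rule cdf_lim_at_top_prob cdf_lim_at_bot)+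
qed

lemma std_normal_cdf_deriv:
  "(std_normal_cdf has_real_derivative std_normal_density x) (at x)"
proof -
  interpret real_distribution "density lborel std_normal_density"
    by (rule real_dist_normal_dist)
  have cont: "continuous_on {x - 1..x + 1} std_normal_density"
    unfolding std_normal_density_def by (intro continuous_intros) auto
  have eq: "std_normal_cdf u = std_normal_cdf (x - 1) + integral {x - 1..u} std_normal_density"
    if "x - 1 < u" "u < x + 1" for u
  proof -
    have "std_normal_cdf u - std_normal_cdf (x - 1) = measure (density lborel std_normal_density) {x - 1<..u}"
      unfolding std_normal_cdf_def using that by (intro cdf_diff_eq) auto
    also have "\<dots> = (\<integral>y. indicator {x - 1<..u} y \<partial>density lborel std_normal_density)"
      by simp
    also have "\<dots> = (\<integral>y. std_normal_density y *\<^sub>R indicator {x - 1<..u} y \<partial>lborel)"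
      by (rule integral_density) auto
    also have "\<dots> = (LINT y:{x - 1..u}|lborel. std_normal_density y)"
      unfolding set_lebesgue_integral_def using AE_lborel_singleton[of "x - 1"]
      by (intro integral_cong_AE) (auto elim!: AE_mp simp: indicator_def)
    also have "\<dots> = integral {x - 1..u} std_normal_density"
      using that by (intro set_borel_integral_eq_integral borel_integrable_atLeastAtMost' continuous_on_subset[OF cont]) auto
    finally show ?thesis by simp
  qed
  have "((\<lambda>u. std_normal_cdf (x - 1) + integral {x - 1..u} std_normal_density) has_real_derivative 0 + std_normal_density x) (at x within {x - 1..x + 1})"
    by (intro derivative_intros integral_has_real_derivative cont) auto
  then have "((\<lambda>u. std_normal_cdf (x - 1) + integral {x - 1..u} std_normal_density) has_real_derivative std_normal_density x) (at x)"
    by (subst (asm) at_within_interior) (auto simp: interior_atLeastAtMost_real)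
  then show ?thesis
    by (rule DERIV_cong_ev[THEN iffD1, rotated -1])
      (auto simp: eq eventually_nhds intro!: exI[of _ "{x - 1<..<x + 1}"])
qed

text \<open>For \<open>v > 0\<close> the density, in \<open>t\<close>, of the first time at which a Brownian motion started at \<open>0\<close> is at level \<open>v\<close>.\<close>

definition hitting_density :: "real \<Rightarrow> real \<Rightarrow> real" where
  "hitting_density v t = v / (sqrt (2 * pi) * t * sqrt t) * exp (- v\<^sup>2 / (2 * t))"

text \<open>
  The integrand has an explicit primitive, the distribution function of the first hitting time of \<open>v\<close> by a Brownian
  motion with drift \<open>s\<close>, multiplied by \<open>exp (- s v)\<close>.
\<close>

lemma hitting_density_laplace:
  assumes v: "0 < v" and s: "0 < s"
  shows "set_integrable lborel {0<..} (\<lambda>t. exp (- (s\<^sup>2 / 2 * t)) * hitting_density v t)"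
    "(LINT t:{0<..}|lborel. exp (- (s\<^sup>2 / 2 * t)) * hitting_density v t) = exp (- s * v)"
proof -
  let ?P = "\<lambda>t. exp (- s * v) * std_normal_cdf ((s * t - v) / sqrt t) + exp (s * v) * std_normal_cdf (- (s * t + v) / sqrt t)"
  let ?f = "\<lambda>t. exp (- (s\<^sup>2 / 2 * t)) * hitting_density v t"
  \<comment> \<open>Both normal densities reduce to the same Gaussian factor, and the terms with \<open>s\<close> of the inner derivatives cancel.\<close>
  have deriv: "(?P has_real_derivative ?f t) (at t)" if t: "0 < t" for t
  proof -
    have e1: "exp (- s * v) * std_normal_density ((s * t - v) / sqrt t) = exp (- (s\<^sup>2 / 2 * t)) * exp (- v\<^sup>2 / (2 * t)) / sqrt (2 * pi)"
    proof -
      have "- (s * v) - ((s * t - v) / sqrt t)\<^sup>2 / 2 = - (s\<^sup>2 / 2 * t) - v\<^sup>2 / (2 * t)"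
        using t by (simp add: power_divide field_simps power2_eq_square)
      then show ?thesis
        unfolding std_normal_density_def by (simp flip: exp_add add: exp_diff)
    qed
    have e2: "exp (s * v) * std_normal_density (- (s * t + v) / sqrt t) = exp (- (s\<^sup>2 / 2 * t)) * exp (- v\<^sup>2 / (2 * t)) / sqrt (2 * pi)"
    proof -
      have "s * v - (- (s * t + v) / sqrt t)\<^sup>2 / 2 = - (s\<^sup>2 / 2 * t) - v\<^sup>2 / (2 * t)"
        using t by (simp add: power_divide field_simps power2_eq_square)
      then show ?thesis
        unfolding std_normal_density_def by (simp flip: exp_add add: exp_diff)
    qed
    have d1: "((\<lambda>t. (s * t - v) / sqrt t) has_real_derivative (s / (2 * sqrt t) + v / (2 * t * sqrt t))) (at t)"
      using t by (auto intro!: derivative_eq_intros simp: field_simps)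
    have d2: "((\<lambda>t. - (s * t + v) / sqrt t) has_real_derivative (- s / (2 * sqrt t) + v / (2 * t * sqrt t))) (at t)"
      using t by (auto intro!: derivative_eq_intros simp: field_simps)
    define X where "X = exp (- (s\<^sup>2 / 2 * t)) * exp (- v\<^sup>2 / (2 * t)) / sqrt (2 * pi)"
    have "(?P has_real_derivative exp (- s * v) * (std_normal_density ((s * t - v) / sqrt t) * (s / (2 * sqrt t) + v / (2 * t * sqrt t))) +
        exp (s * v) * (std_normal_density (- (s * t + v) / sqrt t) * (- s / (2 * sqrt t) + v / (2 * t * sqrt t)))) (at t)"
      by (intro DERIV_add DERIV_cmult DERIV_chain2[OF std_normal_cdf_deriv] d1 d2)
    also have "exp (- s * v) * (std_normal_density ((s * t - v) / sqrt t) * (s / (2 * sqrt t) + v / (2 * t * sqrt t))) +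
        exp (s * v) * (std_normal_density (- (s * t + v) / sqrt t) * (- s / (2 * sqrt t) + v / (2 * t * sqrt t)))
        = X * (s / (2 * sqrt t) + v / (2 * t * sqrt t)) + X * (- s / (2 * sqrt t) + v / (2 * t * sqrt t))"
      unfolding mult.assoc[symmetric] e1 e2 X_def ..
    also have "\<dots> = X * (v / (t * sqrt t))"
      by (simp add: field_simps)
    also have "\<dots> = ?f t"
      by (simp add: X_def hitting_density_def mult_ac)
    finally show ?thesis .
  qed
  have cont: "isCont ?f t" if "0 < t" for t
    using that unfolding hitting_density_def by (intro continuous_intros) auto
  have lim0: "((\<lambda>t. ?P t) \<longlongrightarrow> exp (- s * v) * 0 + exp (s * v) * 0) (at_right 0)"
  proof (intro tendsto_intros filterlim_compose[OF std_normal_cdf_limits(2)])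
    show "LIM t at_right 0. (s * t - v) / sqrt t :> at_bot" using v s by real_asymp
    show "LIM t at_right 0. - (s * t + v) / sqrt t :> at_bot" using v s by real_asymp
  qed
  have lim1: "((\<lambda>t. ?P t) \<longlongrightarrow> exp (- s * v) * 1 + exp (s * v) * 0) at_top"
  proof (intro tendsto_intros filterlim_compose[OF std_normal_cdf_limits(1)] filterlim_compose[OF std_normal_cdf_limits(2)])
    show "LIM t at_top. (s * t - v) / sqrt t :> at_top" using v s by real_asymp
    show "LIM t at_top. - (s * t + v) / sqrt t :> at_bot" using v s by real_asymp
  qed
  have nn: "AE t in lborel. (0::ereal) < ereal t \<longrightarrow> ereal t < \<infinity> \<longrightarrow> 0 \<le> ?f t"
    using v by (auto simp: hitting_density_def)
  have e: "einterval 0 \<infinity> = {0<..}" by (auto simp: einterval_def)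
  note FTC = interval_integral_FTC_nonneg[of 0 \<infinity> ?P ?f 0 "exp (- s * v)", OF _ _ _ nn]
  have r: "((?P \<circ> real_of_ereal) \<longlongrightarrow> 0) (at_right 0)" "((?P \<circ> real_of_ereal) \<longlongrightarrow> exp (- s * v)) (at_left \<infinity>)"
    unfolding zero_ereal_def ereal_tendsto_simps using lim0 lim1 by simp_all
  show "set_integrable lborel {0<..} ?f"
    using FTC(1) deriv cont r by (auto simp: e zero_ereal_def)
  have "(LBINT t=0..\<infinity>. ?f t) = exp (- s * v) - 0"
    using deriv cont r by (intro FTC(2)) (auto simp: zero_ereal_def)
  then show "(LINT t:{0<..}|lborel. ?f t) = exp (- s * v)"
    by (simp add: interval_lebesgue_integral_def e)
qed

text \<open>
  After the substitution \<open>u = exp (- t)\<close> the assumption says that all moments vanish. By Weierstrass' theorem the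
  integral of \<open>exp (- t) * \<psi> (exp (- t)) * h t\<close> is then \<open>0\<close> for every continuous \<open>\<psi>\<close>; a tent function that
  lives where \<open>h\<close> has the sign of \<open>h t0\<close> gives a contradiction if \<open>h t0 \<noteq> 0\<close>.
\<close>

lemma laplace_transform_unique:
  fixes h :: "real \<Rightarrow> real"
  assumes cont: "continuous_on {0<..} h" and bound: "\<And>t. 0 < t \<Longrightarrow> \<bar>h t\<bar> \<le> C"
    and laplace: "\<And>n :: nat. (LINT t:{0<..}|lborel. exp (- real (Suc n) * t) * h t) = 0"
    and t0: "0 < t0"
  shows "h t0 = 0"
proof (rule ccontr)
  assume nz: "h t0 \<noteq> 0"
  let ?w = "\<lambda>\<psi> t. indicator {0<..} t * (exp (- t) * \<psi> (exp (- t)) * h t) :: real"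
  have [measurable]: "(\<lambda>t. indicator {0<..} t * h t) \<in> borel_measurable borel"
    using borel_measurable_continuous_on_indicator[OF _ cont] by simp
  have C: "0 \<le> C" using bound[OF t0] by simp
  have iexp: "integrable lborel (\<lambda>t. indicator {0<..} t * exp (- t) :: real)"
  proof (rule integrableI_nonneg)
    have "(\<integral>\<^sup>+t. ennreal (indicator {0<..} t * exp (- t)) \<partial>lborel) \<le> (\<integral>\<^sup>+t. ennreal (t ^ 0 * exp (- t)) * indicator {0..} t \<partial>lborel)"
      by (intro nn_integral_mono) (auto simp: indicator_def)
    also have "\<dots> < \<infinity>"
      unfolding nn_intergal_power_times_exp_Ici by simp
    finally show "(\<integral>\<^sup>+t. ennreal (indicator {0<..} t * exp (- t)) \<partial>lborel) < \<infinity>" .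
  qed auto
  have w_meas: "?w \<psi> \<in> borel_measurable borel" if "continuous_on UNIV \<psi>" for \<psi>
  proof -
    have [measurable]: "\<psi> \<in> borel_measurable borel" using that by (rule borel_measurable_continuous_onI)
    have "?w \<psi> = (\<lambda>t. exp (- t) * \<psi> (exp (- t)) * (indicator {0<..} t * h t))"
      by (auto simp: fun_eq_iff)
    also have "\<dots> \<in> borel_measurable borel" by measurable
    finally show ?thesis .
  qed
  have w_bound: "norm (?w \<psi> t) \<le> B * C * (indicator {0<..} t * exp (- t))"
    if "\<And>x. x \<in> {0..1} \<Longrightarrow> \<bar>\<psi> x\<bar> \<le> B" for \<psi> B t
  proof (cases "0 < t")
    case True
    then have "\<bar>\<psi> (exp (- t))\<bar> * \<bar>h t\<bar> \<le> B * C"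
      using that[of "exp (- t)"] that[of 0] bound[of t] by (intro mult_mono) auto
    then have "exp (- t) * (\<bar>\<psi> (exp (- t))\<bar> * \<bar>h t\<bar>) \<le> exp (- t) * (B * C)"
      by (intro mult_left_mono) auto
    with True show ?thesis by (simp add: abs_mult mult_ac)
  qed simp
  have w_int: "integrable lborel (?w \<psi>)" if c: "continuous_on UNIV \<psi>" for \<psi>
  proof -
    have "bounded (\<psi> ` {0..1})"
      by (intro compact_imp_bounded compact_continuous_image continuous_on_subset[OF c]) auto
    then obtain B where "\<forall>y\<in>\<psi> ` {0..1}. norm y \<le> B"
      unfolding bounded_iff by blast
    then have b: "norm (?w \<psi> t) \<le> B * C * (indicator {0<..} t * exp (- t))" for t
      by (intro w_bound) simp
    show ?thesis
    proof (rule Bochner_Integration.integrable_bound[OF integrable_mult_right[OF iexp, of "B * C"]])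
      show "AE t in lborel. norm (?w \<psi> t) \<le> norm (B * C * (indicator {0<..} t * exp (- t)))"
        unfolding real_norm_def[of "B * C * _"] by (intro AE_I2 order_trans[OF b abs_ge_self])
    qed (use w_meas[OF c] in simp)
  qed
  have poly: "integral\<^sup>L lborel (?w p) = 0" if pf: "real_polynomial_function p" for p
  proof -
    obtain a n where p: "p = (\<lambda>x. \<Sum>i\<le>n. a i * x ^ i)"
      using real_polynomial_function_imp_sum[OF pf] by auto
    have "?w p t = (\<Sum>i\<le>n. a i * ?w (\<lambda>x. x ^ i) t)" for t
      unfolding p by (simp add: sum_distrib_left sum_distrib_right mult_ac)
    then have e: "integral\<^sup>L lborel (?w p) = (\<Sum>i\<le>n. a i * integral\<^sup>L lborel (?w (\<lambda>x. x ^ i)))"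
      using w_int[of "\<lambda>x. x ^ i" for i] by (simp add: continuous_on_power)
    have z: "integral\<^sup>L lborel (?w (\<lambda>x. x ^ i)) = 0" for i
    proof -
      have "exp (- real (Suc i) * t) = exp (- t) * exp (- t) ^ i" for t
        by (simp add: algebra_simps flip: exp_of_nat_mult exp_add)
      then show ?thesis
        using laplace[of i] by (simp add: set_lebesgue_integral_def)
    qed
    show ?thesis unfolding e z by simp
  qed
  have zero: "integral\<^sup>L lborel (?w \<psi>) = 0" if c: "continuous_on UNIV \<psi>" for \<psi>
  proof (rule ccontr)
    let ?I = "integral\<^sup>L lborel (\<lambda>t. indicator {0<..} t * exp (- t) :: real)"
    assume nI: "integral\<^sup>L lborel (?w \<psi>) \<noteq> 0"
    define e where "e = \<bar>integral\<^sup>L lborel (?w \<psi>)\<bar> / (2 * (C * ?I + 1))"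
    have I: "0 \<le> ?I" by (intro integral_nonneg_AE) auto
    have CI: "0 \<le> C * ?I" using C I by simp
    have e: "0 < e"
      unfolding e_def using CI nI by (intro divide_pos_pos) auto
    obtain p where p: "real_polynomial_function p" "\<And>x. x \<in> {0..1} \<Longrightarrow> \<bar>\<psi> x - p x\<bar> < e"
      using Stone_Weierstrass_real_polynomial_function[of "{0..1}" \<psi> e] e continuous_on_subset[OF c]
      by auto
    have cp: "continuous_on UNIV p"
      using p(1) by (simp add: real_polynomial_function_eq continuous_on_polymonial_function)
    have "integral\<^sup>L lborel (?w \<psi>) = integral\<^sup>L lborel (\<lambda>t. ?w \<psi> t - ?w p t)"
      using w_int[OF c] w_int[OF cp] poly[OF p(1)] by simp
    also have "(\<lambda>t. ?w \<psi> t - ?w p t) = ?w (\<lambda>x. \<psi> x - p x)"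
      by (simp add: fun_eq_iff algebra_simps)
    finally have "\<bar>integral\<^sup>L lborel (?w \<psi>)\<bar> = norm (integral\<^sup>L lborel (?w (\<lambda>x. \<psi> x - p x)))"
      by simp
    also have "\<dots> \<le> integral\<^sup>L lborel (\<lambda>t. e * C * (indicator {0<..} t * exp (- t)))"
      using p(2) by (intro Bochner_Integration.integral_norm_bound_integral w_int continuous_intros c cp
          integrable_mult_right iexp w_bound less_imp_le)
    also have "\<dots> = e * (C * ?I)" by simp
    also have "\<dots> < \<bar>integral\<^sup>L lborel (?w \<psi>)\<bar>"
    proof -
      have "\<bar>integral\<^sup>L lborel (?w \<psi>)\<bar> * (C * ?I) < \<bar>integral\<^sup>L lborel (?w \<psi>)\<bar> * (2 * (C * ?I + 1))"
        using CI nI by (intro mult_strict_left_mono) auto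
      then show ?thesis
        unfolding e_def using CI by (subst times_divide_eq_left, subst pos_divide_less_eq) auto
    qed
    finally show False by simp
  qed
  have "isCont h t0"
    using cont t0 by (simp add: continuous_on_eq_continuous_at)
  moreover have "isCont (\<lambda>x. - ln x) (exp (- t0))"
    by (intro isCont_minus isCont_ln) simp
  ultimately have "isCont (\<lambda>x. h (- ln x)) (exp (- t0))"
    using isCont_o2[of "exp (- t0)" "\<lambda>x. - ln x" h] by simp
  then have "isCont (\<lambda>x. h (- ln x) * h t0) (exp (- t0))"
    by (intro isCont_mult) auto
  then have "(\<lambda>x. h (- ln x) * h t0) \<midarrow>exp (- t0)\<rightarrow> h t0 * h t0"
    by (simp add: isCont_def)
  moreover have pos: "0 < h t0 * h t0" using nz by (auto simp: zero_less_mult_iff)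
  ultimately have "\<forall>\<^sub>F x in at (exp (- t0)). 0 < h (- ln x) * h t0"
    by (rule order_tendstoD(1))
  then obtain r where r: "r > 0" "\<And>x. x \<noteq> exp (- t0) \<Longrightarrow> \<bar>x - exp (- t0)\<bar> < r \<Longrightarrow> 0 < h (- ln x) * h t0"
    by (auto simp: eventually_at dist_real_def)
  have near: "0 < h t * h t0" if "\<bar>exp (- t) - exp (- t0)\<bar> < r" for t
    using r(2)[OF _ that] pos by (cases "t = t0") auto
  \<comment> \<open>The factor \<open>h t0\<close> makes the integrand nonnegative whatever the sign of \<open>h t0\<close> is.\<close>
  define \<psi> where "\<psi> = (\<lambda>x. max 0 (r - \<bar>x - exp (- t0)\<bar>) * h t0)"
  have c\<psi>: "continuous_on UNIV \<psi>"
    unfolding \<psi>_def by (intro continuous_intros)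
  have eq: "?w \<psi> t = indicator {0<..} t * exp (- t) * max 0 (r - \<bar>exp (- t) - exp (- t0)\<bar>) * (h t * h t0)" for t
    by (simp add: \<psi>_def mult_ac)
  have nonneg: "0 \<le> ?w \<psi> t" for t
  proof (cases "\<bar>exp (- t) - exp (- t0)\<bar> < r")
    case True
    have "0 \<le> h t * h t0" using near[OF True] by (rule less_imp_le)
    then show ?thesis unfolding eq by (rule mult_nonneg_nonneg[rotated]) auto
  next
    case False
    then show ?thesis unfolding eq by simp
  qed
  have "AE t in lborel. ?w \<psi> t = 0"
    using zero[OF c\<psi>] integral_nonneg_eq_0_iff_AE[OF w_int[OF c\<psi>]] nonneg by auto
  moreover have "open {t. 0 < t \<and> \<bar>exp (- t) - exp (- t0)\<bar> < r}"
    by (intro open_Collect_conj open_Collect_less continuous_intros)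
  then obtain \<eta> where \<eta>: "\<eta> > 0" "ball t0 \<eta> \<subseteq> {t. 0 < t \<and> \<bar>exp (- t) - exp (- t0)\<bar> < r}"
    using t0 r(1) unfolding open_contains_ball by fastforce
  have "?w \<psi> t \<noteq> 0" if "t \<in> {t0 - \<eta><..<t0 + \<eta>}" for t
  proof -
    have "t \<in> ball t0 \<eta>" using that by (auto simp: dist_real_def)
    then have "0 < t" "\<bar>exp (- t) - exp (- t0)\<bar> < r" using \<eta>(2) by auto
    then show ?thesis unfolding eq using near[of t] by auto
  qed
  ultimately have "AE t in lborel. t \<notin> {t0 - \<eta><..<t0 + \<eta>}"
    by (elim AE_mp) auto
  then have "{t0 - \<eta><..<t0 + \<eta>} \<in> null_sets lborel"
    by (subst (asm) AE_iff_null_sets[symmetric]) auto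
  then show False using \<eta>(1) by auto
qed

section \<open>Ito's formula in expectation\<close>

definition bounded_derivs :: "real \<Rightarrow> (real \<Rightarrow> real) \<Rightarrow> (real \<Rightarrow> real) \<Rightarrow> (real \<Rightarrow> real) \<Rightarrow> (real \<Rightarrow> real) \<Rightarrow> bool" where
  "bounded_derivs K f f1 f2 f3 \<longleftrightarrow> (\<forall>x. (f has_real_derivative f1 x) (at x) \<and> (f1 has_real_derivative f2 x) (at x) \<and>
     (f2 has_real_derivative f3 x) (at x) \<and> \<bar>f x\<bar> \<le> K \<and> \<bar>f1 x\<bar> \<le> K \<and> \<bar>f2 x\<bar> \<le> K \<and> \<bar>f3 x\<bar> \<le> K)"

lemma bounded_derivsD:
  assumes "bounded_derivs K f f1 f2 f3"
  shows "(f has_real_derivative f1 x) (at x)" "(f1 has_real_derivative f2 x) (at x)" "(f2 has_real_derivative f3 x) (at x)"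
    "\<bar>f x\<bar> \<le> K" "\<bar>f1 x\<bar> \<le> K" "\<bar>f2 x\<bar> \<le> K" "\<bar>f3 x\<bar> \<le> K"
    "f \<in> borel_measurable borel" "f1 \<in> borel_measurable borel" "f2 \<in> borel_measurable borel" "0 \<le> K"
proof -
  show *: "(f has_real_derivative f1 x) (at x)" "(f1 has_real_derivative f2 x) (at x)" "(f2 has_real_derivative f3 x) (at x)"
    "\<bar>f x\<bar> \<le> K" "\<bar>f1 x\<bar> \<le> K" "\<bar>f2 x\<bar> \<le> K" "\<bar>f3 x\<bar> \<le> K" for x
    using assms by (auto simp: bounded_derivs_def)
  show "f \<in> borel_measurable borel" "f1 \<in> borel_measurable borel" "f2 \<in> borel_measurable borel"
    using *(1-3) by (auto intro!: borel_measurable_continuous_onI continuous_at_imp_continuous_on DERIV_isCont)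
  show "0 \<le> K" using *(4)[of 0] by simp
qed

lemma lipschitz_of_deriv_bound:
  fixes f :: "real \<Rightarrow> real"
  assumes "\<And>x. (f has_real_derivative f' x) (at x)" "\<And>x. \<bar>f' x\<bar> \<le> K"
  shows "\<bar>f x - f y\<bar> \<le> K * \<bar>x - y\<bar>"
proof -
  have "norm (f x - f y) \<le> K * norm (x - y)"
    by (rule field_differentiable_bound[of UNIV f f']) (use assms in auto)
  then show ?thesis by simp
qed

lemma taylor3_bound:
  assumes "bounded_derivs K f f1 f2 f3"
  shows "\<bar>f (y + g) - f y - f1 y * g - f2 y * g\<^sup>2 / 2\<bar> \<le> K * \<bar>g\<bar> ^ 3 / 6"
proof -
  note f = bounded_derivsD[OF assms]
  let ?d = "\<lambda>(m :: nat) t. if m = 0 then f (y + t) else if m = 1 then f1 (y + t) else if m = 2 then f2 (y + t) else f3 (y + t)"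
  have d: "((\<lambda>t. h (y + t)) has_real_derivative h' (y + t)) (at t)" if "(h has_real_derivative h' (y + t)) (at (y + t))" for h h' t
  proof -
    have "((\<lambda>t. y + t) has_real_derivative 1) (at t)" by (auto intro!: derivative_eq_intros)
    from DERIV_chain2[of h "h' (y + t)" "\<lambda>t. y + t", OF that this] show ?thesis by simp
  qed
  have "\<forall>m t. m < 3 \<and> \<bar>t\<bar> \<le> \<bar>g\<bar> \<longrightarrow> (?d m has_real_derivative ?d (Suc m) t) (at t)"
  proof (intro allI impI)
    fix m :: nat and t :: real assume "m < 3 \<and> \<bar>t\<bar> \<le> \<bar>g\<bar>"
    then have "m = 0 \<or> m = 1 \<or> m = 2" by auto
    then show "(?d m has_real_derivative ?d (Suc m) t) (at t)"
      using d[of f f1 t] d[of f1 f2 t] d[of f2 f3 t] f(1-3)[of "y + t"] by auto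
  qed
  from Maclaurin_bi_le[of ?d "\<lambda>t. f (y + t)" 3 g, OF _ this] obtain t where
    "f (y + g) = (\<Sum>m<3. ?d m 0 / fact m * g ^ m) + ?d 3 t / fact 3 * g ^ 3" by auto
  then have "f (y + g) - f y - f1 y * g - f2 y * g\<^sup>2 / 2 = f3 (y + t) * g ^ 3 / 6"
    by (simp add: eval_nat_numeral lessThan_Suc field_simps)
  then have "\<bar>f (y + g) - f y - f1 y * g - f2 y * g\<^sup>2 / 2\<bar> = \<bar>f3 (y + t) * g ^ 3 / 6\<bar>"
    by (rule arg_cong)
  also have "\<dots> = \<bar>f3 (y + t)\<bar> * \<bar>g\<bar> ^ 3 / 6"
    by (simp add: abs_mult power_abs)
  also have "\<bar>f3 (y + t)\<bar> * \<bar>g\<bar> ^ 3 / 6 \<le> K * \<bar>g\<bar> ^ 3 / 6"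
    using f(7)[of "y + t"] by (simp add: mult_right_mono)
  finally show ?thesis .
qed

text \<open>
  One time step of Ito's formula. By independence the linear term of the Taylor expansion has mean zero and the
  quadratic one contributes \<open>\<sigma>\<^sup>2/2\<close> times the mean second derivative. With \<open>\<sigma>\<^sup>2 = T/n\<close> the errors
  \<open>\<sigma>\<^sup>3\<close> of \<open>n\<close> steps add up to a null sequence.
\<close>

lemma (in prob_space) gaussian_increment_expectation:
  assumes bd: "bounded_derivs K f f1 f2 f3" and indep: "indep_var borel Y borel G"
    and G: "distributed M lborel G (normal_density 0 \<sigma>)" and \<sigma>: "0 < \<sigma>"
  shows "\<bar>expectation (\<lambda>\<omega>. f (Y \<omega> + G \<omega>)) - expectation (\<lambda>\<omega>. f (Y \<omega>)) - \<sigma>\<^sup>2 / 2 * expectation (\<lambda>\<omega>. f2 (Y \<omega>))\<bar> \<le> K * \<sigma> ^ 3"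
proof -
  note f = bounded_derivsD[OF bd]
  have [measurable]: "f \<in> borel_measurable borel" "f1 \<in> borel_measurable borel" "f2 \<in> borel_measurable borel"
    by (fact f)+
  have [measurable]: "Y \<in> borel_measurable M" "G \<in> borel_measurable M"
    using indep by (auto dest: indep_var_rv1 indep_var_rv2)
  have int: "integrable M (\<lambda>\<omega>. g (G \<omega>)) \<longleftrightarrow> integrable lborel (\<lambda>x. normal_density 0 \<sigma> x * g x)"
    "expectation (\<lambda>\<omega>. g (G \<omega>)) = (\<integral>x. normal_density 0 \<sigma> x * g x \<partial>lborel)"
    if "g \<in> borel_measurable borel" for g :: "real \<Rightarrow> real"
    using distributed_integrable[OF G, of g] distributed_integral[OF G, of g] that by auto
  have i1: "integrable M G" "expectation G = 0"
    using int[of "\<lambda>x. x"] integrable_normal_moment[OF \<sigma>, of 0 1] integral_normal_moment_odd[OF \<sigma>, of 0 0] by auto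
  have i2: "integrable M (\<lambda>\<omega>. (G \<omega>)\<^sup>2)" "expectation (\<lambda>\<omega>. (G \<omega>)\<^sup>2) = \<sigma>\<^sup>2"
    using int[of "\<lambda>x. x\<^sup>2"] integrable_normal_moment[OF \<sigma>, of 0 2] integral_normal_moment_even[OF \<sigma>, of 0 1] by auto
  have i3: "integrable M (\<lambda>\<omega>. \<bar>G \<omega>\<bar> ^ 3)" "expectation (\<lambda>\<omega>. \<bar>G \<omega>\<bar> ^ 3) = 2 * \<sigma> ^ 3 * sqrt (2 / pi)"
    using int[of "\<lambda>x. \<bar>x\<bar> ^ 3"] integrable_normal_moment_abs[OF \<sigma>, of 0 3] integral_normal_moment_abs_odd[OF \<sigma>, of 0 1] by auto
  have b: "integrable M (\<lambda>\<omega>. f (Y \<omega> + G \<omega>))" "integrable M (\<lambda>\<omega>. f (Y \<omega>))" "integrable M (\<lambda>\<omega>. f1 (Y \<omega>))" "integrable M (\<lambda>\<omega>. f2 (Y \<omega>))"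
    by (rule integrable_const_bound[where B = K]; use f in simp)+
  have "indep_var borel (f1 \<circ> Y) borel (id \<circ> G)" "indep_var borel (f2 \<circ> Y) borel ((\<lambda>x. x\<^sup>2) \<circ> G)"
    by (intro indep_var_compose[OF indep]; measurable)+
  then have ind: "indep_var borel (\<lambda>\<omega>. f1 (Y \<omega>)) borel G" "indep_var borel (\<lambda>\<omega>. f2 (Y \<omega>)) borel (\<lambda>\<omega>. (G \<omega>)\<^sup>2)"
    by (simp_all add: comp_def)
  note p1 = indep_var_integrable[OF ind(1) b(3) i1(1)] indep_var_lebesgue_integral[OF ind(1) b(3) i1(1)]
  note p2 = indep_var_integrable[OF ind(2) b(4) i2(1)] indep_var_lebesgue_integral[OF ind(2) b(4) i2(1)]
  have "expectation (\<lambda>\<omega>. f (Y \<omega> + G \<omega>)) - expectation (\<lambda>\<omega>. f (Y \<omega>)) - \<sigma>\<^sup>2 / 2 * expectation (\<lambda>\<omega>. f2 (Y \<omega>))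
    = expectation (\<lambda>\<omega>. f (Y \<omega> + G \<omega>) - f (Y \<omega>) - f1 (Y \<omega>) * G \<omega> - f2 (Y \<omega>) * (G \<omega>)\<^sup>2 / 2)"
    using b p1 p2 i1 i2 by simp
  also have "norm \<dots> \<le> expectation (\<lambda>\<omega>. K * \<bar>G \<omega>\<bar> ^ 3 / 6)"
    unfolding real_norm_def by (rule abs_integral_le) (use b p1 p2 i3 taylor3_bound[OF bd] in auto)
  also have "\<dots> = K * \<sigma> ^ 3 * (sqrt (2 / pi) / 3)"
    using i3 by simp
  also have "\<dots> \<le> K * \<sigma> ^ 3 * 1"
  proof (rule mult_left_mono)
    have "sqrt (2 / pi) \<le> sqrt 1" using pi_gt3 by (intro real_sqrt_le_mono) simp
    also have "sqrt 1 = (1 :: real)" by simp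
    finally show "sqrt (2 / pi) / 3 \<le> 1" by linarith
  qed (use f(11) \<sigma> in simp)
  finally show ?thesis by simp
qed

definition grid :: "real \<Rightarrow> nat \<Rightarrow> nat \<Rightarrow> real" where
  "grid T n i = T * real i / real n"

abbreviation cell :: "real \<Rightarrow> nat \<Rightarrow> nat \<Rightarrow> real set" where
  "cell T n i \<equiv> {grid T n i..grid T n (Suc i)}"

lemma grid_facts:
  assumes "0 \<le> T" "i < n"
  shows "0 \<le> grid T n i" "grid T n i \<le> grid T n (Suc i)" "grid T n (Suc i) \<le> T" "grid T n (Suc i) - grid T n i = T / n"
proof -
  show "0 \<le> grid T n i" using assms by (simp add: grid_def)
  show d: "grid T n (Suc i) - grid T n i = T / n" by (simp add: grid_def add_divide_distrib distrib_left)
  then show "grid T n i \<le> grid T n (Suc i)" using divide_nonneg_nonneg[OF assms(1), of "real n"] by simp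
  have "T * real (Suc i) \<le> T * real n" using assms by (intro mult_left_mono) auto
  then show "grid T n (Suc i) \<le> T" using assms by (simp add: grid_def field_simps)
qed

lemma sum_integral_grid:
  fixes h :: "real \<Rightarrow> real"
  assumes T: "0 \<le> T" and n: "0 < n" and h: "h integrable_on {0..T}"
  shows "(\<Sum>i<n. integral (cell T n i) h) = integral {0..T} h"
proof -
  have "k \<le> n \<Longrightarrow> (\<Sum>i<k. integral (cell T n i) h) = integral {0..grid T n k} h" for k
  proof (induction k)
    case 0
    then show ?case by (simp add: grid_def)
  next
    case (Suc k)
    then have k: "k < n" by simp
    note g = grid_facts[OF T k]
    have "integral {0..grid T n k} h + integral {grid T n k..grid T n (Suc k)} h = integral {0..grid T n (Suc k)} h"
      using g by (intro Henstock_Kurzweil_Integration.integral_combine integrable_subinterval_real[OF h]) auto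
    then show ?case using Suc by simp
  qed
  from this[of n] show ?thesis using n by (simp add: grid_def)
qed

text \<open>
  Riemann sums for a measure with density \<open>\<beta>\<close>, with tags \<open>\<xi> n i\<close> that are only near to the path \<open>z\<close>: in the drift
  sums they come from the mean value theorem.
\<close>

lemma riemann_stieltjes_limit:
  fixes z \<beta> g :: "real \<Rightarrow> real" and \<xi> :: "nat \<Rightarrow> nat \<Rightarrow> real"
  assumes T: "0 \<le> T" and \<beta>: "\<beta> integrable_on {0..T}" "\<And>u. 0 \<le> \<beta> u"
    and g\<beta>: "(\<lambda>u. g (z u) * \<beta> u) integrable_on {0..T}"
    and g: "\<And>x y. \<bar>g x - g y\<bar> \<le> K * \<bar>x - y\<bar>" and K: "0 \<le> K"
    and close: "\<And>\<epsilon>. 0 < \<epsilon> \<Longrightarrow> \<forall>\<^sub>F n in sequentially. \<forall>i<n. \<forall>u\<in>cell T n i. \<bar>\<xi> n i - z u\<bar> \<le> \<epsilon>"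
  shows "(\<lambda>n. \<Sum>i<n. g (\<xi> n i) * integral (cell T n i) \<beta>) \<longlonglongrightarrow> integral {0..T} (\<lambda>u. g (z u) * \<beta> u)"
proof (rule LIMSEQ_I)
  fix e :: real assume e: "0 < e"
  let ?I = "integral {0..T} \<beta>"
  have I: "0 \<le> ?I" using \<beta> by (intro Henstock_Kurzweil_Integration.integral_nonneg) auto
  define \<epsilon> where "\<epsilon> = e / (2 * (K * ?I + 1))"
  have \<epsilon>: "0 < \<epsilon>" using e K I by (simp add: \<epsilon>_def add_nonneg_pos)
  have "K * \<epsilon> * ?I < e"
  proof -
    define c where "c = K * ?I"
    have c: "0 \<le> c" using K I by (simp add: c_def)
    have "e * c < e * (2 * (c + 1))"
      using e c by (intro mult_strict_left_mono) simp_all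
    then have "e * c / (2 * (c + 1)) < e" using c by (simp add: pos_divide_less_eq)
    then show ?thesis by (simp add: \<epsilon>_def c_def mult_ac)
  qed
  obtain n0 where n0: "\<And>n i u. n0 \<le> n \<Longrightarrow> i < n \<Longrightarrow> u \<in> cell T n i \<Longrightarrow> \<bar>\<xi> n i - z u\<bar> \<le> \<epsilon>"
    using close[OF \<epsilon>] unfolding eventually_sequentially by blast
  have "norm ((\<Sum>i<n. g (\<xi> n i) * integral (cell T n i) \<beta>) - integral {0..T} (\<lambda>u. g (z u) * \<beta> u)) < e"
    if n: "max 1 n0 \<le> n" for n
  proof -
    have n': "0 < n" using n by simp
    have sub: "h integrable_on cell T n i" if "h integrable_on {0..T}" "i < n" for h :: "real \<Rightarrow> real" and i
      using grid_facts[OF T that(2)] by (intro integrable_subinterval_real[OF that(1)]) auto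
    have "(\<Sum>i<n. g (\<xi> n i) * integral (cell T n i) \<beta>) - integral {0..T} (\<lambda>u. g (z u) * \<beta> u)
       = (\<Sum>i<n. g (\<xi> n i) * integral (cell T n i) \<beta> - integral (cell T n i) (\<lambda>u. g (z u) * \<beta> u))"
      by (simp add: sum_subtractf sum_integral_grid[OF T n' g\<beta>])
    also have "\<bar>\<dots>\<bar> \<le> (\<Sum>i<n. K * \<epsilon> * integral (cell T n i) \<beta>)"
    proof (rule order_trans[OF sum_abs sum_mono])
      fix i assume "i \<in> {..<n}"
      then have i: "i < n" by simp
      let ?J = "cell T n i"
      note i\<beta> = sub[OF \<beta>(1) i] and ig = sub[OF g\<beta> i]
      have "g (\<xi> n i) * integral ?J \<beta> - integral ?J (\<lambda>u. g (z u) * \<beta> u) = integral ?J (\<lambda>u. g (\<xi> n i) * \<beta> u - g (z u) * \<beta> u)"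
        using i\<beta> ig by (subst Henstock_Kurzweil_Integration.integral_diff) (auto intro: integrable_on_mult_right)
      also have "norm \<dots> \<le> integral ?J (\<lambda>u. K * \<epsilon> * \<beta> u)"
      proof (rule integral_norm_bound_integral)
        show "(\<lambda>u. g (\<xi> n i) * \<beta> u - g (z u) * \<beta> u) integrable_on ?J"
          using i\<beta> ig by (intro integrable_diff integrable_on_mult_right)
        show "(\<lambda>u. K * \<epsilon> * \<beta> u) integrable_on ?J"
          using i\<beta> by (intro integrable_on_mult_right)
        fix u assume u: "u \<in> ?J"
        have "\<bar>g (\<xi> n i) - g (z u)\<bar> \<le> K * \<bar>\<xi> n i - z u\<bar>" by (rule g)
        also have "\<dots> \<le> K * \<epsilon>" using n0[of n i u] n i u K by (intro mult_left_mono) auto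
        finally have "\<bar>g (\<xi> n i) - g (z u)\<bar> * \<beta> u \<le> K * \<epsilon> * \<beta> u" using \<beta>(2) by (rule mult_right_mono)
        then show "norm (g (\<xi> n i) * \<beta> u - g (z u) * \<beta> u) \<le> K * \<epsilon> * \<beta> u"
          using \<beta>(2)[of u] by (simp add: abs_mult flip: left_diff_distrib)
      qed
      finally show "\<bar>g (\<xi> n i) * integral ?J \<beta> - integral ?J (\<lambda>u. g (z u) * \<beta> u)\<bar> \<le> K * \<epsilon> * integral ?J \<beta>"
        by simp
    qed
    also have "\<dots> = K * \<epsilon> * ?I"
      by (simp add: sum_distrib_left[symmetric] sum_integral_grid[OF T n' \<beta>(1)])
    finally show ?thesis using \<open>K * \<epsilon> * ?I < e\<close> by simp
  qed
  then show "\<exists>no. \<forall>n\<ge>no. norm ((\<Sum>i<n. g (\<xi> n i) * integral (cell T n i) \<beta>) - integral {0..T} (\<lambda>u. g (z u) * \<beta> u)) < e"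
    by blast
qed

lemma uniform_on_grid:
  fixes z :: "real \<Rightarrow> real"
  assumes T: "0 \<le> T" and z: "continuous_on {0..T} z" and \<epsilon>: "0 < \<epsilon>"
  shows "\<forall>\<^sub>F n in sequentially. \<forall>i<n. \<forall>u\<in>cell T n i. \<forall>v\<in>cell T n i. \<bar>z u - z v\<bar> \<le> \<epsilon>"
proof -
  have "uniformly_continuous_on {0..T} z" by (intro compact_uniformly_continuous z) auto
  then obtain \<delta> where \<delta>: "0 < \<delta>" "\<And>u v. u \<in> {0..T} \<Longrightarrow> v \<in> {0..T} \<Longrightarrow> dist v u < \<delta> \<Longrightarrow> dist (z v) (z u) < \<epsilon>"
    using \<epsilon> unfolding uniformly_continuous_on_def by metis
  have "(\<lambda>n. T / real n) \<longlonglongrightarrow> 0" by (rule lim_const_over_n)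
  from order_tendstoD(2)[OF this \<delta>(1)] show ?thesis
  proof eventually_elim
    case (elim n)
    show ?case
    proof (intro allI impI ballI)
      fix i u v assume i: "i < n" and uv: "u \<in> cell T n i" "v \<in> cell T n i"
      note g = grid_facts[OF T i]
      have "\<bar>u - v\<bar> < \<delta>" using uv g(4) elim by (auto simp: abs_le_iff)
      then have "dist (z u) (z v) < \<epsilon>" using uv g by (intro \<delta>(2)) (auto simp: dist_real_def)
      then show "\<bar>z u - z v\<bar> \<le> \<epsilon>" by (simp add: dist_real_def)
    qed
  qed
qed


text \<open>
  A process \<open>X = x0 + W + \<integral> b(X) du\<close> with a nonnegative drift that may be singular and is integrable in time along
  almost every path only. All paths are required to be continuous on the whole line, which makes \<open>X\<close> jointly
  measurable. The filtration is replaced by its effect on one time step, the independence of \<open>X s\<close> and the later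
  increments of \<open>W\<close>.
\<close>

locale drifted_brownian = prob_space M
  for M :: "'a measure" +
  fixes X :: "'a \<Rightarrow> real \<Rightarrow> real" and W :: "real \<Rightarrow> 'a \<Rightarrow> real" and b :: "real \<Rightarrow> real" and x0 :: real
  assumes X_cont: "continuous_on UNIV (X \<omega>)"
    and X_meas: "(\<lambda>\<omega>. X \<omega> u) \<in> borel_measurable M"
    and W_meas: "0 \<le> u \<Longrightarrow> W u \<in> borel_measurable M"
    and b_meas [measurable]: "b \<in> borel_measurable borel"
    and b_nonneg: "0 \<le> b r"
    and indep: "0 \<le> s \<Longrightarrow> s < t \<Longrightarrow> indep_var borel (\<lambda>\<omega>. X \<omega> s) borel (\<lambda>\<omega>. W t \<omega> - W s \<omega>)"
    and increment_normal: "0 \<le> s \<Longrightarrow> s < t \<Longrightarrow> distributed M lborel (\<lambda>\<omega>. W t \<omega> - W s \<omega>) (normal_density 0 (sqrt (t - s)))"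
    and X_start: "AE \<omega> in M. X \<omega> 0 = x0"
    and drift: "AE \<omega> in M. \<forall>t\<ge>0. set_integrable lborel {0..t} (\<lambda>u. b (X \<omega> u)) \<and>
        X \<omega> t = x0 + W t \<omega> + (LINT u:{0..t}|lborel. b (X \<omega> u))"
begin

text \<open>The path is the pointwise limit of its left-point discretisations, each of which uses countably many times only.\<close>

lemma X_jointly_measurable [measurable]: "(\<lambda>p. X (fst p) (snd p)) \<in> borel_measurable (M \<Otimes>\<^sub>M borel)"
proof (rule borel_measurable_LIMSEQ_real)
  fix p :: "'a \<times> real"
  let ?u = "\<lambda>n. real_of_int \<lfloor>real (Suc n) * snd p\<rfloor> / real (Suc n)"
  have "?u \<longlonglongrightarrow> snd p"
    by real_asymp
  moreover have "isCont (X (fst p)) (snd p)"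
    using X_cont[of "fst p"] by (simp add: continuous_on_eq_continuous_at)
  ultimately show "(\<lambda>n. X (fst p) (?u n)) \<longlonglongrightarrow> X (fst p) (snd p)"
    by (rule isCont_tendsto_compose[rotated])
next
  fix n
  show "(\<lambda>p. X (fst p) (real_of_int \<lfloor>real (Suc n) * snd p\<rfloor> / real (Suc n))) \<in> borel_measurable (M \<Otimes>\<^sub>M borel)"
  proof (rule measurable_compose_countable[where f = "\<lambda>i p. X (fst p) (real_of_int i / real (Suc n))"])
    show "(\<lambda>p. X (fst p) (real_of_int i / real (Suc n))) \<in> borel_measurable (M \<Otimes>\<^sub>M borel)" for i
      by (rule measurable_compose[OF measurable_fst X_meas])
  qed measurable
qed

lemma X_measurable [measurable]: "(\<lambda>\<omega>. X \<omega> u) \<in> borel_measurable M"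
  by (rule X_meas)

lemma X_path_measurable [measurable]: "X \<omega> \<in> borel_measurable borel"
  by (rule borel_measurable_continuous_onI[OF X_cont])

definition regular_path :: "'a \<Rightarrow> bool" where
  "regular_path \<omega> \<longleftrightarrow> X \<omega> 0 = x0 \<and> (\<forall>t\<ge>0. set_integrable lborel {0..t} (\<lambda>u. b (X \<omega> u)) \<and>
        X \<omega> t = x0 + W t \<omega> + (LINT u:{0..t}|lborel. b (X \<omega> u)))"

lemma AE_regular_path: "AE \<omega> in M. regular_path \<omega>"
  using X_start drift unfolding regular_path_def by eventually_elim simp

lemma regular_path_increment:
  assumes "regular_path \<omega>" "0 \<le> s" "s \<le> t"
  shows "(\<lambda>u. b (X \<omega> u)) integrable_on {0..t}"
    "X \<omega> t = X \<omega> s + (W t \<omega> - W s \<omega>) + integral {s..t} (\<lambda>u. b (X \<omega> u))"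
proof -
  have int: "(\<lambda>u. b (X \<omega> u)) integrable_on {0..r}" and
    X: "X \<omega> r = x0 + W r \<omega> + integral {0..r} (\<lambda>u. b (X \<omega> u))" if "0 \<le> r" for r
    using assms(1) that set_borel_integral_eq_integral[of "{0..r}" "\<lambda>u. b (X \<omega> u)"] by (auto simp: regular_path_def)
  show "(\<lambda>u. b (X \<omega> u)) integrable_on {0..t}" using int assms by simp
  have "integral {0..s} (\<lambda>u. b (X \<omega> u)) + integral {s..t} (\<lambda>u. b (X \<omega> u)) = integral {0..t} (\<lambda>u. b (X \<omega> u))"
    using assms int[of t] by (intro Henstock_Kurzweil_Integration.integral_combine) auto
  then show "X \<omega> t = X \<omega> s + (W t \<omega> - W s \<omega>) + integral {s..t} (\<lambda>u. b (X \<omega> u))"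
    using X[of s] X[of t] assms by simp
qed

lemma integrable_bounded_drift:
  assumes "regular_path \<omega>" "0 \<le> T" and g: "g \<in> borel_measurable borel" "\<And>x. \<bar>g x\<bar> \<le> K"
  shows "set_integrable lborel {0..T} (\<lambda>u. g (X \<omega> u) * b (X \<omega> u))"
    "set_integrable lborel {0..T} (\<lambda>u. g (X \<omega> u))"
proof -
  have [measurable]: "g \<in> borel_measurable borel" by fact
  have K: "0 \<le> K" using g(2)[of 0] by simp
  have "set_integrable lborel {0..T} (\<lambda>u. K * b (X \<omega> u))"
    using assms by (auto simp: regular_path_def intro!: set_integrable_mult_right)
  then show "set_integrable lborel {0..T} (\<lambda>u. g (X \<omega> u) * b (X \<omega> u))"
  proof (rule set_integrable_bound)
    show "set_borel_measurable lborel {0..T} (\<lambda>u. g (X \<omega> u) * b (X \<omega> u))"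
      unfolding set_borel_measurable_def by measurable
    show "AE u in lborel. u \<in> {0..T} \<longrightarrow> norm (g (X \<omega> u) * b (X \<omega> u)) \<le> norm (K * b (X \<omega> u))"
      using g(2) K b_nonneg by (auto simp: abs_mult intro!: mult_mono)
  qed
  have "set_integrable lborel {0..T} (\<lambda>u. K)"
    unfolding set_integrable_def
    by (intro integrable_scaleR_left integrable_real_indicator) (auto simp: emeasure_lborel_Icc_eq)
  then show "set_integrable lborel {0..T} (\<lambda>u. g (X \<omega> u))"
  proof (rule set_integrable_bound)
    show "set_borel_measurable lborel {0..T} (\<lambda>u. g (X \<omega> u))"
      unfolding set_borel_measurable_def by measurable
    show "AE u in lborel. u \<in> {0..T} \<longrightarrow> norm (g (X \<omega> u)) \<le> norm K"
      using g(2) K by auto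
  qed
qed

text \<open>
  In each time step the increment of \<open>f(X)\<close> is split at the intermediate value \<open>X + \<Delta>W\<close>. The part below collects
  the effect of the drift; it is defined through \<open>W\<close> and not through the drift integral, and so it is bounded for
  every \<open>n\<close>.
\<close>

definition drift_sum :: "(real \<Rightarrow> real) \<Rightarrow> real \<Rightarrow> nat \<Rightarrow> 'a \<Rightarrow> real" where
  "drift_sum f T n \<omega> = (\<Sum>i<n. f (X \<omega> (grid T n (Suc i))) -
     f (X \<omega> (grid T n i) + (W (grid T n (Suc i)) \<omega> - W (grid T n i) \<omega>)))"

text \<open>The mean value theorem on the interval between \<open>X + \<Delta>W\<close> and the next value of \<open>X\<close>, whose length is the drift.\<close>

lemma drift_sum_eq:
  assumes bd: "bounded_derivs K f f1 f2 f3" and \<omega>: "regular_path \<omega>" and T: "0 \<le> T"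
  shows "\<exists>\<xi>. drift_sum f T n \<omega> = (\<Sum>i<n. f1 (\<xi> i) * integral (cell T n i) (\<lambda>u. b (X \<omega> u))) \<and>
     (\<forall>i<n. \<bar>\<xi> i - X \<omega> (grid T n (Suc i))\<bar> \<le> integral (cell T n i) (\<lambda>u. b (X \<omega> u)))"
proof -
  let ?A = "\<lambda>i. integral (cell T n i) (\<lambda>u. b (X \<omega> u))"
  have "\<exists>\<xi>. f (X \<omega> (grid T n (Suc i))) - f (X \<omega> (grid T n i) + (W (grid T n (Suc i)) \<omega> - W (grid T n i) \<omega>)) = f1 \<xi> * ?A i \<and>
     \<bar>\<xi> - X \<omega> (grid T n (Suc i))\<bar> \<le> ?A i" if i: "i < n" for i
  proof -
    define p where "p = X \<omega> (grid T n (Suc i))"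
    define q where "q = X \<omega> (grid T n i) + (W (grid T n (Suc i)) \<omega> - W (grid T n i) \<omega>)"
    note g = grid_facts[OF T i]
    have pq: "p = q + ?A i"
      using regular_path_increment(2)[OF \<omega> g(1,2)] by (simp add: p_def q_def)
    have A: "0 \<le> ?A i"
      using integrable_subinterval_real[OF regular_path_increment(1)[OF \<omega> g(1,2)], of "grid T n i" "grid T n (Suc i)"] g b_nonneg
      by (intro Henstock_Kurzweil_Integration.integral_nonneg) auto
    show ?thesis
    proof (cases "?A i = 0")
      case True
      then show ?thesis using pq by (intro exI[of _ p]) (simp add: p_def q_def)
    next
      case False
      then have "q < p" using pq A by simp
      then obtain \<xi> where "q < \<xi>" "\<xi> < p" "f p - f q = (p - q) * f1 \<xi>"
        using MVT2[of q p f f1] bounded_derivsD(1)[OF bd] by blast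
      then show ?thesis using pq by (intro exI[of _ \<xi>]) (auto simp: p_def q_def)
    qed
  qed
  then obtain \<xi> where \<xi>: "\<And>i. i < n \<Longrightarrow> f (X \<omega> (grid T n (Suc i))) - f (X \<omega> (grid T n i) + (W (grid T n (Suc i)) \<omega> - W (grid T n i) \<omega>)) = f1 (\<xi> i) * ?A i \<and>
     \<bar>\<xi> i - X \<omega> (grid T n (Suc i))\<bar> \<le> ?A i" by metis
  show ?thesis
    unfolding drift_sum_def using \<xi> by (intro exI[of _ \<xi>] conjI sum.cong) auto
qed

lemma drift_sum_tendsto:
  assumes bd: "bounded_derivs K f f1 f2 f3" and \<omega>: "regular_path \<omega>" and T: "0 \<le> T"
  shows "(\<lambda>n. drift_sum f T n \<omega>) \<longlonglongrightarrow> (LINT u:{0..T}|lborel. f1 (X \<omega> u) * b (X \<omega> u))"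
proof -
  let ?b = "\<lambda>u. b (X \<omega> u)"
  let ?A = "\<lambda>n i. integral (cell T n i) ?b"
  note f = bounded_derivsD[OF bd]
  have "\<forall>n. \<exists>\<xi>. drift_sum f T n \<omega> = (\<Sum>i<n. f1 (\<xi> i) * ?A n i) \<and>
     (\<forall>i<n. \<bar>\<xi> i - X \<omega> (grid T n (Suc i))\<bar> \<le> ?A n i)"
    using drift_sum_eq[OF bd \<omega> T] by (intro allI)
  from choice[OF this] obtain \<xi> where \<xi>: "\<And>n. drift_sum f T n \<omega> = (\<Sum>i<n. f1 (\<xi> n i) * ?A n i)"
     "\<And>n i. i < n \<Longrightarrow> \<bar>\<xi> n i - X \<omega> (grid T n (Suc i))\<bar> \<le> ?A n i"
    by blast
  have ib: "?b integrable_on {0..T}" by (rule regular_path_increment(1)[OF \<omega> order_refl T])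
  note ifb = integrable_bounded_drift(1)[OF \<omega> T f(9) f(5)]
  have "(\<lambda>n. \<Sum>i<n. f1 (\<xi> n i) * ?A n i) \<longlonglongrightarrow> integral {0..T} (\<lambda>u. f1 (X \<omega> u) * ?b u)"
  proof (rule riemann_stieltjes_limit[where g = f1 and z = "X \<omega>" and K = K, OF T ib b_nonneg _ _ f(11)])
    show "(\<lambda>u. f1 (X \<omega> u) * ?b u) integrable_on {0..T}"
      using set_borel_integral_eq_integral(1)[OF ifb] .
    show "\<bar>f1 x - f1 y\<bar> \<le> K * \<bar>x - y\<bar>" for x y
      by (rule lipschitz_of_deriv_bound) (rule f)+
    fix \<epsilon> :: real assume "0 < \<epsilon>"
    then have \<epsilon>: "0 < \<epsilon> / 2" by simp
    have "continuous_on {0..T} (\<lambda>t. integral {0..t} ?b)"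
      by (rule indefinite_integral_continuous_1[OF ib])
    from uniform_on_grid[OF T this \<epsilon>] uniform_on_grid[OF T continuous_on_subset[OF X_cont subset_UNIV] \<epsilon>, of \<omega>]
    show "\<forall>\<^sub>F n in sequentially. \<forall>i<n. \<forall>u\<in>cell T n i. \<bar>\<xi> n i - X \<omega> u\<bar> \<le> \<epsilon>"
    proof eventually_elim
      case (elim n)
      show ?case
      proof (intro allI impI ballI)
        fix i u assume i: "i < n" and u: "u \<in> cell T n i"
        note g = grid_facts[OF T i]
        have "integral {0..grid T n i} ?b + ?A n i = integral {0..grid T n (Suc i)} ?b"
          using g by (intro Henstock_Kurzweil_Integration.integral_combine integrable_subinterval_real[OF ib]) auto
        moreover have "\<bar>integral {0..grid T n (Suc i)} ?b - integral {0..grid T n i} ?b\<bar> \<le> \<epsilon> / 2"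
          using elim(1) i g by auto
        moreover have "\<bar>X \<omega> (grid T n (Suc i)) - X \<omega> u\<bar> \<le> \<epsilon> / 2"
          using elim(2) i u g by auto
        ultimately show "\<bar>\<xi> n i - X \<omega> u\<bar> \<le> \<epsilon>"
          using \<xi>(2)[OF i] by linarith
      qed
    qed
  qed
  then show ?thesis
    unfolding \<xi>(1)[symmetric] by (simp add: set_borel_integral_eq_integral(2)[OF ifb])
qed


lemma drift_sum_measurable [measurable]:
  assumes [measurable]: "f \<in> borel_measurable borel" and "0 \<le> T"
  shows "drift_sum f T n \<in> borel_measurable M"
proof -
  have [measurable]: "W (grid T n i) \<in> borel_measurable M" for i
    using assms(2) by (intro W_meas) (simp add: grid_def)
  show ?thesis unfolding drift_sum_def[abs_def] by measurable
qed

lemma time_integral_measurable [measurable]: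
  fixes h :: "real \<Rightarrow> real"
  assumes [measurable]: "h \<in> borel_measurable borel"
  shows "(\<lambda>\<omega>. LINT u:{0..T}|lborel. h (X \<omega> u)) \<in> borel_measurable M"
proof -
  have "(\<lambda>(\<omega>, u). indicator {0..T} u *\<^sub>R h (X \<omega> u)) \<in> borel_measurable (M \<Otimes>\<^sub>M lborel)"
    unfolding case_prod_beta by measurable
  then show ?thesis
    unfolding set_lebesgue_integral_def
    by (rule lborel.borel_measurable_lebesgue_integral)
qed

lemma abs_time_integral_le:
  assumes g: "g \<in> borel_measurable borel" "\<And>x. \<bar>g x\<bar> \<le> K" and T: "0 \<le> T"
  shows "\<bar>LINT u:{0..T}|lborel. g (X \<omega> u)\<bar> \<le> K * T"
proof -
  have [measurable]: "g \<in> borel_measurable borel" by fact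
  have K: "0 \<le> K" using g(2)[of 0] by simp
  have i: "integrable lborel (\<lambda>u. indicator {0..T} u * K)"
    by (rule integrable_on_interval)
  have "\<bar>LINT u:{0..T}|lborel. g (X \<omega> u)\<bar> \<le> (\<integral>u. indicator {0..T} u * K \<partial>lborel)"
    unfolding set_lebesgue_integral_def
  proof (rule abs_integral_le[OF _ i])
    show "integrable lborel (\<lambda>u. indicat_real {0..T} u *\<^sub>R g (X \<omega> u))"
      by (rule Bochner_Integration.integrable_bound[OF i]) (use g(2) K in \<open>auto simp: indicator_def\<close>)
  qed (use g(2) in \<open>auto simp: indicator_def\<close>)
  then show ?thesis using T by (simp add: mult.commute)
qed

text \<open>
  The increments of \<open>f(X)\<close> telescope, and the mean of the Gaussian parts is known up to an error that vanishes in
  the limit. So the means of the drift sums converge before the integrability of their pathwise limit is known.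
\<close>

lemma expectation_drift_sum_tendsto:
  assumes bd: "bounded_derivs K f f1 f2 f3" and T: "0 < T"
  shows "(\<lambda>n. expectation (drift_sum f T n)) \<longlonglongrightarrow>
      expectation (\<lambda>\<omega>. f (X \<omega> T)) - f x0 - expectation (\<lambda>\<omega>. LINT u:{0..T}|lborel. f2 (X \<omega> u)) / 2"
proof -
  note f = bounded_derivsD[OF bd]
  have [measurable]: "f \<in> borel_measurable borel" "f2 \<in> borel_measurable borel" by (fact f)+
  have T': "0 \<le> T" using T by simp
  let ?x = "\<lambda>n i \<omega>. X \<omega> (grid T n i)"
  let ?W = "\<lambda>n i \<omega>. W (grid T n (Suc i)) \<omega> - W (grid T n i) \<omega>"
  have [measurable]: "W (grid T n i) \<in> borel_measurable M" for n i
    using T by (intro W_meas) (simp add: grid_def)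
  have int: "integrable M (\<lambda>\<omega>. f (?x n i \<omega>))" "integrable M (\<lambda>\<omega>. f (?x n i \<omega> + ?W n i \<omega>))"
    "integrable M (\<lambda>\<omega>. f2 (?x n i \<omega>))" for n i
    by (rule integrable_const_bound[where B = K]; use f in simp)+
  define R where "R n = (\<Sum>i<n. expectation (\<lambda>\<omega>. f (?x n i \<omega> + ?W n i \<omega>)) - expectation (\<lambda>\<omega>. f (?x n i \<omega>)))" for n
  define Q where "Q n = expectation (\<lambda>\<omega>. \<Sum>i<n. f2 (?x n i \<omega>) * (T / n))" for n
  have S: "expectation (drift_sum f T n) = expectation (\<lambda>\<omega>. f (X \<omega> T)) - f x0 - R n" if n: "0 < n" for n
  proof -
    have "expectation (drift_sum f T n) = (\<Sum>i<n. expectation (\<lambda>\<omega>. f (?x n (Suc i) \<omega>)) - expectation (\<lambda>\<omega>. f (?x n i \<omega> + ?W n i \<omega>)))"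
      unfolding drift_sum_def using int by (subst Bochner_Integration.integral_sum) auto
    also have "\<dots> = (\<Sum>i<n. expectation (\<lambda>\<omega>. f (?x n (Suc i) \<omega>)) - expectation (\<lambda>\<omega>. f (?x n i \<omega>))) - R n"
      by (simp add: R_def sum_subtractf)
    also have "(\<Sum>i<n. expectation (\<lambda>\<omega>. f (?x n (Suc i) \<omega>)) - expectation (\<lambda>\<omega>. f (?x n i \<omega>))) =
       expectation (\<lambda>\<omega>. f (?x n n \<omega>)) - expectation (\<lambda>\<omega>. f (?x n 0 \<omega>))"
      by (rule sum_lessThan_telescope)
    also have "expectation (\<lambda>\<omega>. f (?x n 0 \<omega>)) = expectation (\<lambda>\<omega>. f x0)"
      using X_start by (intro integral_cong_AE) (auto simp: grid_def elim!: AE_mp)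
    finally show ?thesis using n by (simp add: grid_def prob_space)
  qed
  have RQ: "\<bar>R n - Q n / 2\<bar> \<le> K * (T * sqrt T) * (1 / sqrt (real n))" if n: "0 < n" for n
  proof -
    have "R n - Q n / 2 = (\<Sum>i<n. expectation (\<lambda>\<omega>. f (?x n i \<omega> + ?W n i \<omega>)) - expectation (\<lambda>\<omega>. f (?x n i \<omega>))
        - T / n / 2 * expectation (\<lambda>\<omega>. f2 (?x n i \<omega>)))"
      unfolding R_def Q_def using int by (subst Bochner_Integration.integral_sum) (auto simp: sum_subtractf sum_divide_distrib sum_distrib_left mult_ac)
    also have "\<bar>\<dots>\<bar> \<le> (\<Sum>i<n. K * sqrt (T / n) ^ 3)"
    proof (rule order_trans[OF sum_abs sum_mono])
      fix i assume "i \<in> {..<n}"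
      then have i: "i < n" by simp
      note g = grid_facts[OF T' i]
      have "0 < T / n" using T n by simp
      then have lt: "grid T n i < grid T n (Suc i)" using g(4) by linarith
      have d: "distributed M lborel (?W n i) (normal_density 0 (sqrt (T / n)))"
        using increment_normal[OF g(1) lt] unfolding g(4) .
      show "\<bar>expectation (\<lambda>\<omega>. f (?x n i \<omega> + ?W n i \<omega>)) - expectation (\<lambda>\<omega>. f (?x n i \<omega>)) - T / n / 2 * expectation (\<lambda>\<omega>. f2 (?x n i \<omega>))\<bar> \<le> K * sqrt (T / n) ^ 3"
        using gaussian_increment_expectation[OF bd indep[OF g(1) lt] d] T n by simp
    qed
    also have "\<dots> = K * (T * sqrt T) * (1 / sqrt (real n))"
      using T n by (simp add: real_sqrt_divide power3_eq_cube field_simps)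
    finally show ?thesis .
  qed
  have "Q \<longlonglongrightarrow> expectation (\<lambda>\<omega>. LINT u:{0..T}|lborel. f2 (X \<omega> u))"
    unfolding Q_def
  proof (rule integral_dominated_convergence[where w = "\<lambda>_. K * T"])
    show "AE \<omega> in M. (\<lambda>n. \<Sum>i<n. f2 (?x n i \<omega>) * (T / n)) \<longlonglongrightarrow> (LINT u:{0..T}|lborel. f2 (X \<omega> u))"
      using AE_regular_path
    proof eventually_elim
      case (elim \<omega>)
      note i2 = integrable_bounded_drift(2)[OF elim T' f(10) f(6)]
      have "(\<lambda>n. \<Sum>i<n. f2 (?x n i \<omega>) * integral (cell T n i) (\<lambda>u. 1)) \<longlonglongrightarrow> integral {0..T} (\<lambda>u. f2 (X \<omega> u) * 1)"
      proof (rule riemann_stieltjes_limit[where g = f2 and z = "X \<omega>" and K = K and \<beta> = "\<lambda>u. 1", OF T' _ _ _ _ f(11)])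
        show "(\<lambda>u. f2 (X \<omega> u) * 1) integrable_on {0..T}"
          using set_borel_integral_eq_integral(1)[OF i2] by simp
        show "\<bar>f2 x - f2 y\<bar> \<le> K * \<bar>x - y\<bar>" for x y
          by (rule lipschitz_of_deriv_bound) (rule f)+
        fix \<epsilon> :: real assume "0 < \<epsilon>"
        from uniform_on_grid[OF T' continuous_on_subset[OF X_cont subset_UNIV] this, of \<omega>]
        show "\<forall>\<^sub>F n in sequentially. \<forall>i<n. \<forall>u\<in>cell T n i. \<bar>X \<omega> (grid T n i) - X \<omega> u\<bar> \<le> \<epsilon>"
          using grid_facts(2)[OF T'] by (auto elim!: eventually_mono)
      qed auto
      moreover have "(\<Sum>i<n. f2 (?x n i \<omega>) * integral (cell T n i) (\<lambda>u. 1)) = (\<Sum>i<n. f2 (?x n i \<omega>) * (T / n))" for n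
        using grid_facts[OF T', of _ n] by (intro sum.cong) auto
      ultimately show ?case using set_borel_integral_eq_integral(2)[OF i2] by simp
    qed
    show "AE \<omega> in M. norm (\<Sum>i<n. f2 (?x n i \<omega>) * (T / n)) \<le> K * T" for n
    proof (intro AE_I2)
      fix \<omega>
      have "\<bar>\<Sum>i<n. f2 (?x n i \<omega>) * (T / n)\<bar> \<le> (\<Sum>i<n. K * (T / n))"
        using f(6) T by (intro order_trans[OF sum_abs sum_mono]) (auto simp: abs_mult intro!: mult_right_mono divide_right_mono)
      also have "\<dots> \<le> K * T" using f(11) T by simp
      finally show "norm (\<Sum>i<n. f2 (?x n i \<omega>) * (T / n)) \<le> K * T" by simp
    qed
  qed auto
  moreover have "(\<lambda>n. R n - Q n / 2) \<longlonglongrightarrow> 0"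
  proof (rule Lim_null_comparison)
    show "\<forall>\<^sub>F n in sequentially. norm (R n - Q n / 2) \<le> K * (T * sqrt T) * (1 / sqrt (real n))"
      by (rule eventually_mono[OF eventually_gt_at_top[of 0]]) (use RQ in simp)
    have "(\<lambda>n. 1 / sqrt (real n)) \<longlonglongrightarrow> 0" by real_asymp
    then show "(\<lambda>n. K * (T * sqrt T) * (1 / sqrt (real n))) \<longlonglongrightarrow> 0" by (rule tendsto_mult_right_zero)
  qed
  ultimately have "(\<lambda>n. (R n - Q n / 2) + Q n / 2) \<longlonglongrightarrow> 0 + expectation (\<lambda>\<omega>. LINT u:{0..T}|lborel. f2 (X \<omega> u)) / 2"
    by (intro tendsto_add tendsto_divide tendsto_const) auto
  then have "R \<longlonglongrightarrow> expectation (\<lambda>\<omega>. LINT u:{0..T}|lborel. f2 (X \<omega> u)) / 2" by simp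
  then have "(\<lambda>n. expectation (\<lambda>\<omega>. f (X \<omega> T)) - f x0 - R n) \<longlonglongrightarrow>
     expectation (\<lambda>\<omega>. f (X \<omega> T)) - f x0 - expectation (\<lambda>\<omega>. LINT u:{0..T}|lborel. f2 (X \<omega> u)) / 2"
    by (intro tendsto_intros)
  then show ?thesis
    by (rule Lim_transform_eventually, intro eventually_mono[OF eventually_gt_at_top[of 0]]) (use S in simp)
qed


text \<open>For increasing \<open>f\<close> the drift sums are nonnegative, and Fatou's lemma bounds the mean of their pathwise limit.\<close>

lemma integrable_nonneg_drift:
  assumes bd: "bounded_derivs K f f1 f2 f3" and nonneg: "\<And>x. 0 \<le> f1 x" and T: "0 < T"
  shows "integrable M (\<lambda>\<omega>. LINT u:{0..T}|lborel. f1 (X \<omega> u) * b (X \<omega> u))"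
proof (rule integrableI_nonneg)
  note f = bounded_derivsD[OF bd]
  have [measurable]: "f \<in> borel_measurable borel" "f1 \<in> borel_measurable borel" by (fact f)+
  have T': "0 \<le> T" using T by simp
  let ?I = "\<lambda>\<omega>. LINT u:{0..T}|lborel. f1 (X \<omega> u) * b (X \<omega> u)"
  let ?l = "expectation (\<lambda>\<omega>. f (X \<omega> T)) - f x0 - expectation (\<lambda>\<omega>. LINT u:{0..T}|lborel. f2 (X \<omega> u)) / 2"
  have meas: "drift_sum f T n \<in> borel_measurable M" for n
    by (rule drift_sum_measurable) (use T' in auto)
  show "?I \<in> borel_measurable M"
    using time_integral_measurable[of "\<lambda>x. f1 x * b x" T] by simp
  show "AE \<omega> in M. 0 \<le> ?I \<omega>"
    unfolding set_lebesgue_integral_def using nonneg b_nonneg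
    by (intro AE_I2 integral_nonneg_AE) auto
  have S_nonneg: "0 \<le> drift_sum f T n \<omega>" if \<omega>: "regular_path \<omega>" for n \<omega>
  proof -
    obtain \<xi> where \<xi>: "drift_sum f T n \<omega> = (\<Sum>i<n. f1 (\<xi> i) * integral (cell T n i) (\<lambda>u. b (X \<omega> u)))"
      "\<forall>i<n. \<bar>\<xi> i - X \<omega> (grid T n (Suc i))\<bar> \<le> integral (cell T n i) (\<lambda>u. b (X \<omega> u))"
      using drift_sum_eq[OF bd \<omega> T'] by blast
    have "0 \<le> integral (cell T n i) (\<lambda>u. b (X \<omega> u))" if "i < n" for i
      using \<xi>(2) that abs_ge_zero order_trans by blast
    then show ?thesis unfolding \<xi>(1) using nonneg by (intro sum_nonneg mult_nonneg_nonneg) auto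
  qed
  have S_int: "integrable M (drift_sum f T n)" for n
  proof (rule integrable_const_bound[where B = "2 * K * n"])
    show "AE \<omega> in M. norm (drift_sum f T n \<omega>) \<le> 2 * K * n"
    proof (intro AE_I2)
      fix \<omega>
      have "\<bar>drift_sum f T n \<omega>\<bar> \<le> (\<Sum>i<n. 2 * K)"
        unfolding drift_sum_def
      proof (rule order_trans[OF sum_abs sum_mono])
        fix i
        show "\<bar>f (X \<omega> (grid T n (Suc i))) - f (X \<omega> (grid T n i) + (W (grid T n (Suc i)) \<omega> - W (grid T n i) \<omega>))\<bar> \<le> 2 * K"
          using f(4)[of "X \<omega> (grid T n (Suc i))"] f(4)[of "X \<omega> (grid T n i) + (W (grid T n (Suc i)) \<omega> - W (grid T n i) \<omega>)"]
          by linarith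
      qed
      then show "norm (drift_sum f T n \<omega>) \<le> 2 * K * n" by (simp add: mult_ac)
    qed
  qed (rule meas)
  have "(\<integral>\<^sup>+\<omega>. ennreal (?I \<omega>) \<partial>M) = (\<integral>\<^sup>+\<omega>. liminf (\<lambda>n. ennreal (drift_sum f T n \<omega>)) \<partial>M)"
  proof (rule nn_integral_cong_AE)
    show "AE \<omega> in M. ennreal (?I \<omega>) = liminf (\<lambda>n. ennreal (drift_sum f T n \<omega>))"
      using AE_regular_path
    proof eventually_elim
      case (elim \<omega>)
      have "(\<lambda>n. ennreal (drift_sum f T n \<omega>)) \<longlonglongrightarrow> ennreal (?I \<omega>)"
        by (intro tendsto_ennrealI drift_sum_tendsto[OF bd elim T'])
      from lim_imp_Liminf[OF trivial_limit_sequentially this] show ?case by simp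
    qed
  qed
  also have "\<dots> \<le> liminf (\<lambda>n. \<integral>\<^sup>+\<omega>. ennreal (drift_sum f T n \<omega>) \<partial>M)"
    by (rule nn_integral_liminf) (use meas in measurable)
  also have "(\<lambda>n. \<integral>\<^sup>+\<omega>. ennreal (drift_sum f T n \<omega>) \<partial>M) = (\<lambda>n. ennreal (expectation (drift_sum f T n)))"
    using S_int S_nonneg AE_regular_path by (intro ext nn_integral_eq_integral) (auto elim!: eventually_mono)
  also have "liminf \<dots> = ennreal ?l"
    by (intro lim_imp_Liminf tendsto_ennrealI expectation_drift_sum_tendsto[OF bd T]) simp
  also have "\<dots> < \<infinity>" by simp
  finally show "(\<integral>\<^sup>+\<omega>. ennreal (?I \<omega>) \<partial>M) < \<infinity>" .
qed

end

text \<open>\<open>arctan\<close> is bounded with bounded derivatives, and its derivative is at least \<open>1/2\<close> on \<open>[- 1, 1]\<close>.\<close>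

lemma bounded_derivs_arctan:
  "bounded_derivs 6 arctan (\<lambda>x. 1 / (1 + x\<^sup>2)) (\<lambda>x. - 2 * x / (1 + x\<^sup>2)\<^sup>2) (\<lambda>x. (6 * x\<^sup>2 - 2) / (1 + x\<^sup>2) ^ 3)"
  unfolding bounded_derivs_def
proof (intro allI conjI)
  fix x :: real
  have p: "0 < 1 + x\<^sup>2" by (simp add: add_pos_nonneg)
  then have p1: "1 \<le> 1 + x\<^sup>2" "1 + x\<^sup>2 \<noteq> 0" by auto
  show "(arctan has_real_derivative 1 / (1 + x\<^sup>2)) (at x)"
    using DERIV_arctan[of x] by (simp add: divide_inverse)
  show "((\<lambda>x. 1 / (1 + x\<^sup>2)) has_real_derivative - 2 * x / (1 + x\<^sup>2)\<^sup>2) (at x)"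
    using p1 by (auto intro!: derivative_eq_intros simp: power2_eq_square)
  show "((\<lambda>x. - 2 * x / (1 + x\<^sup>2)\<^sup>2) has_real_derivative (6 * x\<^sup>2 - 2) / (1 + x\<^sup>2) ^ 3) (at x)"
  proof -
    define y where "y = 1 + x\<^sup>2"
    have y: "y \<noteq> 0" using p1 by (simp add: y_def)
    have "((\<lambda>x. - 2 * x / (1 + x\<^sup>2)\<^sup>2) has_real_derivative (- 2 * y\<^sup>2 - (- 2 * x) * (2 * y * (2 * x))) / (y\<^sup>2 * y\<^sup>2)) (at x)"
      unfolding y_def by (rule DERIV_divide) (use p1 in \<open>auto intro!: derivative_eq_intros\<close>)
    also have "(- 2 * y\<^sup>2 - (- 2 * x) * (2 * y * (2 * x))) / (y\<^sup>2 * y\<^sup>2) = (- 2 * y + 8 * x\<^sup>2) / y ^ 3"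
      using y by (simp add: divide_simps power2_eq_square power3_eq_cube) (simp add: algebra_simps)
    also have "- 2 * y + 8 * x\<^sup>2 = 6 * x\<^sup>2 - 2" by (simp add: y_def)
    finally show ?thesis unfolding y_def .
  qed
  show "\<bar>arctan x\<bar> \<le> 6"
    using arctan_bounded[of x] pi_less_4 by linarith
  show "\<bar>1 / (1 + x\<^sup>2)\<bar> \<le> 6" using p1 by (simp add: divide_simps)
  have "\<bar>x\<bar> \<le> 1 + x\<^sup>2" using zero_le_power2[of "\<bar>x\<bar> - 1 / 2"] by (simp add: power2_eq_square algebra_simps)
  moreover have "1 + x\<^sup>2 \<le> (1 + x\<^sup>2)\<^sup>2" using p1 by (simp add: power2_eq_square mult_le_cancel_left1)
  ultimately have "\<bar>- 2 * x\<bar> \<le> 6 * (1 + x\<^sup>2)\<^sup>2" by (simp add: abs_mult)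
  then show "\<bar>- 2 * x / (1 + x\<^sup>2)\<^sup>2\<bar> \<le> 6" using p by (simp add: abs_divide pos_divide_le_eq)
  have "1 + x\<^sup>2 \<le> (1 + x\<^sup>2) ^ 3" using p1 self_le_power[of "1 + x\<^sup>2" 3] by simp
  moreover have "0 \<le> x\<^sup>2" by simp
  ultimately have "\<bar>6 * x\<^sup>2 - 2\<bar> \<le> 6 * (1 + x\<^sup>2) ^ 3" unfolding abs_le_iff by linarith
  then show "\<bar>(6 * x\<^sup>2 - 2) / (1 + x\<^sup>2) ^ 3\<bar> \<le> 6" using p by (simp add: abs_divide pos_divide_le_eq)
qed

context drifted_brownian
begin

text \<open>
  Near the singularity the drift is dominated by twice \<open>arctan' * b\<close>, and elsewhere by a constant.
\<close>

lemma integrable_total_drift: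
  assumes c: "\<And>r. 1 \<le> \<bar>r\<bar> \<Longrightarrow> b r \<le> c" and T: "0 < T"
  shows "integrable M (\<lambda>\<omega>. LINT u:{0..T}|lborel. b (X \<omega> u))"
proof -
  let ?f1 = "\<lambda>x :: real. 1 / (1 + x\<^sup>2)"
  have T': "0 \<le> T" using T by simp
  note f = bounded_derivsD[OF bounded_derivs_arctan]
  have c0: "0 \<le> c" using b_nonneg[of 1] c[of 1] by simp
  have b_le: "b r \<le> 2 * (?f1 r * b r) + c" for r
  proof (cases "1 \<le> \<bar>r\<bar>")
    case True
    have "0 \<le> ?f1 r * b r" using b_nonneg[of r] by simp
    then show ?thesis using c[OF True] by linarith
  next
    case False
    then have "r\<^sup>2 \<le> 1" by (simp add: abs_square_le_1)
    then have "1 \<le> 2 * ?f1 r" by (simp add: divide_simps add_pos_nonneg)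
    then have "1 * b r \<le> 2 * ?f1 r * b r" using b_nonneg by (intro mult_right_mono)
    then show ?thesis using c0 by simp
  qed
  have i1: "integrable M (\<lambda>\<omega>. 2 * (LINT u:{0..T}|lborel. ?f1 (X \<omega> u) * b (X \<omega> u)) + c * T)"
    by (intro Bochner_Integration.integrable_add integrable_mult_right integrable_nonneg_drift[OF bounded_derivs_arctan _ T]) auto
  show ?thesis
  proof (rule Bochner_Integration.integrable_bound[OF i1])
    show "(\<lambda>\<omega>. LINT u:{0..T}|lborel. b (X \<omega> u)) \<in> borel_measurable M" by measurable
    show "AE \<omega> in M. norm (LINT u:{0..T}|lborel. b (X \<omega> u)) \<le> norm (2 * (LINT u:{0..T}|lborel. ?f1 (X \<omega> u) * b (X \<omega> u)) + c * T)"
      using AE_regular_path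
    proof eventually_elim
      case (elim \<omega>)
      have ib: "set_integrable lborel {0..T} (\<lambda>u. b (X \<omega> u))" using elim T' by (simp add: regular_path_def)
      note ifb = integrable_bounded_drift(1)[OF elim T' f(9) f(5)]
      have ic: "set_integrable lborel {0..T} (\<lambda>u. c)"
        unfolding set_integrable_def
        by (intro integrable_scaleR_left integrable_real_indicator) (auto simp: emeasure_lborel_Icc_eq)
      have "0 \<le> (LINT u:{0..T}|lborel. b (X \<omega> u))"
        unfolding set_lebesgue_integral_def using b_nonneg by (intro integral_nonneg_AE) auto
      moreover have "(LINT u:{0..T}|lborel. b (X \<omega> u)) \<le> (LINT u:{0..T}|lborel. 2 * (?f1 (X \<omega> u) * b (X \<omega> u)) + c)"
        using b_le by (intro set_integral_mono set_integral_add ib ifb ic set_integrable_mult_right) auto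
      moreover have "(LINT u:{0..T}|lborel. 2 * (?f1 (X \<omega> u) * b (X \<omega> u)) + c) = 2 * (LINT u:{0..T}|lborel. ?f1 (X \<omega> u) * b (X \<omega> u)) + c * T"
      proof -
        have "(LINT u:{0..T}|lborel. 2 * (?f1 (X \<omega> u) * b (X \<omega> u)) + c) =
            (LINT u:{0..T}|lborel. 2 * (?f1 (X \<omega> u) * b (X \<omega> u))) + (LINT u:{0..T}|lborel. c)"
          by (rule set_integral_add(2)[OF set_integrable_mult_right[OF ifb] ic])
        also have "(LINT u:{0..T}|lborel. c) = c * T"
          using T by (simp add: set_lebesgue_integral_def)
        also have "(LINT u:{0..T}|lborel. 2 * (?f1 (X \<omega> u) * b (X \<omega> u))) = 2 * (LINT u:{0..T}|lborel. ?f1 (X \<omega> u) * b (X \<omega> u))"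
          by (rule set_integral_mult_right)
        finally show ?thesis .
      qed
      ultimately show ?case by simp
    qed
  qed
qed

text \<open>
  With the total drift integrable in mean, dominated convergence identifies the limit of the means of the drift sums.
\<close>

theorem weak_ito:
  assumes c: "\<And>r. 1 \<le> \<bar>r\<bar> \<Longrightarrow> b r \<le> c" and bd: "bounded_derivs K f f1 f2 f3" and T: "0 \<le> T"
  shows "integrable M (\<lambda>\<omega>. LINT u:{0..T}|lborel. f1 (X \<omega> u) * b (X \<omega> u))"
    "expectation (\<lambda>\<omega>. f (X \<omega> T)) = f x0 + expectation (\<lambda>\<omega>. LINT u:{0..T}|lborel. f1 (X \<omega> u) * b (X \<omega> u))
      + expectation (\<lambda>\<omega>. LINT u:{0..T}|lborel. f2 (X \<omega> u)) / 2"
proof -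
  note f = bounded_derivsD[OF bd]
  have [measurable]: "f \<in> borel_measurable borel" "f1 \<in> borel_measurable borel" by (fact f)+
  let ?I = "\<lambda>\<omega>. LINT u:{0..T}|lborel. f1 (X \<omega> u) * b (X \<omega> u)"
  let ?A = "\<lambda>\<omega>. K * (LINT u:{0..T}|lborel. b (X \<omega> u))"
  have "integrable M ?I \<and> expectation (\<lambda>\<omega>. f (X \<omega> T)) = f x0 + expectation ?I
      + expectation (\<lambda>\<omega>. LINT u:{0..T}|lborel. f2 (X \<omega> u)) / 2"
  proof (cases "T = 0")
    case True
    have z: "(LINT u:{0..0}|lborel. h u) = 0" for h :: "real \<Rightarrow> real"
      unfolding set_lebesgue_integral_def
    proof (rule integral_eq_zero_AE)
      show "AE u in lborel. indicat_real {0..0} u *\<^sub>R h u = 0"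
        using AE_lborel_singleton[of "0 :: real"] by eventually_elim simp
    qed
    have "expectation (\<lambda>\<omega>. f (X \<omega> 0)) = expectation (\<lambda>\<omega>. f x0)"
      using X_start by (intro integral_cong_AE) (auto elim!: AE_mp)
    then show ?thesis using True by (simp add: z[simplified] prob_space)
  next
    case False
    then have T0: "0 < T" using T by simp
    have iA: "integrable M ?A"
      by (intro integrable_mult_right integrable_total_drift[OF c T0])
    have conv: "AE \<omega> in M. (\<lambda>n. drift_sum f T n \<omega>) \<longlonglongrightarrow> ?I \<omega>"
      using AE_regular_path by eventually_elim (rule drift_sum_tendsto[OF bd _ T])
    have dom: "AE \<omega> in M. norm (drift_sum f T n \<omega>) \<le> ?A \<omega>" for n
      using AE_regular_path
    proof eventually_elim
      case (elim \<omega>)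
      let ?J = "\<lambda>i. integral (cell T n i) (\<lambda>u. b (X \<omega> u))"
      obtain \<xi> where \<xi>: "drift_sum f T n \<omega> = (\<Sum>i<n. f1 (\<xi> i) * ?J i)"
        "\<forall>i<n. \<bar>\<xi> i - X \<omega> (grid T n (Suc i))\<bar> \<le> ?J i"
        using drift_sum_eq[OF bd elim T] by blast
      have J: "0 \<le> ?J i" if "i < n" for i
        using \<xi>(2) that abs_ge_zero order_trans by blast
      have si: "set_integrable lborel {0..T} (\<lambda>u. b (X \<omega> u))" using elim T by (simp add: regular_path_def)
      have "\<bar>drift_sum f T n \<omega>\<bar> \<le> (\<Sum>i<n. K * ?J i)"
        unfolding \<xi>(1) using J f(5) by (intro order_trans[OF sum_abs sum_mono]) (auto simp: abs_mult intro!: mult_right_mono)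
      also have "\<dots> \<le> ?A \<omega>"
      proof (cases "n = 0")
        case True
        have "0 \<le> (LINT u:{0..T}|lborel. b (X \<omega> u))"
          unfolding set_lebesgue_integral_def using b_nonneg by (intro integral_nonneg_AE) auto
        then show ?thesis using True f(11) by simp
      next
        case False
        then show ?thesis
          using sum_integral_grid[OF T, of n "\<lambda>u. b (X \<omega> u)"] set_borel_integral_eq_integral[OF si]
          by (simp add: sum_distrib_left[symmetric])
      qed
      finally show ?case by simp
    qed
    have meas: "drift_sum f T n \<in> borel_measurable M" for n
      by (rule drift_sum_measurable) (use T in auto)
    have I_meas: "?I \<in> borel_measurable M"
      using time_integral_measurable[of "\<lambda>x. f1 x * b x" T] by simp
    note dc = integral_dominated_convergence[OF I_meas meas iA conv dom] integrable_dominated_convergence[OF I_meas meas iA conv dom]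
    have "expectation ?I = expectation (\<lambda>\<omega>. f (X \<omega> T)) - f x0 - expectation (\<lambda>\<omega>. LINT u:{0..T}|lborel. f2 (X \<omega> u)) / 2"
      by (rule LIMSEQ_unique[OF dc(1) expectation_drift_sum_tendsto[OF bd T0]])
    with dc(2) show ?thesis by simp
  qed
  then show "integrable M ?I" "expectation (\<lambda>\<omega>. f (X \<omega> T)) = f x0 + expectation ?I
      + expectation (\<lambda>\<omega>. LINT u:{0..T}|lborel. f2 (X \<omega> u)) / 2" by auto
qed

end

section \<open>Evolution of the Laplace transform of the hyperbolic cosine\<close>

text \<open>
  Each derivative is \<open>exp (- \<theta> cosh z)\<close> times a polynomial in \<open>S = \<theta> sinh z\<close> and \<open>C = \<theta> cosh z\<close> with
  \<open>\<bar>S\<bar> \<le> C\<close>, and \<open>C\<^sup>k exp (- C) \<le> k!\<close>; the worst case gives \<open>3 * 2 + 1 + 6 = 13\<close>.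
\<close>

lemma bounded_derivs_exp_cosh:
  assumes \<theta>: "0 < \<theta>"
  shows "bounded_derivs 13 (\<lambda>z. exp (- \<theta> * cosh z)) (\<lambda>z. - (\<theta> * sinh z) * exp (- \<theta> * cosh z))
     (\<lambda>z. ((\<theta> * sinh z)\<^sup>2 - \<theta> * cosh z) * exp (- \<theta> * cosh z))
     (\<lambda>z. (3 * (\<theta> * sinh z) * (\<theta> * cosh z) - \<theta> * sinh z - (\<theta> * sinh z) ^ 3) * exp (- \<theta> * cosh z))"
  unfolding bounded_derivs_def
proof (intro allI conjI)
  fix z :: real
  define S where "S = \<theta> * sinh z"
  define C where "C = \<theta> * cosh z"
  have C0: "0 \<le> C" using \<theta> by (simp add: C_def cosh_real_nonneg)
  have "\<bar>sinh z\<bar> \<le> cosh z"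
    using sinh_le_cosh_real[of z] sinh_le_cosh_real[of "- z"] by (simp add: abs_le_iff)
  then have SC: "\<bar>S\<bar> \<le> C" using \<theta> by (simp add: S_def C_def abs_mult)
  have e: "exp (- \<theta> * cosh z) = exp (- C)" by (simp add: C_def)
  have p: "C * exp (- C) \<le> 1" "C\<^sup>2 * exp (- C) \<le> 2" "C ^ 3 * exp (- C) \<le> 6" "exp (- C) \<le> 1"
    using power_exp_le[OF C0, of 1] power_exp_le[OF C0, of 2] power_exp_le[OF C0, of 3] C0
    by (simp_all add: fact_numeral)
  show "((\<lambda>z. exp (- \<theta> * cosh z)) has_real_derivative - (\<theta> * sinh z) * exp (- \<theta> * cosh z)) (at z)"
    by (auto intro!: derivative_eq_intros)
  show "((\<lambda>z. - (\<theta> * sinh z) * exp (- \<theta> * cosh z)) has_real_derivative ((\<theta> * sinh z)\<^sup>2 - \<theta> * cosh z) * exp (- \<theta> * cosh z)) (at z)"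
    by (rule derivative_eq_intros refl | simp add: algebra_simps power2_eq_square)+
  show "((\<lambda>z. ((\<theta> * sinh z)\<^sup>2 - \<theta> * cosh z) * exp (- \<theta> * cosh z)) has_real_derivative
     (3 * (\<theta> * sinh z) * (\<theta> * cosh z) - \<theta> * sinh z - (\<theta> * sinh z) ^ 3) * exp (- \<theta> * cosh z)) (at z)"
    by (rule derivative_eq_intros refl | simp add: algebra_simps power2_eq_square power3_eq_cube)+
  show "\<bar>exp (- \<theta> * cosh z)\<bar> \<le> 13" unfolding e using p(4) unfolding abs_exp_cancel by linarith
  have "\<bar>S\<bar> * exp (- C) \<le> C * exp (- C)" using SC by (intro mult_right_mono) auto
  also note p(1)
  finally have "\<bar>S\<bar> * exp (- C) \<le> 13" by simp
  then show "\<bar>- (\<theta> * sinh z) * exp (- \<theta> * cosh z)\<bar> \<le> 13"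
    unfolding e S_def[symmetric] by (simp add: abs_mult)
  have S2: "S\<^sup>2 \<le> C\<^sup>2" using SC by (simp add: abs_le_square_iff[symmetric] C0)
  have "\<bar>S\<^sup>2 - C\<bar> \<le> C\<^sup>2 + C" using S2 C0 zero_le_power2[of S] by (simp add: abs_le_iff)
  then have "\<bar>S\<^sup>2 - C\<bar> * exp (- C) \<le> (C\<^sup>2 + C) * exp (- C)" by (intro mult_right_mono) auto
  also have "\<dots> \<le> 13" using p unfolding distrib_right by linarith
  finally show "\<bar>((\<theta> * sinh z)\<^sup>2 - \<theta> * cosh z) * exp (- \<theta> * cosh z)\<bar> \<le> 13"
    unfolding e S_def[symmetric] C_def[symmetric] by (simp add: abs_mult)
  have "\<bar>S * C\<bar> \<le> C\<^sup>2" using SC C0 by (simp add: abs_mult power2_eq_square mult_right_mono)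
  moreover have "\<bar>S ^ 3\<bar> \<le> C ^ 3" unfolding power_abs by (intro power_mono SC) auto
  ultimately have "\<bar>3 * S * C - S - S ^ 3\<bar> \<le> 3 * C\<^sup>2 + C + C ^ 3" using SC by linarith
  then have "\<bar>3 * S * C - S - S ^ 3\<bar> * exp (- C) \<le> (3 * C\<^sup>2 + C + C ^ 3) * exp (- C)" by (intro mult_right_mono) auto
  also have "\<dots> \<le> 13" using p unfolding distrib_right by linarith
  finally show "\<bar>(3 * (\<theta> * sinh z) * (\<theta> * cosh z) - \<theta> * sinh z - (\<theta> * sinh z) ^ 3) * exp (- \<theta> * cosh z)\<bar> \<le> 13"
    unfolding e S_def[symmetric] C_def[symmetric] by (simp add: abs_mult)
qed

lemma exp_generator_measurable [measurable]: "exp_generator a \<theta> \<in> borel_measurable borel"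
  unfolding exp_generator_def[abs_def] by measurable

text \<open>
  The absolute value makes the drift nonnegative on the whole line. It allows for \<open>a = 0\<close>, where \<open>X\<close> is the Brownian
  motion before it is reflected; for \<open>a > 0\<close> the process is positive at almost all times.
\<close>

locale coth_diffusion = drifted_brownian M X W "\<lambda>r. a * coth \<bar>r\<bar>" x0
  for M :: "'a measure" and X :: "'a \<Rightarrow> real \<Rightarrow> real" and W :: "real \<Rightarrow> 'a \<Rightarrow> real" and a x0 :: real +
  assumes a_nonneg: "0 \<le> a"
    and positive: "0 < a \<Longrightarrow> AE \<omega> in M. AE u in lborel. 0 \<le> u \<longrightarrow> 0 < X \<omega> u"
begin

definition cosh_laplace :: "real \<Rightarrow> real \<Rightarrow> real" where
  "cosh_laplace \<theta> t = expectation (\<lambda>\<omega>. exp (- \<theta> * cosh (X \<omega> t)))"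

definition mean_generator :: "real \<Rightarrow> real \<Rightarrow> real" where
  "mean_generator \<theta> t = expectation (\<lambda>\<omega>. exp_generator a \<theta> (cosh (X \<omega> t)))"

lemma generator_bound: "0 < \<theta> \<Longrightarrow> \<bar>exp_generator a \<theta> (cosh x)\<bar> \<le> a + 3 / 2"
  by (intro abs_exp_generator_le a_nonneg cosh_real_ge_1)

text \<open>
  The singularity of the drift is cancelled by the derivative of \<open>cosh\<close>: \<open>coth r * sinh r = cosh r\<close>.
\<close>

lemma generator_drift:
  assumes "0 < r \<or> a = 0"
  shows "- (\<theta> * sinh r) * exp (- \<theta> * cosh r) * (a * coth \<bar>r\<bar>) + ((\<theta> * sinh r)\<^sup>2 - \<theta> * cosh r) * exp (- \<theta> * cosh r) / 2
    = exp_generator a \<theta> (cosh r)"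
proof -
  have h: "(sinh r)\<^sup>2 = (cosh r)\<^sup>2 - 1" by (simp add: cosh_square_eq)
  have "a * (sinh r * coth \<bar>r\<bar>) = a * cosh r"
    using assms by (auto simp: coth_def)
  moreover have "- (\<theta> * sinh r) * exp (- \<theta> * cosh r) * (a * coth \<bar>r\<bar>) = - (\<theta> * exp (- \<theta> * cosh r)) * (a * (sinh r * coth \<bar>r\<bar>))"
    by (simp add: mult_ac)
  ultimately have e: "- (\<theta> * sinh r) * exp (- \<theta> * cosh r) * (a * coth \<bar>r\<bar>) = - (\<theta> * exp (- \<theta> * cosh r)) * (a * cosh r)"
    by (simp only:)
  show ?thesis
    unfolding e exp_generator_def power_mult_distrib h by (simp add: field_simps)
qed

lemma cosh_laplace_evolution:
  assumes \<theta>: "0 < \<theta>" and T: "0 \<le> T"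
  shows "cosh_laplace \<theta> T = exp (- \<theta> * cosh x0) + (LINT u:{0..T}|lborel. mean_generator \<theta> u)"
proof -
  let ?f1 = "\<lambda>z. - (\<theta> * sinh z) * exp (- \<theta> * cosh z)"
  let ?f2 = "\<lambda>z. ((\<theta> * sinh z)\<^sup>2 - \<theta> * cosh z) * exp (- \<theta> * cosh z)"
  let ?g = "\<lambda>\<omega> u. exp_generator a \<theta> (cosh (X \<omega> u))"
  note bd = bounded_derivs_exp_cosh[OF \<theta>]
  note f = bounded_derivsD[OF bd]
  \<comment> \<open>\<open>coth\<close> is decreasing, by the addition theorem for \<open>sinh\<close>.\<close>
  have c: "a * coth \<bar>r\<bar> \<le> a * coth 1" if "1 \<le> \<bar>r\<bar>" for r
  proof -
    have "cosh r' * sinh 1 \<le> cosh 1 * sinh r'" if "1 \<le> r'" for r' :: real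
    proof -
      have "0 \<le> sinh (r' - 1)" using that by simp
      then show ?thesis by (simp add: sinh_diff mult_ac)
    qed
    from this[OF that] have "coth \<bar>r\<bar> \<le> coth 1"
      using that by (simp add: coth_def divide_simps del: cosh_real_abs) (simp add: mult_ac)?
    then show ?thesis using a_nonneg by (intro mult_left_mono)
  qed
  note ito = weak_ito[OF c bd T]
  have i2: "integrable M (\<lambda>\<omega>. LINT u:{0..T}|lborel. ?f2 (X \<omega> u))"
    by (rule integrable_const_bound[where B = "13 * T"])
      (use abs_time_integral_le[OF f(10) f(6) T] time_integral_measurable[OF f(10), of T] in auto)
  have "cosh_laplace \<theta> T = exp (- \<theta> * cosh x0) + expectation (\<lambda>\<omega>. (LINT u:{0..T}|lborel. ?f1 (X \<omega> u) * (a * coth \<bar>X \<omega> u\<bar>))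
      + (LINT u:{0..T}|lborel. ?f2 (X \<omega> u)) / 2)"
  proof -
    have "cosh_laplace \<theta> T = exp (- \<theta> * cosh x0) + expectation (\<lambda>\<omega>. LINT u:{0..T}|lborel. ?f1 (X \<omega> u) * (a * coth \<bar>X \<omega> u\<bar>))
        + expectation (\<lambda>\<omega>. LINT u:{0..T}|lborel. ?f2 (X \<omega> u)) / 2"
      unfolding cosh_laplace_def by (rule ito(2))
    also have "expectation (\<lambda>\<omega>. LINT u:{0..T}|lborel. ?f2 (X \<omega> u)) / 2 = expectation (\<lambda>\<omega>. (LINT u:{0..T}|lborel. ?f2 (X \<omega> u)) / 2)"
      by (rule integral_divide_zero[symmetric])
    finally show ?thesis
      unfolding add.assoc
      by (subst Bochner_Integration.integral_add[OF ito(1) integrable_divide[OF i2]])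
  qed
  also have "expectation (\<lambda>\<omega>. (LINT u:{0..T}|lborel. ?f1 (X \<omega> u) * (a * coth \<bar>X \<omega> u\<bar>))
      + (LINT u:{0..T}|lborel. ?f2 (X \<omega> u)) / 2) = expectation (\<lambda>\<omega>. LINT u:{0..T}|lborel. ?g \<omega> u)"
  proof (rule integral_cong_AE)
    show "(\<lambda>\<omega>. (LINT u:{0..T}|lborel. ?f1 (X \<omega> u) * (a * coth \<bar>X \<omega> u\<bar>)) + (LINT u:{0..T}|lborel. ?f2 (X \<omega> u)) / 2) \<in> borel_measurable M"
      using borel_measurable_integrable[OF ito(1)] borel_measurable_integrable[OF i2] by measurable
    show "(\<lambda>\<omega>. LINT u:{0..T}|lborel. ?g \<omega> u) \<in> borel_measurable M"
      using time_integral_measurable[of "\<lambda>x. exp_generator a \<theta> (cosh x)" T] by simp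
    have pos: "AE \<omega> in M. AE u in lborel. 0 \<le> u \<longrightarrow> 0 < X \<omega> u \<or> a = 0"
      using positive a_nonneg by (cases "a = 0") auto
    show "AE \<omega> in M. (LINT u:{0..T}|lborel. ?f1 (X \<omega> u) * (a * coth \<bar>X \<omega> u\<bar>)) + (LINT u:{0..T}|lborel. ?f2 (X \<omega> u)) / 2
       = (LINT u:{0..T}|lborel. ?g \<omega> u)"
      using AE_regular_path pos
    proof eventually_elim
      case (elim \<omega>)
      note i1' = integrable_bounded_drift(1)[OF elim(1) T f(9) f(5)]
      note i2' = integrable_bounded_drift(2)[OF elim(1) T f(10) f(6)]
      have "(LINT u:{0..T}|lborel. ?f1 (X \<omega> u) * (a * coth \<bar>X \<omega> u\<bar>)) + (LINT u:{0..T}|lborel. ?f2 (X \<omega> u)) / 2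
        = (LINT u:{0..T}|lborel. ?f1 (X \<omega> u) * (a * coth \<bar>X \<omega> u\<bar>)) + (LINT u:{0..T}|lborel. ?f2 (X \<omega> u) / 2)"
        by simp
      also have "\<dots> = (LINT u:{0..T}|lborel. ?f1 (X \<omega> u) * (a * coth \<bar>X \<omega> u\<bar>) + ?f2 (X \<omega> u) / 2)"
        by (rule set_integral_add(2)[symmetric, OF i1' set_integrable_divide[OF i2']])
      also have "\<dots> = (LINT u:{0..T}|lborel. ?g \<omega> u)"
      proof (rule set_lebesgue_integral_cong_AE)
        show "AE u\<in>{0..T} in lborel. ?f1 (X \<omega> u) * (a * coth \<bar>X \<omega> u\<bar>) + ?f2 (X \<omega> u) / 2 = ?g \<omega> u"
          using elim(2) by eventually_elim (use generator_drift in auto)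
      qed (unfold coth_def, measurable)
      finally show ?case .
    qed
  qed
  also have "\<dots> = (LINT u:{0..T}|lborel. mean_generator \<theta> u)"
  proof -
    interpret P: pair_sigma_finite M lborel ..
    have "integrable (M \<Otimes>\<^sub>M lborel) (\<lambda>(\<omega>, u). indicator {0..T} u *\<^sub>R ?g \<omega> u)"
    proof (rule Bochner_Integration.integrable_bound)
      show "integrable (M \<Otimes>\<^sub>M lborel) (\<lambda>p. indicator (space M \<times> {0..T}) p * (a + 3 / 2))"
        by (intro integrable_mult_left integrable_real_indicator)
          (auto simp: lborel.emeasure_pair_measure_Times emeasure_space_1 emeasure_lborel_Icc_eq ennreal_mult_less_top)
      show "(\<lambda>(\<omega>, u). indicator {0..T} u *\<^sub>R ?g \<omega> u) \<in> borel_measurable (M \<Otimes>\<^sub>M lborel)"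
        unfolding case_prod_beta by measurable
      show "AE p in M \<Otimes>\<^sub>M lborel. norm (case p of (\<omega>, u) \<Rightarrow> indicat_real {0..T} u *\<^sub>R ?g \<omega> u)
        \<le> norm (indicat_real (space M \<times> {0..T}) p * (a + 3 / 2))"
        using generator_bound[OF \<theta>] a_nonneg by (intro AE_I2) (auto simp: space_pair_measure indicator_def)
    qed
    from P.Fubini_integral[OF this] show ?thesis
      unfolding set_lebesgue_integral_def mean_generator_def by simp
  qed
  finally show ?thesis .
qed

end

lemma wave_kernel_measurable [measurable (raw)]:
  assumes [measurable]: "f \<in> borel_measurable N" "g \<in> borel_measurable N"
  shows "(\<lambda>x. wave_kernel l (f x) (g x)) \<in> borel_measurable N"
proof -
  have [measurable]: "bessel_sq \<in> borel_measurable borel"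
    by (intro borel_measurable_continuous_onI continuous_intros)
  show ?thesis unfolding wave_kernel_def wave_arg_def by measurable
qed

section \<open>The Laplace transform in time\<close>

lemma exponential_tail:
  assumes c: "0 < c"
  shows "integrable lborel (\<lambda>t. indicator {u..} t * (c * exp (- c * t)) :: real)"
    "(\<integral>t. indicator {u..} t * (c * exp (- c * t)) \<partial>lborel) = exp (- c * u)"
proof -
  have "(\<integral>\<^sup>+t. ennreal (c * exp (- c * t)) * indicator {u..} t \<partial>lborel) = 0 - (- exp (- c * u))"
  proof (rule nn_integral_FTC_atLeast)
    show "((\<lambda>t. - exp (- c * t)) has_real_derivative c * exp (- c * t)) (at t)" for t
      by (auto intro!: derivative_eq_intros)
    show "((\<lambda>t. - exp (- c * t)) \<longlongrightarrow> 0) at_top" using c by real_asymp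
  qed (use c in auto)
  moreover have "ennreal (c * exp (- c * t)) * indicator {u..} t = ennreal (indicator {u..} t * (c * exp (- c * t)))" for t
    by (simp add: indicator_def)
  ultimately have *: "(\<integral>\<^sup>+t. ennreal (indicator {u..} t * (c * exp (- c * t))) \<partial>lborel) = ennreal (exp (- c * u))"
    by simp
  have nn: "0 \<le> indicator {u..} t * (c * exp (- c * t))" for t using c by (simp add: indicator_def)
  show "integrable lborel (\<lambda>t. indicator {u..} t * (c * exp (- c * t)) :: real)"
    by (rule integrableI_nonneg) (use * nn in auto)
  show "(\<integral>t. indicator {u..} t * (c * exp (- c * t)) \<partial>lborel) = exp (- c * u)"
    by (subst integral_eq_nn_integral) (use * nn in auto)
qed

text \<open>
  The wave average of the data \<open>exp (a z - l cosh x exp z)\<close> that belong to the starting point \<open>x\<close>. It is written as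
  an integral over the cone, the form in which it meets the law of \<open>(V\<^sub>t, B\<^sub>t)\<close>.
\<close>

definition wave_source :: "real \<Rightarrow> real \<Rightarrow> real \<Rightarrow> real \<Rightarrow> real" where
  "wave_source a l x v = (\<integral>z. of_bool (\<bar>z\<bar> \<le> v) * (exp (a * z) * exp (- l * exp z * cosh x) * wave_kernel l v z) \<partial>lborel)"

context coth_diffusion
begin

lemma integral_bounded_over_exponential_time:
  fixes g :: "real \<Rightarrow> real"
  assumes c: "0 < c" and g [measurable]: "g \<in> borel_measurable borel" and K: "\<And>x. \<bar>g x\<bar> \<le> K"
  shows "integrable (M \<Otimes>\<^sub>M density lborel (exponential_density c)) (\<lambda>(\<omega>, t). g (X \<omega> t))"
    "(\<integral>(\<omega>, t). g (X \<omega> t) \<partial>(M \<Otimes>\<^sub>M density lborel (exponential_density c))) =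
     (\<integral>t. exponential_density c t * expectation (\<lambda>\<omega>. g (X \<omega> t)) \<partial>lborel)"
proof -
  let ?E = "density lborel (exponential_density c)"
  interpret E: prob_space ?E by (rule prob_space_exponential_density[OF c])
  interpret Q: pair_prob_space M ?E ..
  have [measurable]: "(\<lambda>p. X (fst p) (snd p)) \<in> borel_measurable (M \<Otimes>\<^sub>M ?E)"
    using X_jointly_measurable by (simp cong: measurable_cong_sets sets_pair_measure_cong)
  have meas: "(\<lambda>(\<omega>, t). g (X \<omega> t)) \<in> borel_measurable (M \<Otimes>\<^sub>M ?E)"
    unfolding case_prod_beta by measurable
  show int: "integrable (M \<Otimes>\<^sub>M ?E) (\<lambda>(\<omega>, t). g (X \<omega> t))"
    by (rule Q.integrable_const_bound[where B = K, OF _ meas]) (use K in auto)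
  have "(\<integral>(\<omega>, t). g (X \<omega> t) \<partial>(M \<Otimes>\<^sub>M ?E)) = (\<integral>t. expectation (\<lambda>\<omega>. g (X \<omega> t)) \<partial>?E)"
    by (rule Q.integral_snd[OF int, symmetric])
  also have "\<dots> = (\<integral>t. exponential_density c t *\<^sub>R expectation (\<lambda>\<omega>. g (X \<omega> t)) \<partial>lborel)"
  proof (rule integral_density)
    have "(\<lambda>(t, \<omega>). g (X \<omega> t)) \<in> borel_measurable (lborel \<Otimes>\<^sub>M M)"
      using measurable_pair_swap[OF meas] by (simp add: case_prod_beta cong: measurable_cong_sets sets_pair_measure_cong)
    then show "(\<lambda>t. expectation (\<lambda>\<omega>. g (X \<omega> t))) \<in> borel_measurable lborel"
      by (rule borel_measurable_lebesgue_integral)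
  qed (use c in \<open>auto simp: exponential_density_def\<close>)
  finally show "(\<integral>(\<omega>, t). g (X \<omega> t) \<partial>(M \<Otimes>\<^sub>M ?E)) = (\<integral>t. exponential_density c t * expectation (\<lambda>\<omega>. g (X \<omega> t)) \<partial>lborel)"
    by simp
qed

lemma mean_generator_measurable [measurable]: "mean_generator \<theta> \<in> borel_measurable borel"
proof -
  have "(\<lambda>p. exp_generator a \<theta> (cosh (X (fst p) (snd p)))) \<in> borel_measurable (M \<Otimes>\<^sub>M borel)"
    by measurable
  from measurable_pair_swap[OF this]
  have "(\<lambda>(t, \<omega>). exp_generator a \<theta> (cosh (X \<omega> t))) \<in> borel_measurable (borel \<Otimes>\<^sub>M M)"
    by (simp add: case_prod_beta)
  then show ?thesis
    unfolding mean_generator_def[abs_def] by (rule borel_measurable_lebesgue_integral)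
qed

lemma abs_mean_generator_le:
  assumes \<theta>: "0 < \<theta>"
  shows "\<bar>mean_generator \<theta> t\<bar> \<le> a + 3 / 2"
proof -
  have "\<bar>mean_generator \<theta> t\<bar> \<le> expectation (\<lambda>\<omega>. a + 3 / 2)"
    unfolding mean_generator_def
  proof (rule abs_integral_le)
    show "integrable M (\<lambda>\<omega>. exp_generator a \<theta> (cosh (X \<omega> t)))"
      by (rule integrable_const_bound[where B = "a + 3 / 2"]) (use generator_bound[OF \<theta>] in auto)
  qed (use generator_bound[OF \<theta>] in auto)
  then show ?thesis by (simp add: prob_space)
qed

text \<open>
  Integration of the evolution equation against the exponential law, where
  \<open>\<integral>\<^sub>u\<^sup>\<infinity> c exp (- c t) dt = exp (- c u)\<close> undoes the time integral.
\<close>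

lemma exponential_time_generator:
  assumes c: "0 < c" and \<theta>: "0 < \<theta>"
  shows "c * (\<integral>t. exponential_density c t * cosh_laplace \<theta> t \<partial>lborel) - (\<integral>t. exponential_density c t * mean_generator \<theta> t \<partial>lborel)
    = c * exp (- \<theta> * cosh x0)"
proof -
  let ?\<Gamma> = "mean_generator \<theta>"
  let ?h = "\<lambda>t u. of_bool (0 \<le> u \<and> u \<le> t) * (c * exp (- c * t)) * ?\<Gamma> u"
  let ?E = "density lborel (exponential_density c)"
  interpret E: prob_space ?E by (rule prob_space_exponential_density[OF c])
  have ed: "exponential_density c t = indicator {0..} t * (c * exp (- c * t))" for t
    by (auto simp: exponential_density_def indicator_def mult_ac)
  have ed_int: "integrable lborel (exponential_density c)" "(\<integral>t. exponential_density c t \<partial>lborel) = 1"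
    using exponential_tail[OF c, of 0] by (simp_all add: ed[abs_def])
  have int: "integrable (lborel \<Otimes>\<^sub>M lborel) (\<lambda>(t, u). ?h t u)"
  proof (rule Bochner_Integration.integrable_bound)
    show "integrable (lborel \<Otimes>\<^sub>M lborel) (\<lambda>p. (c * (a + 3 / 2)) * (case p of (t, u) \<Rightarrow> of_bool (\<bar>u\<bar> \<le> t) * exp (- c * t)))"
      by (intro integrable_mult_right integrable_exp_cone c)
    show "(\<lambda>(t, u). ?h t u) \<in> borel_measurable (lborel \<Otimes>\<^sub>M lborel)"
      unfolding case_prod_beta by measurable
    show "AE p in lborel \<Otimes>\<^sub>M lborel. norm (case p of (t, u) \<Rightarrow> ?h t u) \<le> norm ((c * (a + 3 / 2)) * (case p of (t, u) \<Rightarrow> of_bool (\<bar>u\<bar> \<le> t) * exp (- c * t)))"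
    proof (intro AE_I2, clarify)
      fix t u :: real
      have "c * exp (- c * t) * \<bar>?\<Gamma> u\<bar> \<le> c * exp (- c * t) * (a + 3 / 2)"
        using c abs_mean_generator_le[OF \<theta>] by (intro mult_left_mono) auto
      then show "norm (?h t u) \<le> norm ((c * (a + 3 / 2)) * (of_bool (\<bar>u\<bar> \<le> t) * exp (- c * t)))"
        using c a_nonneg by (auto simp: abs_mult mult_ac)
    qed
  qed
  have e1: "(\<integral>u. ?h t u \<partial>lborel) = exponential_density c t * (LINT u:{0..t}|lborel. ?\<Gamma> u)" for t
  proof -
    have "(\<integral>u. ?h t u \<partial>lborel) = (\<integral>u. (c * exp (- c * t)) * (indicator {0..t} u *\<^sub>R ?\<Gamma> u) \<partial>lborel)"
      by (intro Bochner_Integration.integral_cong) (auto simp: indicator_def)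
    also have "\<dots> = c * exp (- c * t) * (LINT u:{0..t}|lborel. ?\<Gamma> u)"
      by (simp add: set_lebesgue_integral_def)
    also have "\<dots> = exponential_density c t * (LINT u:{0..t}|lborel. ?\<Gamma> u)"
      by (cases "0 \<le> t") (auto simp: ed set_lebesgue_integral_def)
    finally show ?thesis .
  qed
  have e2: "c * (\<integral>t. ?h t u \<partial>lborel) = exponential_density c u * ?\<Gamma> u" for u
  proof -
    have "(\<integral>t. ?h t u \<partial>lborel) = (\<integral>t. (indicator {u..} t * (c * exp (- c * t))) * (of_bool (0 \<le> u) * ?\<Gamma> u) \<partial>lborel)"
      by (intro Bochner_Integration.integral_cong) (auto simp: indicator_def)
    also have "\<dots> = exp (- c * u) * (of_bool (0 \<le> u) * ?\<Gamma> u)"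
      by (subst integral_mult_left_zero, subst exponential_tail(2)[OF c]) (rule refl)
    finally have e: "(\<integral>t. ?h t u \<partial>lborel) = exp (- c * u) * (of_bool (0 \<le> u) * ?\<Gamma> u)" .
    show ?thesis unfolding e ed by (simp add: indicator_def)
  qed
  have i1: "integrable lborel (\<lambda>t. exponential_density c t * (LINT u:{0..t}|lborel. ?\<Gamma> u))"
    using lborel_pair.integrable_fst[OF int] by (simp only: e1)
  have "(\<integral>t. exponential_density c t * cosh_laplace \<theta> t \<partial>lborel) =
     (\<integral>t. exponential_density c t * exp (- \<theta> * cosh x0) + exponential_density c t * (LINT u:{0..t}|lborel. ?\<Gamma> u) \<partial>lborel)"
  proof (intro Bochner_Integration.integral_cong refl)
    fix t
    show "exponential_density c t * cosh_laplace \<theta> t =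
      exponential_density c t * exp (- \<theta> * cosh x0) + exponential_density c t * (LINT u:{0..t}|lborel. ?\<Gamma> u)"
    proof (cases "0 \<le> t")
      case True
      then show ?thesis by (simp only: cosh_laplace_evolution[OF \<theta>] distrib_left)
    qed (simp add: exponential_density_def)
  qed
  also have "\<dots> = exp (- \<theta> * cosh x0) + (\<integral>t. exponential_density c t * (LINT u:{0..t}|lborel. ?\<Gamma> u) \<partial>lborel)"
    by (subst Bochner_Integration.integral_add[OF integrable_mult_left[OF ed_int(1)] i1], subst integral_mult_left_zero)
      (simp only: ed_int mult_1)
  also have "(\<integral>t. exponential_density c t * (LINT u:{0..t}|lborel. ?\<Gamma> u) \<partial>lborel) = (\<integral>u. \<integral>t. ?h t u \<partial>lborel \<partial>lborel)"
    unfolding e1[symmetric] by (rule lborel_pair.Fubini_integral[OF int, symmetric])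
  finally have e: "(\<integral>t. exponential_density c t * cosh_laplace \<theta> t \<partial>lborel) = exp (- \<theta> * cosh x0) + (\<integral>u. \<integral>t. ?h t u \<partial>lborel \<partial>lborel)" .
  have "c * (\<integral>u. \<integral>t. ?h t u \<partial>lborel \<partial>lborel) = (\<integral>u. c * (\<integral>t. ?h t u \<partial>lborel) \<partial>lborel)"
    by (rule integral_mult_right_zero[symmetric])
  also have "\<dots> = (\<integral>u. exponential_density c u * ?\<Gamma> u \<partial>lborel)"
    by (simp only: e2)
  finally have e': "c * (\<integral>u. \<integral>t. ?h t u \<partial>lborel \<partial>lborel) = (\<integral>u. exponential_density c u * ?\<Gamma> u \<partial>lborel)" .
  have gen: "c * p - r = c * q" if "p = q + w" "c * w = r" for p q r w :: real
    using that by (simp add: distrib_left)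
  show ?thesis by (rule gen[OF e e'])
qed

text \<open>
  The duality identity is averaged over \<open>y = cosh X\<^sub>t\<close> with \<open>t\<close> exponentially distributed. On one side this gives
  twice the transform at \<open>l\<close>. On the other side, for each \<open>z\<close>, the average of \<open>2 c f\<^sub>\<theta> - 2\<close> generator at
  \<open>\<theta> = l exp z\<close> is by the evolution equation the initial value \<open>2 c exp (- \<theta> cosh x0)\<close>. The choice of \<open>s\<close> makes
  \<open>s\<^sup>2 - a\<^sup>2 = 2 c\<close>.
\<close>

lemma cosh_laplace_time_transform:
  assumes c: "0 < c" and l: "0 < l"
  defines "s \<equiv> sqrt (a\<^sup>2 + 2 * c)"
  shows "(\<integral>t. exponential_density c t * cosh_laplace l t \<partial>lborel) = c * (\<integral>v. exp (- s * v) * wave_source a l x0 v \<partial>lborel)"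
proof -
  let ?E = "density lborel (exponential_density c)"
  let ?R = "lborel \<Otimes>\<^sub>M lborel :: (real \<times> real) measure"
  interpret E: prob_space ?E by (rule prob_space_exponential_density[OF c])
  interpret Q: pair_prob_space M ?E ..
  interpret QR: pair_sigma_finite "M \<Otimes>\<^sub>M ?E" ?R
    by (intro pair_sigma_finite.intro Q.sigma_finite_measure_axioms lborel_pair.sigma_finite_measure_axioms)
  have s2: "s\<^sup>2 - a\<^sup>2 = 2 * c" using c by (simp add: s_def)
  have as: "a < s"
    unfolding s_def using c a_nonneg by (intro real_less_rsqrt) simp
  define Y where "Y q = cosh (X (fst q) (snd q))" for q
  have [measurable]: "(\<lambda>p. X (fst p) (snd p)) \<in> borel_measurable (M \<Otimes>\<^sub>M ?E)"
    using X_jointly_measurable by (simp cong: measurable_cong_sets sets_pair_measure_cong)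
  have Y_meas [measurable]: "Y \<in> borel_measurable (M \<Otimes>\<^sub>M ?E)"
    unfolding Y_def[abs_def] by measurable
  have Y1: "1 \<le> Y q" for q by (simp add: Y_def cosh_real_ge_1)
  \<comment> \<open>The integrand of the duality identity, split into a part without the process and the rest.\<close>
  define k where "k v z = of_bool (\<bar>z\<bar> \<le> v) * (exp (- s * v) * exp (a * z) * wave_kernel l v z)" for v z
  define f where "f q v z = k v z * ((s\<^sup>2 - a\<^sup>2) * exp (- l * exp z * Y q) - 2 * exp_generator a (l * exp z) (Y q))" for q v z
  let ?C = "2 * c + 2 * (a + 3 / 2)"
  have kb: "\<bar>k v z\<bar> \<le> of_bool (\<bar>z\<bar> \<le> v) * exp (- (s - a) * v)" for v z
  proof (cases "\<bar>z\<bar> \<le> v")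
    case True
    have "exp (- s * v) * exp (a * z) * \<bar>wave_kernel l v z\<bar> \<le> exp (- s * v) * exp (a * v) * 1"
      using True a_nonneg abs_wave_kernel_le_1[OF True, of l] by (intro mult_mono) (auto intro: mult_left_mono)
    also have "\<dots> = exp (- (s - a) * v)" by (simp add: algebra_simps flip: exp_add)
    finally show ?thesis using True by (simp add: k_def abs_mult)
  qed (simp add: k_def)
  have fb: "\<bar>f q v z\<bar> \<le> ?C * (of_bool (\<bar>z\<bar> \<le> v) * exp (- (s - a) * v))" for q v z
  proof -
    have "\<bar>(s\<^sup>2 - a\<^sup>2) * exp (- l * exp z * Y q)\<bar> \<le> 2 * c"
      unfolding s2 using c l Y1[of q] by (simp add: abs_mult)
    moreover have "\<bar>2 * exp_generator a (l * exp z) (Y q)\<bar> \<le> 2 * (a + 3 / 2)"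
      using abs_exp_generator_le[OF a_nonneg, of "l * exp z" "Y q"] l Y1 by (simp add: abs_mult)
    ultimately have "\<bar>(s\<^sup>2 - a\<^sup>2) * exp (- l * exp z * Y q) - 2 * exp_generator a (l * exp z) (Y q)\<bar> \<le> ?C" by linarith
    then have "\<bar>f q v z\<bar> \<le> (of_bool (\<bar>z\<bar> \<le> v) * exp (- (s - a) * v)) * ?C"
      unfolding f_def abs_mult[of "k v z"] using kb by (intro mult_mono) auto
    then show ?thesis by (simp add: mult.commute)
  qed
  have cone: "integrable ?R (\<lambda>p. ?C * (case p of (v, z) \<Rightarrow> of_bool (\<bar>z\<bar> \<le> v) * exp (- (s - a) * v)))"
    using as by (intro integrable_mult_right integrable_exp_cone) simp
  have k_meas [measurable]: "(\<lambda>p. k (fst p) (snd p)) \<in> borel_measurable ?R"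
    unfolding k_def by measurable
  have f_meas: "(\<lambda>(q, p). f q (fst p) (snd p)) \<in> borel_measurable ((M \<Otimes>\<^sub>M ?E) \<Otimes>\<^sub>M ?R)"
    unfolding f_def exp_generator_def case_prod_beta by measurable
  have f_int: "integrable ((M \<Otimes>\<^sub>M ?E) \<Otimes>\<^sub>M ?R) (\<lambda>(q, p). f q (fst p) (snd p))"
  proof (rule integrable_dominated[OF _ f_meas])
    show "integrable ((M \<Otimes>\<^sub>M ?E) \<Otimes>\<^sub>M ?R) (\<lambda>(q, p). ?C * (case p of (v, z) \<Rightarrow> of_bool (\<bar>z\<bar> \<le> v) * exp (- (s - a) * v)))"
    proof (rule QR.Fubini_integrable)
      show "(\<lambda>(q, p). ?C * (case p of (v, z) \<Rightarrow> of_bool (\<bar>z\<bar> \<le> v) * exp (- (s - a) * v))) \<in> borel_measurable ((M \<Otimes>\<^sub>M ?E) \<Otimes>\<^sub>M ?R)"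
        unfolding case_prod_beta by measurable
    qed (use cone in auto)
  qed (unfold case_prod_beta, rule fb)
  have left: "(\<integral>p. f q (fst p) (snd p) \<partial>?R) = 2 * exp (- l * Y q)" for q
  proof -
    have "integrable ?R (\<lambda>p. f q (fst p) (snd p))"
    proof (rule integrable_dominated[OF cone])
      show "(\<lambda>p. f q (fst p) (snd p)) \<in> borel_measurable ?R"
        unfolding f_def exp_generator_def by measurable
    qed (unfold case_prod_beta, rule fb)
    then have "(\<integral>p. f q (fst p) (snd p) \<partial>?R) = (\<integral>v. \<integral>z. f q v z \<partial>lborel \<partial>lborel)"
      by (subst lborel_pair.integral_fst'[symmetric]) auto
    also have "\<dots> = 2 * exp (- l * Y q)"
      using wave_duality[OF a_nonneg as l Y1[of q]] by (simp add: f_def k_def mult.assoc)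
    finally show ?thesis .
  qed
  have gen: "(\<integral>q. exp_generator a \<theta> (Y q) \<partial>(M \<Otimes>\<^sub>M ?E)) = (\<integral>t. exponential_density c t * mean_generator \<theta> t \<partial>lborel)"
    "integrable (M \<Otimes>\<^sub>M ?E) (\<lambda>q. exp_generator a \<theta> (Y q))" if "0 < \<theta>" for \<theta>
  proof -
    have m: "(\<lambda>x. exp_generator a \<theta> (cosh x)) \<in> borel_measurable borel" by measurable
    note i = integral_bounded_over_exponential_time[OF c m generator_bound[OF that], unfolded case_prod_beta]
    show "(\<integral>q. exp_generator a \<theta> (Y q) \<partial>(M \<Otimes>\<^sub>M ?E)) = (\<integral>t. exponential_density c t * mean_generator \<theta> t \<partial>lborel)"
      "integrable (M \<Otimes>\<^sub>M ?E) (\<lambda>q. exp_generator a \<theta> (Y q))"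
      unfolding Y_def mean_generator_def by (fact i)+
  qed
  have lap: "(\<integral>q. exp (- \<theta> * Y q) \<partial>(M \<Otimes>\<^sub>M ?E)) = (\<integral>t. exponential_density c t * cosh_laplace \<theta> t \<partial>lborel)"
    "integrable (M \<Otimes>\<^sub>M ?E) (\<lambda>q. exp (- \<theta> * Y q))" if "0 < \<theta>" for \<theta>
  proof -
    have m: "(\<lambda>x. exp (- \<theta> * cosh x)) \<in> borel_measurable borel" by measurable
    have "\<bar>exp (- \<theta> * cosh x)\<bar> \<le> 1" for x using that by simp
    note i = integral_bounded_over_exponential_time[OF c m this, unfolded case_prod_beta]
    show "(\<integral>q. exp (- \<theta> * Y q) \<partial>(M \<Otimes>\<^sub>M ?E)) = (\<integral>t. exponential_density c t * cosh_laplace \<theta> t \<partial>lborel)"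
      "integrable (M \<Otimes>\<^sub>M ?E) (\<lambda>q. exp (- \<theta> * Y q))"
      unfolding Y_def cosh_laplace_def by (fact i)+
  qed
  have right: "(\<integral>q. f q v z \<partial>(M \<Otimes>\<^sub>M ?E)) = k v z * (2 * c * exp (- l * exp z * cosh x0))" for v z
  proof -
    have th: "0 < l * exp z" using l by simp
    have "(\<integral>q. f q v z \<partial>(M \<Otimes>\<^sub>M ?E)) = k v z * (2 * c * (\<integral>q. exp (- (l * exp z) * Y q) \<partial>(M \<Otimes>\<^sub>M ?E)) - 2 * (\<integral>q. exp_generator a (l * exp z) (Y q) \<partial>(M \<Otimes>\<^sub>M ?E)))"
      unfolding f_def s2 using gen(2)[OF th] lap(2)[OF th] by simp
    also have "\<dots> = k v z * (2 * (c * exp (- (l * exp z) * cosh x0)))"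
      unfolding gen(1)[OF th] lap(1)[OF th] exponential_time_generator[OF c th, symmetric] by (simp add: algebra_simps)
    finally show ?thesis by (simp add: mult_ac)
  qed
  have "2 * (\<integral>t. exponential_density c t * cosh_laplace l t \<partial>lborel) = (\<integral>q. \<integral>p. f q (fst p) (snd p) \<partial>?R \<partial>(M \<Otimes>\<^sub>M ?E))"
    unfolding left lap(1)[OF l, symmetric] by simp
  also have "\<dots> = (\<integral>p. \<integral>q. f q (fst p) (snd p) \<partial>(M \<Otimes>\<^sub>M ?E) \<partial>?R)"
    using QR.Fubini_integral[OF f_int] by simp
  also have "\<dots> = (\<integral>p. k (fst p) (snd p) * (2 * c * exp (- l * exp (snd p) * cosh x0)) \<partial>?R)"
    unfolding right ..
  also have "\<dots> = (\<integral>v. \<integral>z. k v z * (2 * c * exp (- l * exp z * cosh x0)) \<partial>lborel \<partial>lborel)"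
  proof (subst lborel_pair.integral_fst'[symmetric])
    have "integrable ?R (\<lambda>p. \<integral>q. f q (fst p) (snd p) \<partial>(M \<Otimes>\<^sub>M ?E))"
      using QR.integrable_snd[OF f_int] by simp
    then show "integrable ?R (\<lambda>p. k (fst p) (snd p) * (2 * c * exp (- l * exp (snd p) * cosh x0)))"
      unfolding right .
  qed simp
  also have "\<dots> = (\<integral>v. 2 * c * (exp (- s * v) * wave_source a l x0 v) \<partial>lborel)"
  proof (intro Bochner_Integration.integral_cong refl)
    fix v
    have ac: "q * (A * B * J) * (2 * c * E) = 2 * c * A * (q * (B * E * J))" for q A B J E :: real
      by (simp add: mult_ac)
    have "(\<integral>z. k v z * (2 * c * exp (- l * exp z * cosh x0)) \<partial>lborel) =
      (\<integral>z. 2 * c * exp (- s * v) * (of_bool (\<bar>z\<bar> \<le> v) * (exp (a * z) * exp (- l * exp z * cosh x0) * wave_kernel l v z)) \<partial>lborel)"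
      unfolding k_def by (intro Bochner_Integration.integral_cong refl ac)
    then show "(\<integral>z. k v z * (2 * c * exp (- l * exp z * cosh x0)) \<partial>lborel) = 2 * c * (exp (- s * v) * wave_source a l x0 v)"
      by (simp add: wave_source_def)
  qed
  also have "\<dots> = 2 * (c * (\<integral>v. exp (- s * v) * wave_source a l x0 v \<partial>lborel))"
    by (subst integral_mult_right_zero) (rule mult.assoc)
  finally show ?thesis unfolding mult_cancel_left by linarith
qed

end

section \<open>Averages over the hitting density\<close>

lemma wave_source_measurable [measurable]: "wave_source a l x \<in> borel_measurable borel"
proof -
  have "(\<lambda>(v, z). of_bool (\<bar>z\<bar> \<le> v) * (exp (a * z) * exp (- l * exp z * cosh x) * wave_kernel l v z)) \<in> borel_measurable (borel \<Otimes>\<^sub>M lborel)"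
    unfolding case_prod_beta by measurable
  then show ?thesis
    unfolding wave_source_def[abs_def] by (rule lborel.borel_measurable_lebesgue_integral)
qed

lemma wave_source_integrand_bound:
  assumes "0 \<le> a" "0 < l"
  shows "\<bar>of_bool (\<bar>z\<bar> \<le> v) * (exp (a * z) * exp (- l * exp z * cosh x) * wave_kernel l v z)\<bar> \<le> indicator {-v..v} z * exp (a * v)"
proof (cases "\<bar>z\<bar> \<le> v")
  case True
  have "exp (- l * exp z * cosh x) \<le> 1" using assms by (simp add: cosh_real_nonneg)
  then have "exp (a * z) * exp (- l * exp z * cosh x) * \<bar>wave_kernel l v z\<bar> \<le> exp (a * v) * 1 * 1"
    using True assms abs_wave_kernel_le_1[OF True, of l] by (intro mult_mono) (auto intro: mult_left_mono)
  then show ?thesis using True by (simp add: abs_mult indicator_def abs_le_iff)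
qed simp

lemma abs_wave_source_le:
  assumes "0 \<le> a" "0 < l"
  shows "\<bar>wave_source a l x v\<bar> \<le> 2 * (indicator {0..} v * (v * exp (a * v)))"
proof -
  have i: "integrable lborel (\<lambda>z. indicator {-v..v} z * exp (a * v))"
    by (rule integrable_on_interval)
  have "\<bar>wave_source a l x v\<bar> \<le> (\<integral>z. indicator {-v..v} z * exp (a * v) \<partial>lborel)"
    unfolding wave_source_def
  proof (rule abs_integral_le[OF _ i wave_source_integrand_bound[OF assms]])
    show "integrable lborel (\<lambda>z. of_bool (\<bar>z\<bar> \<le> v) * (exp (a * z) * exp (- l * exp z * cosh x) * wave_kernel l v z))"
      by (rule integrable_dominated[OF i _ wave_source_integrand_bound[OF assms]]) measurable
  qed
  also have "\<dots> = 2 * (indicator {0..} v * (v * exp (a * v)))"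
  proof -
    have "v < 0 \<or> 0 \<le> v" by linarith
    then show ?thesis by auto
  qed
  finally show ?thesis .
qed

lemma hitting_density_measurable [measurable (raw)]:
  assumes [measurable]: "f \<in> borel_measurable N" "g \<in> borel_measurable N"
  shows "(\<lambda>x. hitting_density (f x) (g x)) \<in> borel_measurable N"
  unfolding hitting_density_def by measurable

text \<open>
  Completing the square: up to a constant the integrand is \<open>v\<^sup>2\<close> times the normal density with mean \<open>a t\<close> and
  variance \<open>t\<close>. In this form it is nonnegative and integrable on the whole line.
\<close>

lemma hitting_density_moment:
  assumes t: "0 < t"
  shows "integrable lborel (\<lambda>v. hitting_density v t * (v * exp (a * v)))"
    "(\<integral>v. hitting_density v t * (v * exp (a * v)) \<partial>lborel) = exp (a\<^sup>2 * t / 2) * (1 + a\<^sup>2 * t)"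
proof -
  let ?n = "normal_density (a * t) (sqrt t)"
  have st: "0 < sqrt t" using t by simp
  have eq: "hitting_density v t * (v * exp (a * v)) =
      exp (a\<^sup>2 * t / 2) / t * (?n v * (v - a * t) ^ (2 * 1) + 2 * a * t * (?n v * (v - a * t) ^ (2 * 0 + 1)) + (a * t)\<^sup>2 * (?n v * (v - a * t) ^ (2 * 0)))" for v
  proof -
    have "- v\<^sup>2 / (2 * t) + a * v = a\<^sup>2 * t / 2 - (v - a * t)\<^sup>2 / (2 * t)"
      using t by (simp add: field_simps power2_eq_square)
    then have "exp (- v\<^sup>2 / (2 * t)) * exp (a * v) = exp (a\<^sup>2 * t / 2) * exp (- (v - a * t)\<^sup>2 / (2 * t))"
      by (simp flip: exp_add)
    then have "hitting_density v t * (v * exp (a * v)) = v\<^sup>2 / (sqrt (2 * pi) * t * sqrt t) * (exp (a\<^sup>2 * t / 2) * exp (- (v - a * t)\<^sup>2 / (2 * t)))"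
      unfolding hitting_density_def by (simp add: power2_eq_square)
    also have "\<dots> = exp (a\<^sup>2 * t / 2) / t * (?n v * v\<^sup>2)"
      using t by (simp add: normal_density_def real_sqrt_mult mult_ac)
    also have "?n v * v\<^sup>2 = ?n v * (v - a * t) ^ (2 * 1) + 2 * a * t * (?n v * (v - a * t) ^ (2 * 0 + 1)) + (a * t)\<^sup>2 * (?n v * (v - a * t) ^ (2 * 0))"
      by (simp add: power2_eq_square algebra_simps)
    finally show ?thesis .
  qed
  note m = normal_moment_even[OF st, of "a * t" 1] normal_moment_odd[OF st, of "a * t" 0] normal_moment_even[OF st, of "a * t" 0]
  have h: "has_bochner_integral lborel (\<lambda>v. hitting_density v t * (v * exp (a * v)))
    (exp (a\<^sup>2 * t / 2) / t * (fact (2 * 1) / ((2 / (sqrt t)\<^sup>2) ^ 1 * fact 1) + 2 * a * t * 0 + (a * t)\<^sup>2 * (fact (2 * 0) / ((2 / (sqrt t)\<^sup>2) ^ 0 * fact 0))))"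
    unfolding eq by (intro has_bochner_integral_mult_right has_bochner_integral_add m)
  show "integrable lborel (\<lambda>v. hitting_density v t * (v * exp (a * v)))"
    using h by (rule integrable.intros)
  have "exp (a\<^sup>2 * t / 2) / t * (fact (2 * 1) / ((2 / (sqrt t)\<^sup>2) ^ 1 * fact 1) + 2 * a * t * 0 + (a * t)\<^sup>2 * (fact (2 * 0) / ((2 / (sqrt t)\<^sup>2) ^ 0 * fact 0))) = exp (a\<^sup>2 * t / 2) * (1 + a\<^sup>2 * t)"
    using t by (simp add: fact_numeral field_simps power2_eq_square)
  then show "(\<integral>v. hitting_density v t * (v * exp (a * v)) \<partial>lborel) = exp (a\<^sup>2 * t / 2) * (1 + a\<^sup>2 * t)"
    using has_bochner_integral_integral_eq[OF h] by simp
qed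

text \<open>The right-hand side of the claim, as an integral over the level \<open>v\<close> alone.\<close>

definition hitting_average :: "real \<Rightarrow> real \<Rightarrow> real \<Rightarrow> real \<Rightarrow> real" where
  "hitting_average a l x t = exp (- (a\<^sup>2 * t / 2)) * (\<integral>v. hitting_density v t * wave_source a l x v \<partial>lborel)"

context
  fixes a l x :: real
  assumes a: "0 \<le> a" and l: "0 < l"
begin

lemma hitting_moment_nonneg: "0 < t \<Longrightarrow> 0 \<le> hitting_density v t * (v * exp (a * v))"
proof -
  assume t: "0 < t"
  have "hitting_density v t * (v * exp (a * v)) = v\<^sup>2 * (exp (- v\<^sup>2 / (2 * t)) * exp (a * v) / (sqrt (2 * pi) * t * sqrt t))"
    by (simp add: hitting_density_def power2_eq_square)
  also have "0 \<le> \<dots>" using t by simp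
  finally show ?thesis .
qed

lemma hitting_source_bound:
  assumes t: "0 < t"
  shows "\<bar>hitting_density v t * wave_source a l x v\<bar> \<le> 2 * (hitting_density v t * (v * exp (a * v)))"
proof (cases "0 \<le> v")
  case True
  have h: "0 \<le> hitting_density v t" using True t by (simp add: hitting_density_def)
  have "hitting_density v t * \<bar>wave_source a l x v\<bar> \<le> hitting_density v t * (2 * (v * exp (a * v)))"
    using abs_wave_source_le[OF a l, of x v] True h by (intro mult_left_mono) auto
  then show ?thesis using h by (simp add: abs_mult)
next
  case False
  then have "wave_source a l x v = 0" using abs_wave_source_le[OF a l, of x v] by simp
  then show ?thesis using hitting_moment_nonneg[OF t, of v] by simp
qed

lemma hitting_source_integrable:
  assumes t: "0 < t"
  shows "integrable lborel (\<lambda>v. hitting_density v t * wave_source a l x v)"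
  by (rule integrable_dominated[OF integrable_mult_right[OF hitting_density_moment(1)[OF t]] _ hitting_source_bound[OF t]])
    measurable

lemma abs_hitting_average_le:
  assumes t: "0 < t"
  shows "\<bar>hitting_average a l x t\<bar> \<le> 2 * (1 + a\<^sup>2 * t)"
proof -
  have "\<bar>\<integral>v. hitting_density v t * wave_source a l x v \<partial>lborel\<bar> \<le> (\<integral>v. 2 * (hitting_density v t * (v * exp (a * v))) \<partial>lborel)"
    by (intro abs_integral_le hitting_source_integrable t integrable_mult_right hitting_density_moment hitting_source_bound)
  also have "\<dots> = 2 * (exp (a\<^sup>2 * t / 2) * (1 + a\<^sup>2 * t))"
    by (simp add: hitting_density_moment[OF t])
  finally have "exp (- (a\<^sup>2 * t / 2)) * \<bar>\<integral>v. hitting_density v t * wave_source a l x v \<partial>lborel\<bar>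
     \<le> exp (- (a\<^sup>2 * t / 2)) * (2 * (exp (a\<^sup>2 * t / 2) * (1 + a\<^sup>2 * t)))"
    by (intro mult_left_mono) auto
  also have "\<dots> = 2 * (1 + a\<^sup>2 * t)" by (simp add: exp_minus field_simps)
  finally show ?thesis by (simp add: hitting_average_def abs_mult)
qed

text \<open>Near \<open>t0\<close> all hitting densities are dominated by a multiple of the one at time \<open>2 * t0\<close>.\<close>

lemma continuous_on_hitting_average: "continuous_on {0<..} (hitting_average a l x)"
proof (rule continuous_at_imp_continuous_on, rule ballI)
  fix t0 :: real assume "t0 \<in> {0<..}"
  then have t0: "0 < t0" by simp
  define t1 t2 where "t1 = t0 / 2" and "t2 = 2 * t0"
  have t12: "0 < t1" "t1 < t0" "t0 < t2" "0 < t2" using t0 by (auto simp: t1_def t2_def)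
  define C where "C = t2 * sqrt t2 / (t1 * sqrt t1)"
  have dom: "\<bar>hitting_density v t * wave_source a l x v\<bar> \<le> 2 * C * (hitting_density v t2 * (v * exp (a * v)))"
    if t: "t \<in> {t1..t2}" for t v
  proof -
    have tp: "0 < t" using t t12 by auto
    have ex: "exp (- v\<^sup>2 / (2 * t)) \<le> exp (- v\<^sup>2 / (2 * t2))"
      using t tp t12 by (simp add: frac_le)
    have de: "1 / (t * sqrt t) \<le> 1 / (t1 * sqrt t1)"
      using t tp t12 by (intro divide_left_mono mult_mono mult_pos_pos) auto
    have "hitting_density v t * (v * exp (a * v)) = (v\<^sup>2 * exp (a * v) / sqrt (2 * pi)) * (1 / (t * sqrt t) * exp (- v\<^sup>2 / (2 * t)))"
      by (simp add: hitting_density_def power2_eq_square mult_ac)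
    also have "\<dots> \<le> (v\<^sup>2 * exp (a * v) / sqrt (2 * pi)) * (1 / (t1 * sqrt t1) * exp (- v\<^sup>2 / (2 * t2)))"
      using ex de t12 by (intro mult_left_mono mult_mono) auto
    also have "\<dots> = C * (hitting_density v t2 * (v * exp (a * v)))"
      using t12 by (simp add: C_def hitting_density_def power2_eq_square mult_ac)
    finally show ?thesis using hitting_source_bound[OF tp, of v] by simp
  qed
  have "continuous_on {t1..t2} (\<lambda>t. \<integral>v. hitting_density v t * wave_source a l x v \<partial>lborel)"
    unfolding continuous_on_sequentially
  proof (intro allI ballI impI, elim conjE)
    fix X :: "nat \<Rightarrow> real" and t assume t: "t \<in> {t1..t2}" and X: "\<forall>n. X n \<in> {t1..t2}" "X \<longlonglongrightarrow> t"
    have tp: "0 < t" using t t12 by auto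
    show "((\<lambda>t. \<integral>v. hitting_density v t * wave_source a l x v \<partial>lborel) \<circ> X) \<longlonglongrightarrow> (\<integral>v. hitting_density v t * wave_source a l x v \<partial>lborel)"
      unfolding comp_def
    proof (rule integral_dominated_convergence[where w = "\<lambda>v. 2 * C * (hitting_density v t2 * (v * exp (a * v)))"])
      show "integrable lborel (\<lambda>v. 2 * C * (hitting_density v t2 * (v * exp (a * v))))"
        by (intro integrable_mult_right hitting_density_moment t12)
      show "AE v in lborel. norm (hitting_density v (X n) * wave_source a l x v) \<le> 2 * C * (hitting_density v t2 * (v * exp (a * v)))" for n
        unfolding real_norm_def using X(1) by (intro AE_I2 dom) auto
      show "AE v in lborel. (\<lambda>n. hitting_density v (X n) * wave_source a l x v) \<longlonglongrightarrow> hitting_density v t * wave_source a l x v"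
        unfolding hitting_density_def using tp by (intro AE_I2 tendsto_intros X(2)) auto
    qed measurable
  qed
  then have "continuous_on {t1..t2} (hitting_average a l x)"
    unfolding hitting_average_def[abs_def] by (intro continuous_intros) auto
  then show "isCont (hitting_average a l x) t0"
    by (rule continuous_on_interior) (use t12 in \<open>simp add: interior_atLeastAtMost_real\<close>)
qed

lemma hitting_average_laplace:
  assumes c: "0 < c"
  defines "s \<equiv> sqrt (a\<^sup>2 + 2 * c)"
  shows "set_integrable lborel {0<..} (\<lambda>t. exp (- c * t) * hitting_average a l x t)"
    "(LINT t:{0<..}|lborel. exp (- c * t) * hitting_average a l x t) = (\<integral>v. exp (- s * v) * wave_source a l x v \<partial>lborel)"
proof -
  let ?ws = "wave_source a l x"
  let ?h = "\<lambda>v t. indicator {0<..} t * (exp (- (s\<^sup>2 / 2 * t)) * hitting_density v t) * ?ws v"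
  have as: "a < s" unfolding s_def using c a by (intro real_less_rsqrt) simp
  have s: "0 < s" using as a by simp
  have s2: "s\<^sup>2 / 2 = c + a\<^sup>2 / 2" using c by (simp add: s_def)
  have ws0: "?ws v = 0" if "v \<le> 0" for v
    using abs_wave_source_le[OF a l, of x v] that by (cases "v = 0") auto
  have inner: "integrable lborel (?h v)" "(\<integral>t. ?h v t \<partial>lborel) = exp (- s * v) * ?ws v"
    "(\<integral>t. norm (?h v t) \<partial>lborel) = exp (- s * v) * \<bar>?ws v\<bar>" for v
  proof -
    have "integrable lborel (?h v) \<and> (\<integral>t. ?h v t \<partial>lborel) = exp (- s * v) * ?ws v \<and> (\<integral>t. norm (?h v t) \<partial>lborel) = exp (- s * v) * \<bar>?ws v\<bar>"
    proof (cases "0 < v")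
      case True
      note L = hitting_density_laplace[OF True s, unfolded set_integrable_def set_lebesgue_integral_def real_scaleR_def]
      have n: "norm (?h v t) = indicator {0<..} t * (exp (- (s\<^sup>2 / 2 * t)) * hitting_density v t) * \<bar>?ws v\<bar>" for t
        using True by (simp add: abs_mult hitting_density_def indicator_def)
      show ?thesis
        unfolding n integral_mult_left_zero L(2) using integrable_mult_left[OF L(1)] by blast
    qed (simp add: ws0)
    then show "integrable lborel (?h v)" "(\<integral>t. ?h v t \<partial>lborel) = exp (- s * v) * ?ws v"
      "(\<integral>t. norm (?h v t) \<partial>lborel) = exp (- s * v) * \<bar>?ws v\<bar>" by blast+
  qed
  have dom: "integrable lborel (\<lambda>v. exp (- s * v) * \<bar>?ws v\<bar>)"
  proof (rule integrable_dominated)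
    show "integrable lborel (\<lambda>v. 2 * (indicator {0..} v * (v * exp (- (s - a) * v))))"
      using as by (intro integrable_mult_right integrable_linear_exp) simp
    show "\<bar>exp (- s * v) * \<bar>?ws v\<bar>\<bar> \<le> 2 * (indicator {0..} v * (v * exp (- (s - a) * v)))" for v
    proof -
      have "exp (- s * v) * \<bar>?ws v\<bar> \<le> exp (- s * v) * (2 * (indicator {0..} v * (v * exp (a * v))))"
        using abs_wave_source_le[OF a l] by (intro mult_left_mono) auto
      also have "\<dots> = 2 * (indicator {0..} v * (v * (exp (- s * v) * exp (a * v))))" by simp
      also have "exp (- s * v) * exp (a * v) = exp (- (s - a) * v)" by (simp add: algebra_simps flip: exp_add)
      finally have le: "exp (- s * v) * \<bar>?ws v\<bar> \<le> 2 * (indicator {0..} v * (v * exp (- (s - a) * v)))" .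
      show ?thesis
        unfolding abs_mult[of "exp _"] abs_exp_cancel abs_idempotent by (rule le)
    qed
  qed measurable
  have int: "integrable (lborel \<Otimes>\<^sub>M lborel) (\<lambda>(v, t). ?h v t)"
  proof (rule lborel_pair.Fubini_integrable)
    show "(\<lambda>(v, t). ?h v t) \<in> borel_measurable (lborel \<Otimes>\<^sub>M lborel)"
      unfolding case_prod_beta by measurable
    show "integrable lborel (\<lambda>v. \<integral>t. norm (case (v, t) of (v, t) \<Rightarrow> ?h v t) \<partial>lborel)"
      unfolding prod.case inner(3) by (rule dom)
    show "AE v in lborel. integrable lborel (\<lambda>t. case (v, t) of (v, t) \<Rightarrow> ?h v t)"
      unfolding prod.case by (intro AE_I2 inner)
  qed
  have e: "(\<integral>v. ?h v t \<partial>lborel) = indicator {0<..} t *\<^sub>R (exp (- c * t) * hitting_average a l x t)" for t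
  proof -
    have "(\<integral>v. ?h v t \<partial>lborel) = (\<integral>v. (indicator {0<..} t * exp (- (s\<^sup>2 / 2 * t))) * (hitting_density v t * ?ws v) \<partial>lborel)"
      by (simp only: mult.assoc)
    also have "\<dots> = (indicator {0<..} t * exp (- (s\<^sup>2 / 2 * t))) * (\<integral>v. hitting_density v t * ?ws v \<partial>lborel)"
      by (rule integral_mult_right_zero)
    finally have e1: "(\<integral>v. ?h v t \<partial>lborel) = (indicator {0<..} t * exp (- (s\<^sup>2 / 2 * t))) * (\<integral>v. hitting_density v t * ?ws v \<partial>lborel)" .
    have e2: "exp (- (s\<^sup>2 / 2 * t)) = exp (- c * t) * exp (- (a\<^sup>2 * t / 2))"
      unfolding s2 by (simp add: algebra_simps flip: exp_add)
    show ?thesis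
      unfolding e1 unfolding e2 hitting_average_def real_scaleR_def by (simp only: mult.assoc)
  qed
  show "set_integrable lborel {0<..} (\<lambda>t. exp (- c * t) * hitting_average a l x t)"
    using lborel_pair.integrable_snd[OF int] unfolding e set_integrable_def .
  show "(LINT t:{0<..}|lborel. exp (- c * t) * hitting_average a l x t) = (\<integral>v. exp (- s * v) * ?ws v \<partial>lborel)"
    unfolding set_lebesgue_integral_def e[symmetric] inner(2)[symmetric] by (rule lborel_pair.Fubini_integral[OF int])
qed

end

context coth_diffusion
begin

lemma continuous_on_cosh_laplace:
  assumes \<theta>: "0 < \<theta>"
  shows "continuous_on S (cosh_laplace \<theta>)"
proof -
  have "continuous_on UNIV (cosh_laplace \<theta>)"
    unfolding continuous_on_sequentially cosh_laplace_def[abs_def] comp_def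
  proof (intro allI ballI impI, elim conjE)
    fix T :: "nat \<Rightarrow> real" and t assume T: "T \<longlonglongrightarrow> t"
    show "(\<lambda>n. expectation (\<lambda>\<omega>. exp (- \<theta> * cosh (X \<omega> (T n))))) \<longlonglongrightarrow> expectation (\<lambda>\<omega>. exp (- \<theta> * cosh (X \<omega> t)))"
    proof (rule integral_dominated_convergence[where w = "\<lambda>_. 1"])
      show "AE \<omega> in M. (\<lambda>n. exp (- \<theta> * cosh (X \<omega> (T n)))) \<longlonglongrightarrow> exp (- \<theta> * cosh (X \<omega> t))"
      proof (intro AE_I2)
        fix \<omega>
        have "isCont (X \<omega>) t" using X_cont[of \<omega>] by (simp add: continuous_on_eq_continuous_at)
        then have "(\<lambda>n. X \<omega> (T n)) \<longlonglongrightarrow> X \<omega> t" using T by (rule isCont_tendsto_compose)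
        then show "(\<lambda>n. exp (- \<theta> * cosh (X \<omega> (T n)))) \<longlonglongrightarrow> exp (- \<theta> * cosh (X \<omega> t))"
          by (intro tendsto_intros)
      qed
    qed (use \<theta> in auto)
  qed
  then show ?thesis by (rule continuous_on_subset) simp
qed

lemma abs_cosh_laplace_le_1:
  assumes \<theta>: "0 < \<theta>"
  shows "\<bar>cosh_laplace \<theta> t\<bar> \<le> 1"
proof -
  have "\<bar>cosh_laplace \<theta> t\<bar> \<le> expectation (\<lambda>\<omega>. 1)"
    unfolding cosh_laplace_def
  proof (rule abs_integral_le)
    show "integrable M (\<lambda>\<omega>. exp (- \<theta> * cosh (X \<omega> t)))"
      by (rule integrable_const_bound[where B = 1]) (use \<theta> in auto)
  qed (use \<theta> in auto)
  then show ?thesis by (simp add: prob_space)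
qed

text \<open>
  The factor \<open>exp (- t)\<close> in the proof makes the difference of the two sides bounded: one of them is only known to grow
  at most linearly in \<open>t\<close>.
\<close>

theorem cosh_laplace_eq_hitting_average:
  assumes l: "0 < l" and t: "0 < t"
  shows "cosh_laplace l t = hitting_average a l x0 t"
proof -
  let ?d = "\<lambda>t. exp (- t) * (cosh_laplace l t - hitting_average a l x0 t)"
  have [measurable]: "cosh_laplace l \<in> borel_measurable borel"
    by (rule borel_measurable_continuous_onI[OF continuous_on_cosh_laplace[OF l]])
  have "?d t = 0"
  proof (rule laplace_transform_unique[OF _ _ _ t])
    show "continuous_on {0<..} ?d"
      by (intro continuous_intros continuous_on_cosh_laplace l continuous_on_hitting_average a_nonneg)
    show "\<bar>?d t\<bar> \<le> 3 + 2 * a\<^sup>2" if t: "0 < t" for t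
    proof -
      have "\<bar>cosh_laplace l t - hitting_average a l x0 t\<bar> \<le> 1 + 2 * (1 + a\<^sup>2 * t)"
        using abs_cosh_laplace_le_1[OF l, of t] abs_hitting_average_le[OF a_nonneg l t, of x0] by linarith
      then have "exp (- t) * \<bar>cosh_laplace l t - hitting_average a l x0 t\<bar> \<le> exp (- t) * (1 + 2 * (1 + a\<^sup>2 * t))"
        by (intro mult_left_mono) auto
      also have "\<dots> = 3 * exp (- t) + 2 * a\<^sup>2 * (t ^ 1 * exp (- t))" by (simp add: algebra_simps)
      also have "\<dots> \<le> 3 * 1 + 2 * a\<^sup>2 * fact 1"
        using t by (intro add_mono mult_left_mono power_exp_le) auto
      finally show ?thesis by (simp add: abs_mult)
    qed
    fix n :: nat
    \<comment> \<open>\<open>Suc n\<close> plus one from the factor \<open>exp (- t)\<close>.\<close>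
    define c where "c = real n + 2"
    have c: "0 < c" by (simp add: c_def)
    have ec: "exp (- real (Suc n) * t) * exp (- t) = exp (- c * t)" for t
      by (simp add: c_def algebra_simps flip: exp_add)
    note H = hitting_average_laplace[OF a_nonneg l c, of x0]
    have ed: "AE t in lborel. exponential_density c t * cosh_laplace l t = indicator {0<..} t * (c * (exp (- c * t) * cosh_laplace l t))"
      using AE_lborel_singleton[of "0 :: real"]
      by eventually_elim (auto simp: exponential_density_def indicator_def mult_ac)
    have iL: "set_integrable lborel {0<..} (\<lambda>t. exp (- c * t) * cosh_laplace l t)"
      unfolding set_integrable_def
    proof (rule Bochner_Integration.integrable_bound[OF exponential_tail(1)[OF c, of 0]])
      show "AE t in lborel. norm (indicator {0<..} t *\<^sub>R (exp (- c * t) * cosh_laplace l t)) \<le> norm (indicator {0..} t * (c * exp (- c * t)))"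
      proof (intro AE_I2)
        fix t
        have "exp (- c * t) * \<bar>cosh_laplace l t\<bar> \<le> exp (- c * t) * c"
          using abs_cosh_laplace_le_1[OF l, of t] by (intro mult_left_mono) (auto simp: c_def)
        then show "norm (indicator {0<..} t *\<^sub>R (exp (- c * t) * cosh_laplace l t)) \<le> norm (indicator {0..} t * (c * exp (- c * t)))"
          using c by (auto simp: abs_mult indicator_def mult_ac)
      qed
    qed measurable
    have "c * (LINT t:{0<..}|lborel. exp (- c * t) * cosh_laplace l t) = (\<integral>t. indicator {0<..} t * (c * (exp (- c * t) * cosh_laplace l t)) \<partial>lborel)"
      unfolding set_lebesgue_integral_def by (subst integral_mult_right_zero[symmetric]) (simp add: mult.left_commute)
    also have "\<dots> = (\<integral>t. exponential_density c t * cosh_laplace l t \<partial>lborel)"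
      using ed by (intro integral_cong_AE) auto
    also have "\<dots> = c * (LINT t:{0<..}|lborel. exp (- c * t) * hitting_average a l x0 t)"
      unfolding cosh_laplace_time_transform[OF c l] H(2) ..
    finally have eq: "(LINT t:{0<..}|lborel. exp (- c * t) * cosh_laplace l t) = (LINT t:{0<..}|lborel. exp (- c * t) * hitting_average a l x0 t)"
      using c by simp
    have "(LINT t:{0<..}|lborel. exp (- real (Suc n) * t) * ?d t) =
      (LINT t:{0<..}|lborel. exp (- c * t) * cosh_laplace l t - exp (- c * t) * hitting_average a l x0 t)"
      unfolding mult.assoc[symmetric] ec right_diff_distrib ..
    also have "\<dots> = 0"
      using set_integral_diff(2)[OF iL H(1)] eq by simp
    finally show "(LINT t:{0<..}|lborel. exp (- real (Suc n) * t) * ?d t) = 0" .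
  qed
  then show ?thesis by simp
qed

end

section \<open>The expectation over two independent Brownian motions\<close>

text \<open>The Gaussian factor of \<open>B\<^sub>t\<close> is cancelled by \<open>exp (z\<^sup>2/2t)\<close>; what remains of the densities is a hitting density.\<close>

lemma hitting_density_normal:
  assumes "0 < t"
  shows "sqrt (2 * pi) / sqrt t * (normal_density 0 (sqrt t) v * normal_density 0 (sqrt t) z * (v * exp (z\<^sup>2 / (2 * t)))) = hitting_density v t"
proof -
  have p: "0 < sqrt (2 * pi)" "0 < sqrt t" "sqrt t * sqrt t = t" using assms by auto
  have nd: "normal_density 0 (sqrt t) u = exp (- u\<^sup>2 / (2 * t)) / (sqrt (2 * pi) * sqrt t)" for u
    using assms by (simp add: normal_density_def real_sqrt_mult)
  have "normal_density 0 (sqrt t) v * normal_density 0 (sqrt t) z * (v * exp (z\<^sup>2 / (2 * t)))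
    = v * exp (- v\<^sup>2 / (2 * t)) * (exp (- z\<^sup>2 / (2 * t)) * exp (z\<^sup>2 / (2 * t))) / ((sqrt (2 * pi) * sqrt t) * (sqrt (2 * pi) * sqrt t))"
    unfolding nd by (simp add: mult_ac)
  also have "exp (- z\<^sup>2 / (2 * t)) * exp (z\<^sup>2 / (2 * t)) = 1" by (simp flip: exp_add)
  finally have e: "normal_density 0 (sqrt t) v * normal_density 0 (sqrt t) z * (v * exp (z\<^sup>2 / (2 * t)))
    = v * exp (- v\<^sup>2 / (2 * t)) / ((sqrt (2 * pi) * sqrt t) * (sqrt (2 * pi) * sqrt t))" by simp
  have gen: "r / q * (X / ((r * q) * (r * q))) = X / (r * (q * q) * q)" if "0 < r" "0 < q" for r q X :: real
    using that by (simp add: divide_simps)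
  show ?thesis
    unfolding e gen[OF p(1,2)] p(3) hitting_density_def by simp
qed

lemma (in prob_space) bessel_expectation_eq_hitting_average:
  assumes V: "distributed M lborel V (normal_density 0 (sqrt t))"
    and B: "distributed M lborel B (normal_density 0 (sqrt t))"
    and indep: "indep_var borel V borel B"
    and t: "0 < t" and a: "0 \<le> a" and l: "0 < l"
  shows "integrable M (\<lambda>\<omega>. of_bool (V \<omega> \<ge> \<bar>B \<omega>\<bar>) * V \<omega> * bessel_h a l t (B \<omega>) x * bessel_J 0 (l * bessel_phi (B \<omega>) (V \<omega>)))"
    "sqrt (2 * pi) / sqrt t * exp (- (a\<^sup>2 * t / 2)) *
      expectation (\<lambda>\<omega>. of_bool (V \<omega> \<ge> \<bar>B \<omega>\<bar>) * V \<omega> * bessel_h a l t (B \<omega>) x * bessel_J 0 (l * bessel_phi (B \<omega>) (V \<omega>))) =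
     hitting_average a l x t"
proof -
  let ?n = "normal_density 0 (sqrt t)"
  define G where "G v z = of_bool (\<bar>z\<bar> \<le> v) * (v * exp (z\<^sup>2 / (2 * t) + a * z - l * cosh x * exp z) * wave_kernel l v z)" for v z
  define S where "S v z = of_bool (\<bar>z\<bar> \<le> v) * (exp (a * z) * exp (- l * exp z * cosh x) * wave_kernel l v z)" for v z
  have G: "of_bool (v \<ge> \<bar>z\<bar>) * v * bessel_h a l t z x * bessel_J 0 (l * bessel_phi z v) = G v z" for v z
    by (cases "\<bar>z\<bar> \<le> v") (simp_all add: G_def bessel_h_def wave_kernel_eq_bessel_J mult_ac)
  have [measurable]: "(\<lambda>p. G (fst p) (snd p)) \<in> borel_measurable (lborel \<Otimes>\<^sub>M lborel)"
    unfolding G_def by measurable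
  have [measurable]: "(\<lambda>p. S (fst p) (snd p)) \<in> borel_measurable (lborel \<Otimes>\<^sub>M lborel)"
    unfolding S_def by measurable
  have indep': "indep_var lborel V lborel B"
    using indep unfolding indep_var_eq by simp
  have J: "distributed M (lborel \<Otimes>\<^sub>M lborel) (\<lambda>\<omega>. (V \<omega>, B \<omega>)) (\<lambda>(v, z). ennreal (?n v) * ennreal (?n z))"
    by (rule distributed_joint_indep[OF sigma_finite_lborel sigma_finite_lborel V B indep'])
  have J': "distributed M (lborel \<Otimes>\<^sub>M lborel) (\<lambda>\<omega>. (V \<omega>, B \<omega>)) (\<lambda>p. ennreal (?n (fst p) * ?n (snd p)))"
    using J unfolding case_prod_beta by (simp add: ennreal_mult)
  let ?k = "sqrt (2 * pi) / sqrt t"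
  have k0: "?k \<noteq> 0" using t by simp
  have dens: "?k * (?n v * ?n z * G v z) = hitting_density v t * S v z" for v z
  proof -
    have ex: "exp (z\<^sup>2 / (2 * t) + a * z - l * cosh x * exp z) = exp (z\<^sup>2 / (2 * t)) * (exp (a * z) * exp (- l * exp z * cosh x))"
      by (simp add: algebra_simps flip: exp_add)
    have "?k * (?n v * ?n z * G v z) = (?k * (?n v * ?n z * (v * exp (z\<^sup>2 / (2 * t))))) * S v z"
      unfolding G_def S_def ex by (simp add: mult_ac)
    then show ?thesis unfolding hitting_density_normal[OF t] .
  qed
  have int: "integrable (lborel \<Otimes>\<^sub>M lborel) (\<lambda>(v, z). hitting_density v t * S v z)"
  proof (rule Bochner_Integration.integrable_bound)
    let ?w = "\<lambda>v z. hitting_density v t * (indicator {-v..v} z * exp (a * v))"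
    have wnn: "0 \<le> ?w v z" for v z
      using t by (cases "0 \<le> v") (auto simp: hitting_density_def indicator_def)
    have w_int: "(\<integral>z. norm (?w v z) \<partial>lborel) = 2 * (indicator {0..} v * (hitting_density v t * (v * exp (a * v))))" for v
    proof -
      have "(\<integral>z. norm (?w v z) \<partial>lborel) = (\<integral>z. ?w v z \<partial>lborel)"
        using wnn by (intro Bochner_Integration.integral_cong) auto
      also have "\<dots> = hitting_density v t * ((\<integral>z. indicator {-v..v} z \<partial>lborel) * exp (a * v))"
        by simp
      also have "\<dots> = 2 * (indicator {0..} v * (hitting_density v t * (v * exp (a * v))))"
        by (cases "0 \<le> v") auto
      finally show ?thesis .
    qed
    show "integrable (lborel \<Otimes>\<^sub>M lborel) (\<lambda>(v, z). ?w v z)"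
    proof (rule lborel_pair.Fubini_integrable)
      have "(\<lambda>(v, z). hitting_density v t * (of_bool (\<bar>z\<bar> \<le> v) * exp (a * v))) \<in> borel_measurable (lborel \<Otimes>\<^sub>M lborel)"
        unfolding case_prod_beta by measurable
      moreover have "(\<lambda>(v, z). ?w v z) = (\<lambda>(v, z). hitting_density v t * (of_bool (\<bar>z\<bar> \<le> v) * exp (a * v)))"
        by (auto simp: fun_eq_iff indicator_def)
      ultimately show "(\<lambda>(v, z). ?w v z) \<in> borel_measurable (lborel \<Otimes>\<^sub>M lborel)" by simp
      have "integrable lborel (\<lambda>v. indicator {0..} v *\<^sub>R (hitting_density v t * (v * exp (a * v))))"
        by (intro integrable_mult_indicator hitting_density_moment t) simp
      then show "integrable lborel (\<lambda>v. \<integral>z. norm (case (v, z) of (v, z) \<Rightarrow> ?w v z) \<partial>lborel)"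
        unfolding prod.case w_int by (intro integrable_mult_right) simp
      show "AE v in lborel. integrable lborel (\<lambda>z. case (v, z) of (v, z) \<Rightarrow> ?w v z)"
        unfolding prod.case
        by (intro AE_I2 integrable_mult_right integrable_on_interval)
    qed
    show "(\<lambda>(v, z). hitting_density v t * S v z) \<in> borel_measurable (lborel \<Otimes>\<^sub>M lborel)"
      unfolding case_prod_beta by measurable
    show "AE p in lborel \<Otimes>\<^sub>M lborel. norm (case p of (v, z) \<Rightarrow> hitting_density v t * S v z) \<le> norm (case p of (v, z) \<Rightarrow> ?w v z)"
    proof (intro AE_I2, clarify)
      fix v z
      have le: "\<bar>S v z\<bar> \<le> indicator {-v..v} z * exp (a * v)"
        unfolding S_def by (rule wave_source_integrand_bound[OF a l])
      show "norm (hitting_density v t * S v z) \<le> norm (?w v z)"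
        unfolding real_norm_def abs_mult[of "hitting_density v t"]
        by (rule mult_left_mono[OF order_trans[OF le abs_ge_self] abs_ge_zero])
    qed
  qed
  have int': "integrable (lborel \<Otimes>\<^sub>M lborel) (\<lambda>p. ?n (fst p) * ?n (snd p) * G (fst p) (snd p))"
  proof -
    have "integrable (lborel \<Otimes>\<^sub>M lborel) (\<lambda>p. ?k * (?n (fst p) * ?n (snd p) * G (fst p) (snd p)))"
      unfolding dens using int unfolding case_prod_beta .
    then show ?thesis using k0 by (simp only: integrable_mult_left_iff) simp
  qed
  have nn: "0 \<le> ?n (fst p) * ?n (snd p)" for p by simp
  have GM: "integrable M (\<lambda>\<omega>. G (V \<omega>) (B \<omega>))"
    "expectation (\<lambda>\<omega>. G (V \<omega>) (B \<omega>)) = (\<integral>p. ?n (fst p) * ?n (snd p) * G (fst p) (snd p) \<partial>(lborel \<Otimes>\<^sub>M lborel))"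
    using distributed_integrable[OF J', of "\<lambda>p. G (fst p) (snd p)"] distributed_integral[OF J', of "\<lambda>p. G (fst p) (snd p)"] int'
    by simp_all
  show "integrable M (\<lambda>\<omega>. of_bool (V \<omega> \<ge> \<bar>B \<omega>\<bar>) * V \<omega> * bessel_h a l t (B \<omega>) x * bessel_J 0 (l * bessel_phi (B \<omega>) (V \<omega>)))"
    unfolding G by (rule GM)
  have "?k * expectation (\<lambda>\<omega>. G (V \<omega>) (B \<omega>)) = (\<integral>p. ?k * (?n (fst p) * ?n (snd p) * G (fst p) (snd p)) \<partial>(lborel \<Otimes>\<^sub>M lborel))"
    unfolding GM by (rule integral_mult_right_zero[symmetric])
  also have "\<dots> = (\<integral>(v, z). hitting_density v t * S v z \<partial>(lborel \<Otimes>\<^sub>M lborel))"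
    unfolding dens case_prod_beta ..
  also have "\<dots> = (\<integral>v. \<integral>z. hitting_density v t * S v z \<partial>lborel \<partial>lborel)"
    by (rule lborel_pair.integral_fst[OF int, symmetric])
  also have "\<dots> = (\<integral>v. hitting_density v t * wave_source a l x v \<partial>lborel)"
    unfolding integral_mult_right_zero S_def wave_source_def ..
  finally have fin: "?k * expectation (\<lambda>\<omega>. G (V \<omega>) (B \<omega>)) = (\<integral>v. hitting_density v t * wave_source a l x v \<partial>lborel)" .
  have "?k * exp (- (a\<^sup>2 * t / 2)) * expectation (\<lambda>\<omega>. G (V \<omega>) (B \<omega>)) = exp (- (a\<^sup>2 * t / 2)) * (?k * expectation (\<lambda>\<omega>. G (V \<omega>) (B \<omega>)))"
    by (simp only: mult_ac)
  then show "?k * exp (- (a\<^sup>2 * t / 2)) *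
      expectation (\<lambda>\<omega>. of_bool (V \<omega> \<ge> \<bar>B \<omega>\<bar>) * V \<omega> * bessel_h a l t (B \<omega>) x * bessel_J 0 (l * bessel_phi (B \<omega>) (V \<omega>))) =
     hitting_average a l x t"
    unfolding G hitting_average_def fin .
qed

section \<open>Brownian motions and hyperbolic Bessel processes\<close>

lemma filtered_prob_spaceD:
  assumes "filtered_prob_space M F"
  shows "prob_space M" "\<And>t. 0 \<le> t \<Longrightarrow> space (F t) = space M" "\<And>t. 0 \<le> t \<Longrightarrow> sets (F t) \<subseteq> sets M"
    "\<And>s t. 0 \<le> s \<Longrightarrow> s \<le> t \<Longrightarrow> sets (F s) \<subseteq> sets (F t)"
    "0 \<le> t \<Longrightarrow> f \<in> borel_measurable (F t) \<Longrightarrow> f \<in> borel_measurable M"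
proof -
  show "prob_space M" using assms by (simp add: filtered_prob_space_def)
  show S: "0 \<le> t \<Longrightarrow> sets (F t) \<subseteq> sets M" for t
    using assms by (simp add: filtered_prob_space_def)
  interpret filtration "space M" "\<lambda>t. F (max 0 t)" using assms by (simp add: filtered_prob_space_def)
  show sp: "0 \<le> t \<Longrightarrow> space (F t) = space M" for t using space_F[of t] by simp
  show "0 \<le> s \<Longrightarrow> s \<le> t \<Longrightarrow> sets (F s) \<subseteq> sets (F t)" for s t using sets_F_mono[of s t] by simp
  show "f \<in> borel_measurable M" if "0 \<le> t" "f \<in> borel_measurable (F t)"
    by (rule borel_measurable_subalgebra[OF S[OF that(1)] sp[OF that(1)] that(2)])
qed

lemma brownian_motion_increment_indep:
  assumes bm: "brownian_motion_wrt M F W" and st: "0 \<le> s" "s < t" and Y: "Y \<in> borel_measurable (F s)"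
  shows "prob_space.indep_var M borel Y borel (\<lambda>\<omega>. W t \<omega> - W s \<omega> :: real)"
proof -
  have fp: "filtered_prob_space M F" using bm by (simp add: brownian_motion_wrt_def)
  note F = filtered_prob_spaceD[OF fp]
  interpret prob_space M by (rule F)
  let ?G = "\<lambda>\<omega>. W t \<omega> - W s \<omega>"
  have W: "W u \<in> borel_measurable M" if "0 \<le> u" for u
    using bm that F(5)[OF that, of "W u"] unfolding brownian_motion_wrt_def adapted_process_def by blast
  have G: "?G \<in> borel_measurable M"
    using st by (intro borel_measurable_diff W) simp_all
  have ind: "indep_set (sets (F s)) (sets (vimage_algebra (space M) ?G borel))"
    using bm st unfolding brownian_motion_wrt_def by blast
  have 1: "sigma_sets (space M) {Y -` A \<inter> space M |A. A \<in> sets borel} \<subseteq> sets (F s)"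
  proof -
    have "{Y -` A \<inter> space M |A. A \<in> sets borel} \<subseteq> sets (F s)"
      using measurable_sets[OF Y] F(2)[OF st(1)] by auto
    from sets.sigma_sets_subset[OF this] show ?thesis using F(2)[OF st(1)] by simp
  qed
  have 2: "sigma_sets (space M) {?G -` A \<inter> space M |A. A \<in> sets borel} = sets (vimage_algebra (space M) ?G borel)"
    by (rule sets_vimage_algebra[symmetric])
  have "indep_set (sigma_sets (space M) {Y -` A \<inter> space M |A. A \<in> sets borel}) (sigma_sets (space M) {?G -` A \<inter> space M |A. A \<in> sets borel})"
    using ind unfolding 2 indep_set_def by (rule indep_sets_mono_sets) (use 1 in \<open>simp split: bool.split\<close>)
  then show ?thesis
    unfolding indep_var_eq using F(5)[OF st(1) Y] G by simp
qed

lemma standard_brownian_motion_normal: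
  assumes bm: "standard_brownian_motion N V" and t: "0 < t"
  shows "distributed N lborel (V t) (normal_density 0 (sqrt t))"
proof -
  let ?F = "natural_filtration N V"
  have bm': "brownian_motion_wrt N ?F V" using bm by (simp add: standard_brownian_motion_def)
  then have fp: "filtered_prob_space N ?F" by (simp add: brownian_motion_wrt_def)
  note F = filtered_prob_spaceD[OF fp]
  interpret prob_space N by (rule F)
  have m: "V u \<in> borel_measurable N" if "0 \<le> u" for u
    using bm' F(5)[OF that] that by (auto simp: brownian_motion_wrt_def adapted_process_def)
  then have mt: "V t \<in> borel_measurable N" using t by simp
  have d: "distributed N lborel (\<lambda>\<omega>. V t \<omega> - V 0 \<omega>) (normal_density 0 (sqrt t))"
  proof -
    have "\<forall>s t. 0 \<le> s \<longrightarrow> s < t \<longrightarrow> distributed N lborel (\<lambda>\<omega>. V t \<omega> - V s \<omega>) (normal_density 0 (sqrt (t - s)))"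
      using bm' unfolding brownian_motion_wrt_def by blast
    from this[rule_format, of 0 t] show ?thesis using t by simp
  qed
  have "AE \<omega> in N. V t \<omega> - V 0 \<omega> = V t \<omega>"
    using bm' by (auto simp: brownian_motion_wrt_def elim: eventually_mono)
  then have "distr N lborel (\<lambda>\<omega>. V t \<omega> - V 0 \<omega>) = distr N lborel (V t)"
    using m[of 0] mt by (intro distr_cong_AE) auto
  then show ?thesis
    using d mt by (simp add: distributed_def)
qed

lemma indep_processes_at:
  assumes "prob_space N" "indep_processes N V B" "0 \<le> t"
  shows "prob_space.indep_var N borel (V t) borel (B t)"
proof -
  interpret prob_space N by fact
  have "indep_var (\<Pi>\<^sub>M t\<in>{0..}. borel) (\<lambda>\<omega>. \<lambda>t\<in>{0..}. V t \<omega>) (\<Pi>\<^sub>M t\<in>{0..}. borel) (\<lambda>\<omega>. \<lambda>t\<in>{0..}. B t \<omega>)"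
    using assms by (simp add: indep_processes_def)
  moreover have "(\<lambda>f. f t) \<in> measurable (\<Pi>\<^sub>M t\<in>{0..}. borel) (borel :: real measure)"
    using assms(3) by (intro measurable_component_singleton) simp
  ultimately have "indep_var borel ((\<lambda>f. f t) \<circ> (\<lambda>\<omega>. \<lambda>t\<in>{0..}. V t \<omega>)) borel ((\<lambda>f. f t) \<circ> (\<lambda>\<omega>. \<lambda>t\<in>{0..}. B t \<omega>))"
    by (intro indep_var_compose)
  then show ?thesis using assms(3) by (simp add: comp_def)
qed

lemma drift_equation_cong:
  fixes \<beta> \<beta>' y z :: "real \<Rightarrow> real"
  assumes eq: "\<And>u. 0 \<le> u \<Longrightarrow> \<beta> u = \<beta>' u"
    and drift: "\<forall>t\<ge>0. set_integrable lborel {0..t} \<beta>' \<and> z t = y t + (LINT u:{0..t}|lborel. \<beta>' u)"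
  shows "\<forall>t\<ge>0. set_integrable lborel {0..t} \<beta> \<and> z t = y t + (LINT u:{0..t}|lborel. \<beta> u)"
proof (intro allI impI)
  fix t :: real assume t: "0 \<le> t"
  have i: "set_integrable lborel {0..t} \<beta> = set_integrable lborel {0..t} \<beta>'"
    using eq by (intro set_integrable_cong) auto
  have j: "(LINT u:{0..t}|lborel. \<beta> u) = (LINT u:{0..t}|lborel. \<beta>' u)"
    using eq by (intro set_lebesgue_integral_cong) auto
  show "set_integrable lborel {0..t} \<beta> \<and> z t = y t + (LINT u:{0..t}|lborel. \<beta> u)"
    unfolding i j using drift t by blast
qed

lemma coth_drift_facts:
  assumes "0 \<le> a"
  shows "(\<lambda>r. a * coth \<bar>r\<bar>) \<in> borel_measurable borel" "0 \<le> a * coth \<bar>r\<bar>"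
proof -
  show "(\<lambda>r. a * coth \<bar>r\<bar>) \<in> borel_measurable borel"
    unfolding coth_def by measurable
  show "0 \<le> a * coth \<bar>r\<bar>"
    using assms unfolding coth_def by (intro mult_nonneg_nonneg divide_nonneg_nonneg) (auto simp: cosh_real_nonneg)
qed

text \<open>
  One form for all indices: \<open>Z = x + W\<close> for \<open>\<alpha> = - 1/2\<close>, where the drift coefficient is \<open>0\<close> and \<open>R = \<bar>Z\<bar>\<close> has the
  same hyperbolic cosine, and \<open>Z = R\<close> otherwise. The equations for \<open>\<alpha> < 0\<close> and \<open>\<alpha> \<ge> 0\<close> agree because
  \<open>coth 0 = 0\<close> by the convention on division by zero.
\<close>

lemma hyperbolic_bessel_signed_solution:
  assumes bm: "brownian_motion_wrt M F W" and \<alpha>: "\<alpha> \<ge> - 1 / 2"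
    and hb: "hyperbolic_bessel_process M F W \<alpha> x R"
  shows "\<exists>Z. adapted_process F Z \<and> (AE \<omega> in M. continuous_on {0..} (\<lambda>t. Z t \<omega>)) \<and>
    (AE \<omega> in M. \<forall>t\<ge>0. set_integrable lborel {0..t} (\<lambda>u. (\<alpha> + 1 / 2) * coth \<bar>Z u \<omega>\<bar>) \<and>
       Z t \<omega> = x + W t \<omega> + (LINT u:{0..t}|lborel. (\<alpha> + 1 / 2) * coth \<bar>Z u \<omega>\<bar>)) \<and>
    (0 < \<alpha> + 1 / 2 \<longrightarrow> (AE \<omega> in M. AE u in lborel. 0 \<le> u \<longrightarrow> 0 < Z u \<omega>)) \<and>
    (AE \<omega> in M. \<forall>t\<ge>0. cosh (R t \<omega>) = cosh (Z t \<omega>))"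
proof (cases "\<alpha> = - 1 / 2")
  case True
  let ?Z = "\<lambda>t \<omega>. x + W t \<omega>"
  have R: "AE \<omega> in M. \<forall>t\<ge>0. R t \<omega> = \<bar>x + W t \<omega>\<bar>"
    using hb True by (simp add: hyperbolic_bessel_process_def)
  have W: "adapted_process F W" "AE \<omega> in M. continuous_on {0..} (\<lambda>t. W t \<omega>)"
    using bm unfolding brownian_motion_wrt_def by blast+
  have "adapted_process F ?Z"
    using W(1) unfolding adapted_process_def by (intro allI impI borel_measurable_add) auto
  moreover have "AE \<omega> in M. continuous_on {0..} (\<lambda>t. ?Z t \<omega>)"
    using W(2) by eventually_elim (intro continuous_intros)
  moreover have "AE \<omega> in M. \<forall>t\<ge>0. set_integrable lborel {0..t} (\<lambda>u. (\<alpha> + 1 / 2) * coth \<bar>?Z u \<omega>\<bar>) \<and>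
       ?Z t \<omega> = x + W t \<omega> + (LINT u:{0..t}|lborel. (\<alpha> + 1 / 2) * coth \<bar>?Z u \<omega>\<bar>)"
    using True by (simp add: set_integrable_def set_lebesgue_integral_def)
  moreover have "AE \<omega> in M. \<forall>t\<ge>0. cosh (R t \<omega>) = cosh (?Z t \<omega>)"
    using R by eventually_elim simp
  ultimately show ?thesis using True by (intro exI[of _ ?Z]) simp
next
  case False
  let ?b = "\<lambda>r. (\<alpha> + 1 / 2) * coth r"
  have z: "of_bool (r \<noteq> 0) * coth r = coth r" for r by (simp add: coth_def)
  have ad: "adapted_process F R" and nn: "AE \<omega> in M. continuous_on {0..} (\<lambda>t. R t \<omega>) \<and> (\<forall>t\<ge>0. 0 \<le> R t \<omega>)"
    using hb unfolding hyperbolic_bessel_process_def by blast+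
  have nt: "null_time_at_zero M R" and sde: "solves_drift_equation M W ?b x R"
    using hb False unfolding hyperbolic_bessel_process_def z by (auto split: if_splits)
  have "AE \<omega> in M. continuous_on {0..} (\<lambda>t. R t \<omega>)" using nn by eventually_elim simp
  moreover have "AE \<omega> in M. \<forall>t\<ge>0. set_integrable lborel {0..t} (\<lambda>u. ?b \<bar>R u \<omega>\<bar>) \<and>
       R t \<omega> = x + W t \<omega> + (LINT u:{0..t}|lborel. ?b \<bar>R u \<omega>\<bar>)"
    using nn sde[unfolded solves_drift_equation_def]
  proof eventually_elim
    case (elim \<omega>)
    show ?case
      by (rule drift_equation_cong[OF _ elim(2)]) (use elim(1) in simp)
  qed
  moreover have "AE \<omega> in M. AE u in lborel. 0 \<le> u \<longrightarrow> 0 < R u \<omega>"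
    using nn nt[unfolded null_time_at_zero_def]
  proof eventually_elim
    case (elim \<omega>)
    from elim(2) show ?case
      by eventually_elim (use elim(1) in \<open>auto simp: order_less_le\<close>)
  qed
  ultimately show ?thesis using ad by (intro exI[of _ R]) simp
qed

text \<open>
  The paths are made continuous everywhere by replacing those in a null set with constants. Since null sets belong
  to every \<open>F s\<close>, the modified process is still adapted, and so its values remain independent of later increments of
  the driving Brownian motion.
\<close>

lemma hyperbolic_bessel_coth_diffusion:
  assumes fp: "filtered_prob_space M F" and usual: "usual_conditions M F"
    and bm: "brownian_motion_wrt M F W" and \<alpha>: "\<alpha> \<ge> - 1 / 2"
    and hb: "hyperbolic_bessel_process M F W \<alpha> x R"
  obtains X where "coth_diffusion M X W (\<alpha> + 1 / 2) x" "AE \<omega> in M. \<forall>t\<ge>0. cosh (R t \<omega>) = cosh (X \<omega> t)"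
proof -
  let ?a = "\<alpha> + 1 / 2"
  let ?b = "\<lambda>r. ?a * coth \<bar>r\<bar>"
  have a: "0 \<le> ?a" using \<alpha> by simp
  note F = filtered_prob_spaceD[OF fp]
  interpret prob_space M by (rule F)
  obtain Z where Z: "adapted_process F Z" "AE \<omega> in M. continuous_on {0..} (\<lambda>t. Z t \<omega>)"
    "AE \<omega> in M. \<forall>t\<ge>0. set_integrable lborel {0..t} (\<lambda>u. ?b (Z u \<omega>)) \<and>
       Z t \<omega> = x + W t \<omega> + (LINT u:{0..t}|lborel. ?b (Z u \<omega>))"
    "0 < ?a \<Longrightarrow> AE \<omega> in M. AE u in lborel. 0 \<le> u \<longrightarrow> 0 < Z u \<omega>"
    "AE \<omega> in M. \<forall>t\<ge>0. cosh (R t \<omega>) = cosh (Z t \<omega>)"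
    using hyperbolic_bessel_signed_solution[OF bm \<alpha> hb] by blast
  from Z(2) obtain N where N: "{\<omega> \<in> space M. \<not> continuous_on {0..} (\<lambda>t. Z t \<omega>)} \<subseteq> N" "emeasure M N = 0" "N \<in> sets M"
    by (rule AE_E)
  define X where "X \<omega> u = (if \<omega> \<in> space M - N then Z (max 0 u) \<omega> else x)" for \<omega> u
  have nullN: "N \<in> null_sets M" using N by auto
  have NF: "N \<in> sets (F s)" if "0 \<le> s" for s
    using usual nullN F(4)[OF order_refl that] unfolding usual_conditions_def by blast
  have XF: "(\<lambda>\<omega>. X \<omega> s) \<in> borel_measurable (F s)" if s: "0 \<le> s" for s
  proof -
    have "Z s \<in> borel_measurable (F s)" using Z(1) s by (simp add: adapted_process_def)
    moreover have "{\<omega> \<in> space (F s). \<omega> \<in> space M - N} \<in> sets (F s)"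
    proof -
      have "{\<omega> \<in> space (F s). \<omega> \<in> space M - N} = space (F s) - N" using F(2)[OF s] by auto
      then show ?thesis using NF[OF s] by simp
    qed
    ultimately have "(\<lambda>\<omega>. if \<omega> \<in> space M - N then Z s \<omega> else x) \<in> borel_measurable (F s)"
      by (intro measurable_If borel_measurable_const)
    then show ?thesis unfolding X_def max_absorb2[OF s] .
  qed
  have XZ: "AE \<omega> in M. \<forall>u\<ge>0. X \<omega> u = Z u \<omega>"
    using AE_not_in[OF nullN] AE_space by eventually_elim (simp add: X_def)
  have clamp: "X \<omega> u = X \<omega> (max 0 u)" for \<omega> u by (simp add: X_def)
  have W: "adapted_process F W" "AE \<omega> in M. W 0 \<omega> = 0"
    "\<And>s t. 0 \<le> s \<Longrightarrow> s < t \<Longrightarrow> distributed M lborel (\<lambda>\<omega>. W t \<omega> - W s \<omega>) (normal_density 0 (sqrt (t - s)))"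
    using bm unfolding brownian_motion_wrt_def by blast+
  have drift': "AE \<omega> in M. \<forall>t\<ge>0. set_integrable lborel {0..t} (\<lambda>u. ?b (X \<omega> u)) \<and>
       X \<omega> t = x + W t \<omega> + (LINT u:{0..t}|lborel. ?b (X \<omega> u))"
    using XZ Z(3)
  proof eventually_elim
    case (elim \<omega>)
    have "\<forall>t\<ge>0. set_integrable lborel {0..t} (\<lambda>u. ?b (X \<omega> u)) \<and>
       Z t \<omega> = x + W t \<omega> + (LINT u:{0..t}|lborel. ?b (X \<omega> u))"
      by (rule drift_equation_cong[OF _ elim(2)]) (use elim(1) in simp)
    then show ?case using elim(1) by simp
  qed
  have "coth_diffusion M X W ?a x"
  proof
    show "continuous_on UNIV (X \<omega>)" for \<omega>
    proof (cases "\<omega> \<in> space M - N")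
      case True
      then have "continuous_on {0..} (\<lambda>t. Z t \<omega>)" using N(1) by auto
      then have "continuous_on UNIV (\<lambda>u. Z (max 0 u) \<omega>)"
        by (rule continuous_on_compose2[of _ "\<lambda>t. Z t \<omega>"]) (auto intro!: continuous_intros)
      then show ?thesis using True by (simp add: X_def[abs_def])
    next
      case False
      have "X \<omega> = (\<lambda>u. x)" using False by (auto simp: X_def fun_eq_iff)
      then show ?thesis by (simp only: continuous_on_const)
    qed
    show "(\<lambda>\<omega>. X \<omega> u) \<in> borel_measurable M" for u
      using F(5)[OF _ XF, of "max 0 u"] by (subst clamp) simp
    show "W u \<in> borel_measurable M" if "0 \<le> u" for u
      using F(5)[OF that, of "W u"] W(1) that by (simp add: adapted_process_def)
    show "?b \<in> borel_measurable borel" by (rule coth_drift_facts[OF a])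
    show "0 \<le> ?b r" for r by (rule coth_drift_facts[OF a])
    show "indep_var borel (\<lambda>\<omega>. X \<omega> s) borel (\<lambda>\<omega>. W t \<omega> - W s \<omega>)" if "0 \<le> s" "s < t" for s t
      by (rule brownian_motion_increment_indep[OF bm that XF[OF that(1)]])
    show "distributed M lborel (\<lambda>\<omega>. W t \<omega> - W s \<omega>) (normal_density 0 (sqrt (t - s)))" if "0 \<le> s" "s < t" for s t
      by (rule W(3)[OF that])
    show "AE \<omega> in M. X \<omega> 0 = x"
      using drift' W(2)
    proof eventually_elim
      case (elim \<omega>)
      have "(LINT u:{0..0}|lborel. ?b (X \<omega> u)) = 0"
        unfolding set_lebesgue_integral_def
      proof (rule integral_eq_zero_AE)
        show "AE u in lborel. indicat_real {0..0} u *\<^sub>R ?b (X \<omega> u) = 0"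
          using AE_lborel_singleton[of "0 :: real"] by eventually_elim simp
      qed
      then show ?case using elim(1)[rule_format, of 0] elim(2) by linarith
    qed
    show "AE \<omega> in M. \<forall>t\<ge>0. set_integrable lborel {0..t} (\<lambda>u. ?b (X \<omega> u)) \<and>
       X \<omega> t = x + W t \<omega> + (LINT u:{0..t}|lborel. ?b (X \<omega> u))" by (rule drift')
    show "0 \<le> ?a" by (rule a)
    show "AE \<omega> in M. AE u in lborel. 0 \<le> u \<longrightarrow> 0 < X \<omega> u" if "0 < ?a"
      using Z(4)[OF that] XZ
    proof eventually_elim
      case (elim \<omega>)
      from elim(1) show ?case by eventually_elim (use elim(2) in simp)
    qed
  qed
  moreover have "AE \<omega> in M. \<forall>t\<ge>0. cosh (R t \<omega>) = cosh (X \<omega> t)"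
    using XZ Z(5) by eventually_elim simp
  ultimately show ?thesis by (rule that)
qed

theorem theorem2p8:
  fixes M :: "'a measure" and F :: "real \<Rightarrow> 'a measure"
    and W R :: "real \<Rightarrow> 'a \<Rightarrow> real"
    and N :: "'b measure" and V B :: "real \<Rightarrow> 'b \<Rightarrow> real"
    and \<alpha> a x t l :: real
  assumes "filtered_prob_space M F" and "usual_conditions M F"
    and "brownian_motion_wrt M F W"
    and "\<alpha> \<ge> - 1 / 2" and "x \<ge> 0"
    and "hyperbolic_bessel_process M F W \<alpha> x R"
    and "standard_brownian_motion N V" and "standard_brownian_motion N B"
    and "indep_processes N V B"
    and "t > 0" and "l > 0"
    and "a = \<alpha> + 1 / 2"
  shows "integrable M (\<lambda>\<omega>. exp (- l * cosh (R t \<omega>))) \<and>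
    integrable N (\<lambda>\<omega>. of_bool (V t \<omega> \<ge> \<bar>B t \<omega>\<bar>) * V t \<omega> * bessel_h a l t (B t \<omega>) x *
      bessel_J 0 (l * bessel_phi (B t \<omega>) (V t \<omega>))) \<and>
    prob_space.expectation M (\<lambda>\<omega>. exp (- l * cosh (R t \<omega>))) =
      sqrt (2 * pi) / sqrt t * exp (- (a\<^sup>2 * t / 2)) *
      prob_space.expectation N (\<lambda>\<omega>. of_bool (V t \<omega> \<ge> \<bar>B t \<omega>\<bar>) * V t \<omega> *
        bessel_h a l t (B t \<omega>) x * bessel_J 0 (l * bessel_phi (B t \<omega>) (V t \<omega>)))"
proof (intro conjI)
  note t = \<open>t > 0\<close> and l = \<open>l > 0\<close> and a_def = \<open>a = \<alpha> + 1 / 2\<close>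
  have t0: "0 \<le> t" using t by simp
  have a: "0 \<le> a" using \<open>\<alpha> \<ge> - 1 / 2\<close> by (simp add: a_def)
  note F = filtered_prob_spaceD[OF \<open>filtered_prob_space M F\<close>]
  have N: "prob_space N"
    using \<open>standard_brownian_motion N V\<close> filtered_prob_spaceD(1)
    unfolding standard_brownian_motion_def brownian_motion_wrt_def by blast
  obtain X where X: "coth_diffusion M X W (\<alpha> + 1 / 2) x" "AE \<omega> in M. \<forall>t\<ge>0. cosh (R t \<omega>) = cosh (X \<omega> t)"
    by (rule hyperbolic_bessel_coth_diffusion[OF assms(1-4,6)])
  interpret coth_diffusion M X W a x
    using X(1) unfolding a_def .
  have [measurable]: "R t \<in> borel_measurable M"
    using F(5)[OF t0, of "R t"] assms(6) t0 by (simp add: hyperbolic_bessel_process_def adapted_process_def)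
  show "integrable M (\<lambda>\<omega>. exp (- l * cosh (R t \<omega>)))"
    by (rule integrable_const_bound[where B = 1]) (use l in auto)
  note rhs = prob_space.bessel_expectation_eq_hitting_average[OF N
      standard_brownian_motion_normal[OF assms(7) t] standard_brownian_motion_normal[OF assms(8) t]
      indep_processes_at[OF N assms(9) t0] t a l, of x]
  show "integrable N (\<lambda>\<omega>. of_bool (V t \<omega> \<ge> \<bar>B t \<omega>\<bar>) * V t \<omega> * bessel_h a l t (B t \<omega>) x *
      bessel_J 0 (l * bessel_phi (B t \<omega>) (V t \<omega>)))"
    by (rule rhs(1))
  have "expectation (\<lambda>\<omega>. exp (- l * cosh (R t \<omega>))) = cosh_laplace l t"
    unfolding cosh_laplace_def
  proof (rule integral_cong_AE)
    show "AE \<omega> in M. exp (- l * cosh (R t \<omega>)) = exp (- l * cosh (X \<omega> t))"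
      using X(2) by eventually_elim (use t0 in \<open>simp only:\<close>)
  qed measurable
  also have "\<dots> = hitting_average a l x t"
    by (rule cosh_laplace_eq_hitting_average[OF l t])
  finally show "expectation (\<lambda>\<omega>. exp (- l * cosh (R t \<omega>))) =
      sqrt (2 * pi) / sqrt t * exp (- (a\<^sup>2 * t / 2)) *
      prob_space.expectation N (\<lambda>\<omega>. of_bool (V t \<omega> \<ge> \<bar>B t \<omega>\<bar>) * V t \<omega> *
        bessel_h a l t (B t \<omega>) x * bessel_J 0 (l * bessel_phi (B t \<omega>) (V t \<omega>)))"
    unfolding rhs(2) .
qed

end
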